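(* Let $T$ and $T'$ be complete classical first-order theories in countable languages (satisfying the standing assumptions below), and assume that $T$ and $T'$ are bi-interpretable. Let $\Phi$ be a rich sequence for the language of $T$ and $\Psi$ a rich sequence for the language of $T'$. Then $\mathbf{G}_\Phi(T)$ and $\mathbf{G}_\Psi(T')$ are isomorphic as topological groupoids. In other words, up to isomorphism of topological groupoids, $\mathbf{G}_\Phi(T)$ does not depend on $\Phi$, and depends on $T$ only up to bi-interpretation.
   Context: Standing assumptions: theories are complete classical (two-valued) first-order theories in a countable language; structures are nonempty and no model of the theory is a singleton. For simplicity the language is single-sorted (the multi-sorted case is analogous, with each variable assigned a sort). "Definable" means without parameters. A groupoid is a set $\mathbf{G}$ with a partial associative composition and an inversion $g\mapsto g^{-1}$ such that $g^{-1}g$ and $gg^{-1}$ are always defined and $fgg^{-1}=f$, $f^{-1}fg=g$ whenever $fg$ is defined; $s_g=g^{-1}g$ (source), $t_g=gg^{-1}$ (target), and the base $\mathbf{B}$ is the set of $e$ with $e^2=e$. A topological groupoid is a groupoid with a Hausdorff topology making composition (where defined) and inversion continuous. A sequence $\Phi=(\varphi_n(x_{<n},y):n\in\mathbb{N})$ of formulas, $y$ a single variable, is rich if every formula $\varphi(x_{<k},y)$ appears (with dummy variables) as $\varphi_n$ for some $n\ge k$. Put $D_{\Phi,n}(x_{<n})=\bigwedge_{k<n}\forall y\,[\varphi_k(x_{<k},y)\to\varphi_k(x_{\le k})]$ and $D_\Phi(x)=\bigwedge_n D_{\Phi,n}(x_{<n})$, a partial type in an infinite tuple $x=(x_n)_{n\in\mathbb{N}}$.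 Let $\mathbf{G}_\Phi(T)$ be the set of complete types $\mathrm{tp}(a,b)$ (in the space $S_{2\times\mathbb{N}}(T)$ of types of pairs of $\mathbb{N}$-indexed sequences, with the usual logic topology, and $\mathbf{G}_\Phi(T)$ with the subspace topology) such that $a,b$ both realise $D_\Phi$ and have the same set of entries (this set is then a countable model). Composition is $\mathrm{tp}(a,b)\cdot\mathrm{tp}(b,c)=\mathrm{tp}(a,c)$ (defined when the type of the middle tuple agrees) and inversion $\mathrm{tp}(a,b)^{-1}=\mathrm{tp}(b,a)$; the base consists of the types $\mathrm{tp}(a,a)$. *)

theory Defs
  imports "HOL-Analysis.Analysis"
begin

text \<open>Symbols are natural numbers, so every language is countable.
  A language assigns (partially) arities to relation and function symbols;
  constants are 0-ary function symbols.\<close>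

record lang =
  rel_ar :: "nat \<Rightarrow> nat option"
  fun_ar :: "nat \<Rightarrow> nat option"

datatype trm = Var nat | Fn nat "trm list"

datatype fm =
    Eq trm trm
  | Rel nat "trm list"
  | Neg fm
  | Conj fm fm
  | Ex nat fm

fun wf_trm :: "lang \<Rightarrow> trm \<Rightarrow> bool" where
  "wf_trm L (Var i) = True"
| "wf_trm L (Fn f ts) = (fun_ar L f = Some (length ts) \<and> (\<forall>t\<in>set ts. wf_trm L t))"

fun wf_fm :: "lang \<Rightarrow> fm \<Rightarrow> bool" where
  "wf_fm L (Eq s t) = (wf_trm L s \<and> wf_trm L t)"
| "wf_fm L (Rel r ts) = (rel_ar L r = Some (length ts) \<and> (\<forall>t\<in>set ts. wf_trm L t))"
| "wf_fm L (Neg \<phi>) = wf_fm L \<phi>"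
| "wf_fm L (Conj \<phi> \<psi>) = (wf_fm L \<phi> \<and> wf_fm L \<psi>)"
| "wf_fm L (Ex i \<phi>) = wf_fm L \<phi>"

fun fv_trm :: "trm \<Rightarrow> nat set" where
  "fv_trm (Var i) = {i}"
| "fv_trm (Fn f ts) = (\<Union>t\<in>set ts. fv_trm t)"

fun fv :: "fm \<Rightarrow> nat set" where
  "fv (Eq s t) = fv_trm s \<union> fv_trm t"
| "fv (Rel r ts) = (\<Union>t\<in>set ts. fv_trm t)"
| "fv (Neg \<phi>) = fv \<phi>"
| "fv (Conj \<phi> \<psi>) = fv \<phi> \<union> fv \<psi>"
| "fv (Ex i \<phi>) = fv \<phi> - {i}"

definition sentence :: "lang \<Rightarrow> fm \<Rightarrow> bool" where
  "sentence L \<phi> \<longleftrightarrow> wf_fm L \<phi> \<and> fv \<phi> = {}"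

record 'a struc =
  sdom :: "'a set"
  srel :: "nat \<Rightarrow> 'a list \<Rightarrow> bool"
  sfun :: "nat \<Rightarrow> 'a list \<Rightarrow> 'a"

definition is_struc :: "lang \<Rightarrow> 'a struc \<Rightarrow> bool" where
  "is_struc L M \<longleftrightarrow> sdom M \<noteq> {} \<and>
     (\<forall>f k xs. fun_ar L f = Some k \<and> length xs = k \<and> set xs \<subseteq> sdom M
        \<longrightarrow> sfun M f xs \<in> sdom M)"

fun eval :: "'a struc \<Rightarrow> (nat \<Rightarrow> 'a) \<Rightarrow> trm \<Rightarrow> 'a" where
  "eval M v (Var i) = v i"
| "eval M v (Fn f ts) = sfun M f (map (eval M v) ts)"

fun sat :: "'a struc \<Rightarrow> (nat \<Rightarrow> 'a) \<Rightarrow> fm \<Rightarrow> bool" where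
  "sat M v (Eq s t) = (eval M v s = eval M v t)"
| "sat M v (Rel r ts) = srel M r (map (eval M v) ts)"
| "sat M v (Neg \<phi>) = (\<not> sat M v \<phi>)"
| "sat M v (Conj \<phi> \<psi>) = (sat M v \<phi> \<and> sat M v \<psi>)"
| "sat M v (Ex i \<phi>) = (\<exists>d\<in>sdom M. sat M (v(i := d)) \<phi>)"

definition model :: "lang \<Rightarrow> fm set \<Rightarrow> 'a struc \<Rightarrow> bool" where
  "model L T M \<longleftrightarrow> is_struc L M \<and>
     (\<forall>\<phi>\<in>T. \<forall>v. range v \<subseteq> sdom M \<longrightarrow> sat M v \<phi>)"

text \<open>Complete theories. Semantic notions quantify over models whose carrier is a
  subset of \<open>nat\<close>; by downward Loewenheim--Skolem (countable language) this loses
  nothing.\<close>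
definition complete_theory :: "lang \<Rightarrow> fm set \<Rightarrow> bool" where
  "complete_theory L T \<longleftrightarrow>
     (\<forall>\<phi>\<in>T. sentence L \<phi>) \<and>
     (\<exists>M :: nat struc. model L T M) \<and>
     (\<forall>\<phi>. sentence L \<phi> \<longrightarrow> \<phi> \<in> T \<or> Neg \<phi> \<in> T)"

definition no_singleton_models :: "lang \<Rightarrow> fm set \<Rightarrow> bool" where
  "no_singleton_models L T \<longleftrightarrow>
     (\<forall>M :: nat struc. model L T M \<longrightarrow> \<not> (\<exists>x. sdom M = {x}))"

definition struc_iso :: "lang \<Rightarrow> 'a struc \<Rightarrow> 'b struc \<Rightarrow> ('a \<Rightarrow> 'b) \<Rightarrow> bool" where
  "struc_iso L A B h \<longleftrightarrow> bij_betw h (sdom A) (sdom B) \<and>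
     (\<forall>r k xs. rel_ar L r = Some k \<and> length xs = k \<and> set xs \<subseteq> sdom A
        \<longrightarrow> (srel A r xs \<longleftrightarrow> srel B r (map h xs))) \<and>
     (\<forall>f k xs. fun_ar L f = Some k \<and> length xs = k \<and> set xs \<subseteq> sdom A
        \<longrightarrow> h (sfun A f xs) = sfun B f (map h xs))"

definition lasg :: "'a list \<Rightarrow> nat \<Rightarrow> 'a" where
  "lasg xs i = xs ! i"

text \<open>An interpretation of an \<open>L'\<close>-structure in an \<open>L\<close>-structure: dimension \<open>n\<close>,
  a domain formula in variables \<open>0..<n\<close>, an equivalence formula in \<open>0..<2n\<close>, for each
  \<open>k\<close>-ary relation symbol of \<open>L'\<close> a formula in \<open>0..<n*k\<close>, and for each \<open>k\<close>-ary
  function symbol of \<open>L'\<close> a formula (its graph) in \<open>0..<n*(k+1)\<close>.\<close>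
record interp =
  idim :: nat
  idom :: fm
  ieq  :: fm
  irel :: "nat \<Rightarrow> fm"
  ifun :: "nat \<Rightarrow> fm"

definition idomset :: "interp \<Rightarrow> 'a struc \<Rightarrow> 'a list set" where
  "idomset I M = {xs. length xs = idim I \<and> set xs \<subseteq> sdom M \<and> sat M (lasg xs) (idom I)}"

definition ieqrel :: "interp \<Rightarrow> 'a struc \<Rightarrow> ('a list \<times> 'a list) set" where
  "ieqrel I M = {(xs, ys). xs \<in> idomset I M \<and> ys \<in> idomset I M \<and> sat M (lasg (xs @ ys)) (ieq I)}"

definition interp_struc :: "interp \<Rightarrow> 'a struc \<Rightarrow> 'a list set struc" where
  "interp_struc I M =
     \<lparr> sdom = idomset I M // ieqrel I M,
       srel = (\<lambda>r cs. \<exists>xss. list_all2 (\<lambda>xs c. xs \<in> c) xss cs \<and>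
                          sat M (lasg (concat xss)) (irel I r)),
       sfun = (\<lambda>f cs. THE c. c \<in> idomset I M // ieqrel I M \<and>
                 (\<exists>xss ys. list_all2 (\<lambda>xs c. xs \<in> c) xss cs \<and> ys \<in> c \<and>
                    sat M (lasg (concat xss @ ys)) (ifun I f))) \<rparr>"

definition is_interp :: "lang \<Rightarrow> fm set \<Rightarrow> lang \<Rightarrow> fm set \<Rightarrow> interp \<Rightarrow> bool" where
  "is_interp L T L' T' I \<longleftrightarrow>
     0 < idim I \<and>
     wf_fm L (idom I) \<and> fv (idom I) \<subseteq> {..<idim I} \<and>
     wf_fm L (ieq I) \<and> fv (ieq I) \<subseteq> {..<2 * idim I} \<and>
     (\<forall>r k. rel_ar L' r = Some k \<longrightarrow>
        wf_fm L (irel I r) \<and> fv (irel I r) \<subseteq> {..<idim I * k}) \<and>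
     (\<forall>f k. fun_ar L' f = Some k \<longrightarrow>
        wf_fm L (ifun I f) \<and> fv (ifun I f) \<subseteq> {..<idim I * (k + 1)}) \<and>
     (\<forall>M :: nat struc. model L T M \<longrightarrow>
        idomset I M \<noteq> {} \<and>
        equiv (idomset I M) (ieqrel I M) \<and>
        (\<forall>r k xss yss. rel_ar L' r = Some k \<and> length xss = k \<and>
            list_all2 (\<lambda>xs ys. (xs, ys) \<in> ieqrel I M) xss yss \<longrightarrow>
            (sat M (lasg (concat xss)) (irel I r) \<longleftrightarrow> sat M (lasg (concat yss)) (irel I r))) \<and>
        (\<forall>f k xss. fun_ar L' f = Some k \<and> length xss = k \<and> set xss \<subseteq> idomset I M \<longrightarrow>
            (\<exists>ys\<in>idomset I M. sat M (lasg (concat xss @ ys)) (ifun I f)) \<and>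
            (\<forall>ys zs. ys \<in> idomset I M \<and> zs \<in> idomset I M \<and>
               sat M (lasg (concat xss @ ys)) (ifun I f) \<and>
               sat M (lasg (concat xss @ zs)) (ifun I f) \<longrightarrow> (ys, zs) \<in> ieqrel I M)) \<and>
        (\<forall>f k xss yss ys zs. fun_ar L' f = Some k \<and> length xss = k \<and>
            list_all2 (\<lambda>xs ys. (xs, ys) \<in> ieqrel I M) xss yss \<and> (ys, zs) \<in> ieqrel I M \<longrightarrow>
            (sat M (lasg (concat xss @ ys)) (ifun I f) \<longleftrightarrow>
             sat M (lasg (concat yss @ zs)) (ifun I f))) \<and>
        model L' T' (interp_struc I M))"

definition chunk :: "nat \<Rightarrow> nat \<Rightarrow> 'a list \<Rightarrow> 'a list" where
  "chunk n i ys = take n (drop (i * n) ys)"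

definition defines_iso ::
  "lang \<Rightarrow> 'a struc \<Rightarrow> interp \<Rightarrow> interp \<Rightarrow> fm \<Rightarrow> bool" where
  "defines_iso L M \<Gamma> \<Delta> \<theta> \<longleftrightarrow>
     (\<exists>h. struc_iso L M (interp_struc \<Delta> (interp_struc \<Gamma> M)) h \<and>
        (\<forall>a\<in>sdom M. \<forall>ys. length ys = idim \<Gamma> * idim \<Delta> \<and> set ys \<subseteq> sdom M \<longrightarrow>
           (sat M (lasg (a # ys)) \<theta> \<longleftrightarrow>
              (\<forall>i<idim \<Delta>. chunk (idim \<Gamma>) i ys \<in> idomset \<Gamma> M) \<and>
              (let cs = map (\<lambda>i. ieqrel \<Gamma> M `` {chunk (idim \<Gamma>) i ys}) [0..<idim \<Delta>]
               in cs \<in> idomset \<Delta> (interp_struc \<Gamma> M) \<and>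
                  h a = ieqrel \<Delta> (interp_struc \<Gamma> M) `` {cs}))))"

definition bi_interpretable :: "lang \<Rightarrow> fm set \<Rightarrow> lang \<Rightarrow> fm set \<Rightarrow> bool" where
  "bi_interpretable L T L' T' \<longleftrightarrow>
     (\<exists>\<Gamma> \<Delta> \<theta> \<theta>'.
        is_interp L T L' T' \<Gamma> \<and> is_interp L' T' L T \<Delta> \<and>
        wf_fm L \<theta> \<and> fv \<theta> \<subseteq> {..<1 + idim \<Gamma> * idim \<Delta>} \<and>
        wf_fm L' \<theta>' \<and> fv \<theta>' \<subseteq> {..<1 + idim \<Delta> * idim \<Gamma>} \<and>
        (\<forall>M :: nat struc. model L T M \<longrightarrow> defines_iso L M \<Gamma> \<Delta> \<theta>) \<and>
        (\<forall>N :: nat struc. model L' T' N \<longrightarrow> defines_iso L' N \<Delta> \<Gamma> \<theta>'))"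

text \<open>Convention for \<open>\<phi>\<^sub>n(x\<^sub><\<^sub>n, y)\<close>: variable 0 is \<open>y\<close>, variable \<open>i+1\<close> is \<open>x\<^sub>i\<close>.\<close>
definition rich :: "lang \<Rightarrow> (nat \<Rightarrow> fm) \<Rightarrow> bool" where
  "rich L \<Phi> \<longleftrightarrow>
     (\<forall>n. wf_fm L (\<Phi> n) \<and> fv (\<Phi> n) \<subseteq> {..n}) \<and>
     (\<forall>\<psi> k. wf_fm L \<psi> \<and> fv \<psi> \<subseteq> {..k} \<longrightarrow> (\<exists>n\<ge>k. \<Phi> n = \<psi>))"

definition yx_asg :: "'a \<Rightarrow> (nat \<Rightarrow> 'a) \<Rightarrow> nat \<Rightarrow> 'a" where
  "yx_asg d a i = (if i = 0 then d else a (i - 1))"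

definition realises_D :: "'a struc \<Rightarrow> (nat \<Rightarrow> fm) \<Rightarrow> (nat \<Rightarrow> 'a) \<Rightarrow> bool" where
  "realises_D M \<Phi> a \<longleftrightarrow>
     (\<forall>k. \<forall>d\<in>sdom M. sat M (yx_asg d a) (\<Phi> k) \<longrightarrow> sat M (yx_asg (a k) a) (\<Phi> k))"

definition pair_asg :: "(nat \<Rightarrow> 'a) \<Rightarrow> (nat \<Rightarrow> 'a) \<Rightarrow> nat \<Rightarrow> 'a" where
  "pair_asg a b i = (if even i then a (i div 2) else b (i div 2))"

definition ptp :: "lang \<Rightarrow> 'a struc \<Rightarrow> (nat \<Rightarrow> 'a) \<Rightarrow> (nat \<Rightarrow> 'a) \<Rightarrow> fm set" where
  "ptp L M a b = {\<phi>. wf_fm L \<phi> \<and> sat M (pair_asg a b) \<phi>}"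

definition Stypes :: "lang \<Rightarrow> fm set \<Rightarrow> fm set set" where
  "Stypes L T = {ptp L M a b | (M :: nat struc) a b.
       model L T M \<and> range a \<subseteq> sdom M \<and> range b \<subseteq> sdom M}"

definition logic_top :: "lang \<Rightarrow> fm set \<Rightarrow> fm set topology" where
  "logic_top L T = subtopology
     (topology_generated_by {{p. \<phi> \<in> p} | \<phi>. wf_fm L \<phi>}) (Stypes L T)"

definition Gset :: "lang \<Rightarrow> fm set \<Rightarrow> (nat \<Rightarrow> fm) \<Rightarrow> fm set set" where
  "Gset L T \<Phi> = {ptp L M a b | (M :: nat struc) a b.
       model L T M \<and> range a \<subseteq> sdom M \<and> range b \<subseteq> sdom M \<and>
       realises_D M \<Phi> a \<and> realises_D M \<Phi> b \<and> range a = range b}"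

text \<open>Partial composition as a relation: \<open>gcomp p q r\<close> means \<open>p\<cdot>q\<close> is defined and
  equals \<open>r\<close>, i.e. \<open>tp(a,b)\<cdot>tp(b,c) = tp(a,c)\<close>; inversion \<open>tp(a,b)\<^sup>-\<^sup>1 = tp(b,a)\<close>.\<close>
definition tp_comp :: "lang \<Rightarrow> fm set \<Rightarrow> fm set \<Rightarrow> fm set \<Rightarrow> fm set \<Rightarrow> bool" where
  "tp_comp L T p q r \<longleftrightarrow> (\<exists>(M :: nat struc) a b c.
       model L T M \<and> range a \<subseteq> sdom M \<and> range b \<subseteq> sdom M \<and> range c \<subseteq> sdom M \<and>
       p = ptp L M a b \<and> q = ptp L M b c \<and> r = ptp L M a c)"

definition tp_inv :: "lang \<Rightarrow> fm set \<Rightarrow> fm set \<Rightarrow> fm set \<Rightarrow> bool" where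
  "tp_inv L T p q \<longleftrightarrow> (\<exists>(M :: nat struc) a b.
       model L T M \<and> range a \<subseteq> sdom M \<and> range b \<subseteq> sdom M \<and>
       p = ptp L M a b \<and> q = ptp L M b a)"

record 'a tgroupoid =
  gcar  :: "'a set"
  gcomp :: "'a \<Rightarrow> 'a \<Rightarrow> 'a \<Rightarrow> bool"
  ginv  :: "'a \<Rightarrow> 'a \<Rightarrow> bool"
  gtop  :: "'a topology"

definition G_Phi :: "lang \<Rightarrow> fm set \<Rightarrow> (nat \<Rightarrow> fm) \<Rightarrow> fm set tgroupoid" where
  "G_Phi L T \<Phi> =
     \<lparr> gcar = Gset L T \<Phi>,
       gcomp = tp_comp L T,
       ginv = tp_inv L T,
       gtop = subtopology (logic_top L T) (Gset L T \<Phi>) \<rparr>"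

definition tgroupoid_iso :: "'a tgroupoid \<Rightarrow> 'b tgroupoid \<Rightarrow> ('a \<Rightarrow> 'b) \<Rightarrow> bool" where
  "tgroupoid_iso G H f \<longleftrightarrow>
     topspace (gtop G) = gcar G \<and> topspace (gtop H) = gcar H \<and>
     homeomorphic_map (gtop G) (gtop H) f \<and>
     (\<forall>p\<in>gcar G. \<forall>q\<in>gcar G. \<forall>r\<in>gcar G. gcomp G p q r \<longleftrightarrow> gcomp H (f p) (f q) (f r)) \<and>
     (\<forall>p\<in>gcar G. \<forall>q\<in>gcar G. ginv G p q \<longleftrightarrow> ginv H (f p) (f q))"

definition tgroupoid_isomorphic :: "'a tgroupoid \<Rightarrow> 'b tgroupoid \<Rightarrow> bool" where
  "tgroupoid_isomorphic G H \<longleftrightarrow> (\<exists>f. tgroupoid_iso G H f)"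

end

theory Submission
  imports Defs
begin

text \<open>A finite part of the bijection between realisations of \<open>D\<^sub>\<Phi>\<close> in a model
  \<open>M\<close> and realisations of \<open>D\<^sub>\<Psi>\<close> in the interpreted model \<open>N\<close> is a surjection from
  the \<open>n\<close>-tuples satisfying \<open>D\<^sub>\<Phi>\<close> onto the \<open>m\<close>-tuples satisfying \<open>D\<^sub>\<Psi>\<close> of the simplest
  possible form: each coordinate of the image is the element of \<open>N\<close> coded by a fixed
  selection of coordinates of the argument. As \<open>\<Psi>\<close> is rich, it has positions whose
  formulas force the new entries to code a preimage under such a surjection, and conversely
  every preimage is so obtained. This yields a surjection in the opposite direction, from
  longer tuples, and the composite is the restriction map. Iterating back and forth, the
  limit is a bijection, given coordinatewise by definable functions uniformly in the model.
  So it induces a homeomorphism of types, which respects the groupoid operations.\<close>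

text \<open>A map on types must be given by formulas that serve all models at once. Models therefore
  enter as families indexed by a set \<open>K\<close>, and \<open>dfn\<close> expresses definability
  uniform in \<open>K\<close>. Some obstacles shape the rest. Composing interpretations nests
  quotients and raises the type of the carrier; \<open>codes\<close> replaces the interpreted
  structure by any isomorphic copy, in practice one on \<open>nat\<close>, together with a decoding
  map. A formula of a rich sequence constrains a single entry, whereas a code of a tuple occupies
  many; \<open>rich_coordinates\<close> spreads a definable tuple over suitable positions by
  projecting away one variable at a time. The finite maps are only asked to be onto, since entries
  that the image does not select remain free; injectivity appears in the limit. Finally, the sets of
  entries of two tuples must stay equal: an element definable from entries of a realisation of
  \<open>D\<close> is itself an entry, by richness, and both composite decodings are
  definable.\<close>

lemma eval_cong: "(\<And>i. i \<in> fv_trm t \<Longrightarrow> v i = w i) \<Longrightarrow> eval M v t = eval M w t"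
proof (induction t)
  case (Fn f ts)
  then have "map (eval M v) ts = map (eval M w) ts" by auto
  then show ?case by (metis eval.simps(2))
qed simp

lemma sat_cong: "(\<And>i. i \<in> fv \<phi> \<Longrightarrow> v i = w i) \<Longrightarrow> sat M v \<phi> \<longleftrightarrow> sat M w \<phi>"
proof (induction \<phi> arbitrary: v w)
  case (Eq s t)
  then show ?case using eval_cong[of s v w M] eval_cong[of t v w M] by auto
next
  case (Rel r ts)
  then have "map (eval M v) ts = map (eval M w) ts" by (auto intro!: eval_cong)
  then show ?case by (metis sat.simps(2))
next
  case (Ex i \<phi>)
  have "sat M (v(i := d)) \<phi> \<longleftrightarrow> sat M (w(i := d)) \<phi>" for d
    by (rule Ex.IH) (use Ex.prems in auto)
  then show ?case by simp
next
  case (Conj \<phi> \<psi>)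
  then show ?case by (metis UnCI fv.simps(4) sat.simps(4))
next
  case (Neg \<phi>)
  then show ?case by (metis fv.simps(3) sat.simps(3))
qed

lemma finite_fv_trm: "finite (fv_trm t)"
  by (induction t) auto

lemma finite_fv: "finite (fv \<phi>)"
  by (induction \<phi>) (auto simp: finite_fv_trm)

section \<open>Capture-avoiding renaming of variables\<close>

fun ren_trm :: "(nat \<Rightarrow> nat) \<Rightarrow> trm \<Rightarrow> trm" where
  "ren_trm f (Var i) = Var (f i)"
| "ren_trm f (Fn g ts) = Fn g (map (ren_trm f) ts)"

text \<open>Each quantifier binds the least index outside the images of the variables free in its
  body, so capture is avoided for every \<open>f\<close>, injective or not.\<close>

fun ren :: "(nat \<Rightarrow> nat) \<Rightarrow> fm \<Rightarrow> fm" where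
  "ren f (Eq s t) = Eq (ren_trm f s) (ren_trm f t)"
| "ren f (Rel r ts) = Rel r (map (ren_trm f) ts)"
| "ren f (Neg \<phi>) = Neg (ren f \<phi>)"
| "ren f (Conj \<phi> \<psi>) = Conj (ren f \<phi>) (ren f \<psi>)"
| "ren f (Ex i \<phi>) = (let j = (LEAST j. j \<notin> f ` fv \<phi>) in Ex j (ren (f(i := j)) \<phi>))"

lemma Least_fresh: "finite A \<Longrightarrow> (LEAST j::nat. j \<notin> A) \<notin> A"
  by (rule LeastI_ex) (rule ex_new_if_finite[OF infinite_UNIV_nat])

lemma eval_ren: "eval M v (ren_trm f t) = eval M (\<lambda>i. v (f i)) t"
proof (induction t)
  case (Fn g ts)
  then have "map (eval M v) (map (ren_trm f) ts) = map (eval M (\<lambda>i. v (f i))) ts" by simp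
  then show ?case by (metis eval.simps(2) ren_trm.simps(2))
qed simp

lemma fv_ren_trm: "fv_trm (ren_trm f t) = f ` fv_trm t"
  by (induction t) auto

lemma fv_ren: "fv (ren f \<phi>) \<subseteq> f ` fv \<phi>"
proof (induction \<phi> arbitrary: f)
  case (Ex i \<phi>)
  define j where "j = (LEAST j. j \<notin> f ` fv \<phi>)"
  have "f(i := j) ` fv \<phi> \<subseteq> insert j (f ` (fv \<phi> - {i}))" by auto
  then have "fv (ren (f(i := j)) \<phi>) - {j} \<subseteq> f ` (fv \<phi> - {i})"
    using Ex.IH[of "f(i := j)"] by blast
  then show ?case by (simp add: Let_def j_def)
next
  case (Conj \<phi> \<psi>)
  then show ?case by (simp add: image_Un) blast
qed (auto simp: fv_ren_trm)

lemma wf_ren_trm: "wf_trm L t \<Longrightarrow> wf_trm L (ren_trm f t)"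
  by (induction t) auto

lemma wf_ren: "wf_fm L \<phi> \<Longrightarrow> wf_fm L (ren f \<phi>)"
  by (induction \<phi> arbitrary: f) (auto simp: wf_ren_trm Let_def)

lemma sat_ren: "sat M v (ren f \<phi>) \<longleftrightarrow> sat M (\<lambda>i. v (f i)) \<phi>"
proof (induction \<phi> arbitrary: f v)
  case (Eq s t) then show ?case by (simp add: eval_ren)
next
  case (Rel r ts)
  have "map (eval M v) (map (ren_trm f) ts) = map (eval M (\<lambda>i. v (f i))) ts"
    by (simp add: eval_ren)
  then show ?case by (metis ren.simps(2) sat.simps(2))
next
  case (Ex i \<phi>)
  define j where "j = (LEAST j. j \<notin> f ` fv \<phi>)"
  have j: "j \<notin> f ` fv \<phi>" unfolding j_def by (rule Least_fresh) (simp add: finite_fv)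
  \<comment> \<open>As \<open>j\<close> differs from the image of every variable free in the body,
    updating at \<open>j\<close> touches the bound variable only.\<close>
  have "sat M (\<lambda>k. (v(j := d)) ((f(i := j)) k)) \<phi> \<longleftrightarrow> sat M ((\<lambda>i. v (f i))(i := d)) \<phi>" for d
    by (rule sat_cong) (use j in auto)
  then show ?case by (simp add: Let_def j_def[symmetric] Ex.IH del: fun_upd_apply)
qed auto

section \<open>Isomorphisms of structures\<close>

lemma iso_eval:
  assumes "struc_iso L A B g" "is_struc L A" "wf_trm L t" "v ` fv_trm t \<subseteq> sdom A"
  shows "eval A v t \<in> sdom A \<and> eval B (\<lambda>i. g (v i)) t = g (eval A v t)"
  using assms(3,4)
proof (induction t)
  case (Fn f ts)
  have 1: "set (map (eval A v) ts) \<subseteq> sdom A" using Fn by fastforce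
  have 2: "map (eval B (\<lambda>i. g (v i))) ts = map g (map (eval A v) ts)" using Fn by fastforce
  have ar: "fun_ar L f = Some (length (map (eval A v) ts))" using Fn.prems by simp
  have "sfun A f (map (eval A v) ts) \<in> sdom A"
    using assms(2) ar 1 unfolding is_struc_def by blast
  moreover have "g (sfun A f (map (eval A v) ts)) = sfun B f (map g (map (eval A v) ts))"
    using assms(1) ar 1 unfolding struc_iso_def by blast
  ultimately show ?case using 2 by (metis eval.simps(2))
qed simp

text \<open>The assignment is constrained on the free variables only, because an assignment such as
  \<open>lasg xs\<close> is unspecified beyond the length of \<open>xs\<close>.\<close>

lemma iso_sat:
  assumes iso: "struc_iso L A B g" and st: "is_struc L A"
  shows "wf_fm L \<phi> \<Longrightarrow> v ` fv \<phi> \<subseteq> sdom A \<Longrightarrow> sat B (\<lambda>i. g (v i)) \<phi> \<longleftrightarrow> sat A v \<phi>"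
proof (induction \<phi> arbitrary: v)
  case (Eq s t)
  then have "eval A v s \<in> sdom A \<and> eval B (\<lambda>i. g (v i)) s = g (eval A v s)"
    "eval A v t \<in> sdom A \<and> eval B (\<lambda>i. g (v i)) t = g (eval A v t)"
    using iso_eval[OF iso st] by (auto simp: image_Un)
  then show ?case using iso unfolding struc_iso_def bij_betw_def
    by (metis inj_on_contraD sat.simps(1))
next
  case (Rel r ts)
  have *: "eval A v t \<in> sdom A \<and> eval B (\<lambda>i. g (v i)) t = g (eval A v t)" if "t \<in> set ts" for t
    by (rule iso_eval[OF iso st]) (use Rel that in auto)
  have 1: "set (map (eval A v) ts) \<subseteq> sdom A" using * by fastforce
  have 2: "map (eval B (\<lambda>i. g (v i))) ts = map g (map (eval A v) ts)" using * by fastforce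
  have ar: "rel_ar L r = Some (length (map (eval A v) ts))" using Rel.prems by simp
  have "srel A r (map (eval A v) ts) \<longleftrightarrow> srel B r (map g (map (eval A v) ts))"
    using iso ar 1 unfolding struc_iso_def by blast
  then show ?case using 2 by (metis sat.simps(2))
next
  case (Ex i \<phi>)
  have im: "g ` sdom A = sdom B" using iso unfolding struc_iso_def bij_betw_def by blast
  have "sat B ((\<lambda>i. g (v i))(i := g d)) \<phi> \<longleftrightarrow> sat A (v(i := d)) \<phi>" if "d \<in> sdom A" for d
  proof -
    have "sat B (\<lambda>k. g ((v(i := d)) k)) \<phi> \<longleftrightarrow> sat A (v(i := d)) \<phi>"
      by (rule Ex.IH) (use Ex.prems that in auto)
    moreover have "(\<lambda>k. g ((v(i := d)) k)) = (\<lambda>i. g (v i))(i := g d)" by auto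
    ultimately show ?thesis by simp
  qed
  then show ?case unfolding sat.simps im[symmetric] by blast
qed (auto simp: image_Un)

lemma iso_model:
  assumes iso: "struc_iso L A B g" and m: "model L T A" and T: "\<And>\<phi>. \<phi> \<in> T \<Longrightarrow> sentence L \<phi>"
    and B: "is_struc L B"
  shows "model L T B"
proof -
  have st: "is_struc L A" using m unfolding model_def by blast
  have "sat B v \<phi>" if "\<phi> \<in> T" for v \<phi>
  proof -
    obtain a where a: "a \<in> sdom A" using st unfolding is_struc_def by blast
    have wf: "wf_fm L \<phi>" "fv \<phi> = {}" using T[OF that] unfolding sentence_def by auto
    \<comment> \<open>A sentence does not depend on the assignment, so it may be tested at a
      constant one.\<close>
    have "sat A (\<lambda>_. a) \<phi>" using m that a unfolding model_def by auto
    then have "sat B (\<lambda>_. g a) \<phi>" using iso_sat[OF iso st wf(1), of "\<lambda>_. a"] wf by simp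
    then show ?thesis using sat_cong[of \<phi> v "\<lambda>_. g a" B] wf by simp
  qed
  then show ?thesis using B unfolding model_def by blast
qed

lemma iso_is_struc:
  assumes iso: "struc_iso L A B g" and A: "is_struc L A"
  shows "is_struc L B"
proof -
  have im: "g ` sdom A = sdom B" using iso unfolding struc_iso_def bij_betw_def by blast
  have "sfun B f ys \<in> sdom B" if "fun_ar L f = Some (length ys)" "set ys \<subseteq> sdom B" for f ys
  proof -
    have "ys = map g (map (inv_into (sdom A) g) ys)"
      using that(2) im by (auto simp: f_inv_into_f subset_iff intro!: map_idI[symmetric])
    moreover have "set (map (inv_into (sdom A) g) ys) \<subseteq> sdom A"
      using that(2) im by (auto simp: subset_iff intro!: inv_into_into)
    ultimately obtain xs where xs: "ys = map g xs" "set xs \<subseteq> sdom A" by blast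
    have "g (sfun A f xs) = sfun B f ys"
      using iso that(1) xs unfolding struc_iso_def by (metis length_map)
    moreover have "sfun A f xs \<in> sdom A"
      using A that(1) xs unfolding is_struc_def by (metis length_map)
    ultimately show ?thesis using im by (metis imageI)
  qed
  then show ?thesis using A im unfolding is_struc_def by blast
qed

lemma struc_iso_comp:
  assumes g: "struc_iso L A B g" and h: "struc_iso L B C h"
  shows "struc_iso L A C (\<lambda>x. h (g x))"
proof -
  have im: "g ` sdom A = sdom B" using g unfolding struc_iso_def bij_betw_def by blast
  have s: "set (map g xs) \<subseteq> sdom B" if "set xs \<subseteq> sdom A" for xs using that im by auto
  have c: "map (\<lambda>x. h (g x)) xs = map h (map g xs)" for xs by simp
  have "bij_betw (\<lambda>x. h (g x)) (sdom A) (sdom C)"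
    using bij_betw_trans[of g "sdom A" "sdom B" h "sdom C"] g h
    unfolding struc_iso_def comp_def by blast
  then show ?thesis using g h s unfolding struc_iso_def c by (metis length_map)
qed

lemma struc_iso_inv:
  assumes g: "struc_iso L A B g" and A: "is_struc L A"
  shows "struc_iso L B A (inv_into (sdom A) g)"
proof -
  let ?h = "inv_into (sdom A) g"
  have bij: "bij_betw g (sdom A) (sdom B)" using g unfolding struc_iso_def by blast
  have h: "set (map ?h ys) \<subseteq> sdom A" "map g (map ?h ys) = ys" if "set ys \<subseteq> sdom B" for ys
    using bij that unfolding bij_betw_def
    by (auto simp: inv_into_into f_inv_into_f subset_iff intro!: map_idI)
  have "?h (sfun B f ys) = sfun A f (map ?h ys)"
    if "fun_ar L f = Some (length ys)" "set ys \<subseteq> sdom B" for f ys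
  proof -
    have "g (sfun A f (map ?h ys)) = sfun B f ys"
      using g h[OF that(2)] that(1) unfolding struc_iso_def by (metis length_map)
    moreover have "sfun A f (map ?h ys) \<in> sdom A"
      using A h[OF that(2)] that(1) unfolding is_struc_def by (metis length_map)
    ultimately show ?thesis using bij unfolding bij_betw_def by (metis inv_into_f_f)
  qed
  moreover have "srel B r ys \<longleftrightarrow> srel A r (map ?h ys)"
    if "rel_ar L r = Some (length ys)" "set ys \<subseteq> sdom B" for r ys
    using g h[OF that(2)] that(1) unfolding struc_iso_def by (metis length_map)
  ultimately show ?thesis
    using bij_betw_inv_into[OF bij] unfolding struc_iso_def by blast
qed

section \<open>Uniformly definable relations\<close>

text \<open>One formula has to define all members of the family \<open>P\<close>. Nothing is
  required of the assignment outside \<open>A\<close>, nor of \<open>P\<close> at assignments that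
  leave the domain on \<open>A\<close>.\<close>

definition dfn :: "lang \<Rightarrow> 'k set \<Rightarrow> ('k \<Rightarrow> nat struc) \<Rightarrow> nat set \<Rightarrow> ('k \<Rightarrow> (nat \<Rightarrow> nat) \<Rightarrow> bool) \<Rightarrow> bool"
  where "dfn L K S A P \<longleftrightarrow> (\<exists>\<phi>. wf_fm L \<phi> \<and> fv \<phi> \<subseteq> A \<and>
    (\<forall>k\<in>K. \<forall>v. v ` A \<subseteq> sdom (S k) \<longrightarrow> (P k v \<longleftrightarrow> sat (S k) v \<phi>)))"

lemma dfn_cong:
  assumes "dfn L K S A P" "\<And>k v. k \<in> K \<Longrightarrow> v ` A \<subseteq> sdom (S k) \<Longrightarrow> Q k v \<longleftrightarrow> P k v"
  shows "dfn L K S A Q"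
  using assms unfolding dfn_def by meson

lemma dfn_mono: "dfn L K S A P \<Longrightarrow> A \<subseteq> B \<Longrightarrow> dfn L K S B P"
  unfolding dfn_def by (meson image_mono subset_trans)

lemma dfn_sat:
  assumes "wf_fm L \<phi>" "f ` fv \<phi> \<subseteq> A"
  shows "dfn L K S A (\<lambda>k v. sat (S k) (\<lambda>i. v (f i)) \<phi>)"
  unfolding dfn_def
  by (rule exI[of _ "ren f \<phi>"]) (use assms fv_ren[of f \<phi>] in \<open>auto simp: wf_ren sat_ren\<close>)

lemma dfn_ren:
  assumes "dfn L K S A P" "f ` A \<subseteq> B"
  shows "dfn L K S B (\<lambda>k v. P k (\<lambda>i. v (f i)))"
proof -
  obtain \<phi> where \<phi>: "wf_fm L \<phi>" "fv \<phi> \<subseteq> A"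
    "\<And>k v. k \<in> K \<Longrightarrow> v ` A \<subseteq> sdom (S k) \<Longrightarrow> P k v \<longleftrightarrow> sat (S k) v \<phi>"
    using assms(1) unfolding dfn_def by blast
  have "P k (\<lambda>i. v (f i)) \<longleftrightarrow> sat (S k) (\<lambda>i. v (f i)) \<phi>"
    if "k \<in> K" "v ` B \<subseteq> sdom (S k)" for k v
    by (rule \<phi>(3)) (use that assms(2) in auto)
  moreover have "f ` fv \<phi> \<subseteq> B" using \<phi>(2) assms(2) by blast
  ultimately show ?thesis by (intro dfn_cong[OF dfn_sat[OF \<phi>(1)]])
qed

lemma dfn_True: "dfn L K S A (\<lambda>k v. True)"
  unfolding dfn_def
  by (rule exI[of _ "Neg (Ex 0 (Neg (Eq (Var 0) (Var 0))))"]) auto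

lemma dfn_Neg: "dfn L K S A P \<Longrightarrow> dfn L K S A (\<lambda>k v. \<not> P k v)"
  unfolding dfn_def by (metis sat.simps(3) wf_fm.simps(3) fv.simps(3))

lemma dfn_Conj:
  assumes "dfn L K S A P" "dfn L K S A Q"
  shows "dfn L K S A (\<lambda>k v. P k v \<and> Q k v)"
proof -
  obtain \<phi> where "wf_fm L \<phi>" "fv \<phi> \<subseteq> A"
    "\<And>k v. k \<in> K \<Longrightarrow> v ` A \<subseteq> sdom (S k) \<Longrightarrow> P k v \<longleftrightarrow> sat (S k) v \<phi>"
    using assms(1) unfolding dfn_def by blast
  moreover obtain \<psi> where "wf_fm L \<psi>" "fv \<psi> \<subseteq> A"
    "\<And>k v. k \<in> K \<Longrightarrow> v ` A \<subseteq> sdom (S k) \<Longrightarrow> Q k v \<longleftrightarrow> sat (S k) v \<psi>"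
    using assms(2) unfolding dfn_def by blast
  ultimately show ?thesis unfolding dfn_def
    by (intro exI[of _ "Conj \<phi> \<psi>"]) auto
qed

lemma dfn_imp:
  assumes "dfn L K S A P" "dfn L K S A Q"
  shows "dfn L K S A (\<lambda>k v. P k v \<longrightarrow> Q k v)"
  by (rule dfn_cong[OF dfn_Neg[OF dfn_Conj[OF assms(1) dfn_Neg[OF assms(2)]]]]) blast

lemma dfn_ball:
  assumes "finite I" "\<And>i. i \<in> I \<Longrightarrow> dfn L K S A (P i)"
  shows "dfn L K S A (\<lambda>k v. \<forall>i\<in>I. P i k v)"
  using assms
proof (induction I)
  case empty
  then show ?case using dfn_True by simp
next
  case (insert i I)
  have "dfn L K S A (\<lambda>k v. P i k v \<and> (\<forall>i\<in>I. P i k v))"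
    using insert by (intro dfn_Conj) auto
  then show ?case by simp
qed

lemma dfn_ex1:
  assumes "dfn L K S A P"
  shows "dfn L K S (A - {i}) (\<lambda>k v. \<exists>d\<in>sdom (S k). P k (v(i := d)))"
proof -
  obtain \<phi> where \<phi>: "wf_fm L \<phi>" "fv \<phi> \<subseteq> A"
    "\<And>k v. k \<in> K \<Longrightarrow> v ` A \<subseteq> sdom (S k) \<Longrightarrow> P k v \<longleftrightarrow> sat (S k) v \<phi>"
    using assms(1) unfolding dfn_def by blast
  have "P k (v(i := d)) \<longleftrightarrow> sat (S k) (v(i := d)) \<phi>"
    if "k \<in> K" "v ` (A - {i}) \<subseteq> sdom (S k)" "d \<in> sdom (S k)" for k v d
    by (rule \<phi>(3)) (use that in auto)
  then show ?thesis unfolding dfn_def using \<phi> by (intro exI[of _ "Ex i \<phi>"]) auto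
qed

text \<open>Iterates \<open>dfn_ex1\<close>. The witnesses are given as an assignment
  \<open>u\<close> used on \<open>Z\<close> only, so that quantifying over a code needs no
  lists.\<close>

lemma dfn_exs:
  assumes "dfn L K S A P" "finite Z"
  shows "dfn L K S (A - Z) (\<lambda>k v. \<exists>u. u ` Z \<subseteq> sdom (S k) \<and> P k (override_on v u Z))"
  using assms(2,1)
proof (induction Z arbitrary: A P)
  case empty
  then show ?case by simp
next
  case (insert i Z)
  have "dfn L K S (A - Z - {i}) (\<lambda>k v. \<exists>d\<in>sdom (S k). \<exists>u. u ` Z \<subseteq> sdom (S k) \<and>
      P k (override_on (v(i := d)) u Z))"
    by (rule dfn_ex1) (rule insert.IH[OF insert.prems])
  moreover have "(\<exists>u. u ` insert i Z \<subseteq> B \<and> Q (override_on v u (insert i Z))) \<longleftrightarrow>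
     (\<exists>d\<in>B. \<exists>u. u ` Z \<subseteq> B \<and> Q (override_on (v(i := d)) u Z))" (is "?l \<longleftrightarrow> ?r")
    for B :: "nat set" and Q v
  proof
    assume ?l
    then obtain u where "u ` insert i Z \<subseteq> B" "Q (override_on v u (insert i Z))" by blast
    moreover have "override_on v u (insert i Z) = override_on (v(i := u i)) u Z"
      by (auto simp: override_on_def)
    ultimately show ?r by (intro bexI[of _ "u i"] exI[of _ u]) auto
  next
    assume ?r
    then obtain d u where "d \<in> B" "u ` Z \<subseteq> B" "Q (override_on (v(i := d)) u Z)" by blast
    moreover have "override_on v (u(i := d)) (insert i Z) = override_on (v(i := d)) u Z"
      using insert(2) by (auto simp: override_on_def)
    moreover have "(u(i := d)) ` insert i Z \<subseteq> B" using calculation insert(2) by auto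
    ultimately show ?l by metis
  qed
  moreover have "A - insert i Z = A - Z - {i}" by blast
  ultimately show ?case by (simp only:)
qed

section \<open>Interpretations as codings of structures\<close>

lemma struc_iso_id: "struc_iso L A A (\<lambda>x. x)"
  unfolding struc_iso_def bij_betw_def by auto

lemma eval_in_sdom:
  "is_struc L A \<Longrightarrow> wf_trm L t \<Longrightarrow> v ` fv_trm t \<subseteq> sdom A \<Longrightarrow> eval A v t \<in> sdom A"
  using iso_eval[OF struc_iso_id] by blast

text \<open>The formulas of an interpretation are evaluated at lists. Evaluating at the values of
  the variables \<open>js\<close> is a renaming along \<open>js\<close>.\<close>

lemma dfn_lasg:
  assumes "wf_fm L \<phi>" "fv \<phi> \<subseteq> {..<length js}" "set js \<subseteq> A"
  shows "dfn L K S A (\<lambda>k v. sat (S k) (lasg (map v js)) \<phi>)"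
proof (rule dfn_cong[OF dfn_sat[OF assms(1)]])
  show "(\<lambda>i. js ! i) ` fv \<phi> \<subseteq> A" using assms(2,3) by (auto simp: subset_iff)
  show "sat (S k) (lasg (map v js)) \<phi> \<longleftrightarrow> sat (S k) (\<lambda>i. v (js ! i)) \<phi>" for k v
    by (rule sat_cong) (use assms(2) in \<open>auto simp: lasg_def\<close>)
qed

text \<open>Variable \<open>i\<close> of the interpreted language is represented by these
  \<open>d\<close> variables of the interpreting one. \<open>block\<close> reads off their values,
  and \<open>BL\<close> collects them for a set of variables.\<close>

definition bix :: "nat \<Rightarrow> nat \<Rightarrow> nat list" where
  "bix d i = [i * d..<i * d + d]"

definition block :: "nat \<Rightarrow> (nat \<Rightarrow> 'a) \<Rightarrow> nat \<Rightarrow> 'a list" where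
  "block d w i = map w (bix d i)"

definition BL :: "nat \<Rightarrow> nat set \<Rightarrow> nat set" where
  "BL d A = {n. n div d \<in> A}"

lemma length_block[simp]: "length (block d w i) = d"
  by (simp add: block_def bix_def)

lemma set_bix:
  assumes "0 < d" shows "set (bix d i) = BL d {i}"
proof -
  have "n div d = i \<longleftrightarrow> i * d \<le> n \<and> n < i * d + d" for n
    using less_eq_div_iff_mult_less_eq[OF assms, of i n] div_less_iff_less_mult[OF assms, of n "Suc i"]
    by (simp add: add.commute) linarith
  then show ?thesis unfolding bix_def BL_def by (simp add: set_eq_iff)
qed

lemma BL_mono: "A \<subseteq> B \<Longrightarrow> BL d A \<subseteq> BL d B"
  unfolding BL_def by blast

lemma BL_UN: "BL d A = (\<Union>i\<in>A. BL d {i})"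
  unfolding BL_def by blast

lemma finite_BL: assumes "0 < d" "finite A" shows "finite (BL d A)"
proof -
  have "finite (\<Union>i\<in>A. set (bix d i))" using assms by simp
  then show ?thesis using set_bix[OF assms(1)] BL_UN[of d A] by simp
qed

lemma block_cong: "0 < d \<Longrightarrow> (\<And>n. n \<in> BL d {i} \<Longrightarrow> v n = w n) \<Longrightarrow> block d v i = block d w i"
  unfolding block_def using set_bix[of d i] by auto

lemma block_override_in: "0 < d \<Longrightarrow> i \<in> B \<Longrightarrow> block d (override_on w u (BL d B)) i = block d u i"
  by (rule block_cong) (auto simp: BL_def override_on_def)

lemma block_override_out: "0 < d \<Longrightarrow> i \<notin> B \<Longrightarrow> block d (override_on w u (BL d B)) i = block d w i"
  by (rule block_cong) (auto simp: BL_def override_on_def)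

lemma set_block: "0 < d \<Longrightarrow> set (block d w i) = w ` BL d {i}"
  by (simp add: block_def set_bix)

text \<open>Quotient and remainder by \<open>d\<close> locate an index in its block. The length is
  assumed for every \<open>i\<close>, so applications put a dummy list into blocks that do not
  matter.\<close>

lemma block_surj:
  assumes "\<And>i. length (xs i) = d"
  shows "\<exists>u. \<forall>i. block d u i = xs i"
proof -
  let ?u = "\<lambda>n. xs (n div d) ! (n mod d)"
  have "block d ?u i = xs i" for i
    by (rule nth_equalityI) (use assms in \<open>auto simp: block_def bix_def\<close>)
  then show ?thesis by blast
qed

lemma concat_block: "concat (map (block d w) is) = map w (concat (map (bix d) is))"
  by (induction "is") (auto simp: block_def)

lemma length_concat_bix: "length (concat (map (bix d) is)) = d * length is"
  by (induction "is") (auto simp: bix_def)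

definition wf_interp :: "lang \<Rightarrow> lang \<Rightarrow> interp \<Rightarrow> bool" where
  "wf_interp L L' I \<longleftrightarrow> 0 < idim I \<and>
     wf_fm L (idom I) \<and> fv (idom I) \<subseteq> {..<idim I} \<and>
     wf_fm L (ieq I) \<and> fv (ieq I) \<subseteq> {..<2 * idim I} \<and>
     (\<forall>r k. rel_ar L' r = Some k \<longrightarrow>
        wf_fm L (irel I r) \<and> fv (irel I r) \<subseteq> {..<idim I * k}) \<and>
     (\<forall>f k. fun_ar L' f = Some k \<longrightarrow>
        wf_fm L (ifun I f) \<and> fv (ifun I f) \<subseteq> {..<idim I * (k + 1)})"

text \<open>\<open>\<pi>\<close> decodes a tuple of \<open>M\<close> to the element of
  \<open>N\<close> that it represents, so \<open>N\<close> is the interpreted structure up to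
  isomorphism. In contrast to \<open>interp_struc\<close>, the carrier type of \<open>N\<close> is
  free, which keeps iterated interpretations on \<open>nat\<close>.\<close>

definition codes :: "lang \<Rightarrow> interp \<Rightarrow> 'a struc \<Rightarrow> 'b struc \<Rightarrow> ('a list \<Rightarrow> 'b) \<Rightarrow> bool" where
  "codes L' I M N \<pi> \<longleftrightarrow> \<pi> ` idomset I M = sdom N \<and>
     (\<forall>xs\<in>idomset I M. \<forall>ys\<in>idomset I M. \<pi> xs = \<pi> ys \<longleftrightarrow> sat M (lasg (xs @ ys)) (ieq I)) \<and>
     (\<forall>r xss. rel_ar L' r = Some (length xss) \<and> set xss \<subseteq> idomset I M \<longrightarrow>
        (srel N r (map \<pi> xss) \<longleftrightarrow> sat M (lasg (concat xss)) (irel I r))) \<and>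
     (\<forall>f xss ys. fun_ar L' f = Some (length xss) \<and> set xss \<subseteq> idomset I M \<and> ys \<in> idomset I M \<longrightarrow>
        (\<pi> ys = sfun N f (map \<pi> xss) \<longleftrightarrow> sat M (lasg (concat xss @ ys)) (ifun I f)))"

locale coded =
  fixes L L' :: lang and I :: interp and K :: "'k set" and M N :: "'k \<Rightarrow> nat struc"
    and \<pi> :: "'k \<Rightarrow> nat list \<Rightarrow> nat"
  assumes wfI: "wf_interp L L' I"
    and cod: "k \<in> K \<Longrightarrow> codes L' I (M k) (N k) (\<pi> k)"
    and strucN: "k \<in> K \<Longrightarrow> is_struc L' (N k)"
begin

abbreviation "d \<equiv> idim I"
abbreviation "E k \<equiv> idomset I (M k)"
abbreviation "val k w i \<equiv> \<pi> k (block d w i)"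

lemma d_pos: "0 < d" using wfI unfolding wf_interp_def by blast

lemma sdom_N: "k \<in> K \<Longrightarrow> sdom (N k) = \<pi> k ` E k"
  using cod unfolding codes_def by metis

lemma val_in: "k \<in> K \<Longrightarrow> block d w i \<in> E k \<Longrightarrow> val k w i \<in> sdom (N k)"
  using sdom_N by blast

lemma dfn_idom:
  assumes "i \<in> F" shows "dfn L K M (BL d F) (\<lambda>k w. block d w i \<in> E k)"
proof -
  have s: "set (bix d i) \<subseteq> BL d F" using assms BL_mono[of "{i}" F] by (simp add: set_bix d_pos)
  have "dfn L K M (BL d F) (\<lambda>k w. sat (M k) (lasg (map w (bix d i))) (idom I))"
    by (rule dfn_lasg) (use wfI s in \<open>auto simp: wf_interp_def bix_def\<close>)
  then show ?thesis
    by (rule dfn_cong) (use s in \<open>auto simp: idomset_def block_def bix_def\<close>)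
qed

lemma dfn_idoms:
  assumes "finite F" "F \<subseteq> G" shows "dfn L K M (BL d G) (\<lambda>k w. \<forall>i\<in>F. block d w i \<in> E k)"
  using assms by (intro dfn_ball dfn_idom) auto

text \<open>An interpretation supplies graphs of function symbols only, so nested terms must be
  unfolded. Fresh blocks from \<open>b\<close> on name the values of the arguments, \<open>Q\<close>
  translates the relation \<open>R\<close> between them, and the fresh blocks are quantified away.
  Domain conditions accompany every translation because decoding is meaningful on
  \<open>idomset\<close> only.\<close>

lemma args_pull:
  assumes tm: "\<And>t j. t \<in> set ts \<Longrightarrow> dfn L K M (BL d (insert j (fv_trm t)))
      (\<lambda>k w. (\<forall>i\<in>insert j (fv_trm t). block d w i \<in> E k) \<and> val k w j = eval (N k) (val k w) t)"
    and wf: "\<And>t. t \<in> set ts \<Longrightarrow> wf_trm L' t"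
    and F: "finite F" "\<And>t. t \<in> set ts \<Longrightarrow> fv_trm t \<subseteq> F" and b: "\<And>i. i \<in> F \<Longrightarrow> i < b"
    and Q: "dfn L K M (BL d (F \<union> {b..<b + length ts})) Q"
    and QR: "\<And>k w. k \<in> K \<Longrightarrow> (\<And>i. i \<in> F \<union> {b..<b + length ts} \<Longrightarrow> block d w i \<in> E k) \<Longrightarrow>
       Q k w \<longleftrightarrow> R k (val k w) (map (val k w) [b..<b + length ts])"
    and R: "\<And>k v v' as. (\<And>i. i \<in> F \<Longrightarrow> v i = v' i) \<Longrightarrow> R k v as \<longleftrightarrow> R k v' as"
  shows "dfn L K M (BL d F) (\<lambda>k w. (\<forall>i\<in>F. block d w i \<in> E k) \<and>
      R k (val k w) (map (eval (N k) (val k w)) ts))"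
proof -
  define n where "n = length ts"
  define B where "B = {b..<b + n}"
  have FB: "F \<inter> B = {}" using b unfolding B_def by fastforce
  define P where "P k w \<longleftrightarrow> (\<forall>l\<in>{..<n}.
      (\<forall>i\<in>insert (b + l) (fv_trm (ts ! l)). block d w i \<in> E k) \<and>
      val k w (b + l) = eval (N k) (val k w) (ts ! l)) \<and> Q k w" for k w
  have "dfn L K M (BL d (F \<union> B)) P"
    unfolding P_def
  proof (rule dfn_Conj, rule dfn_ball)
    show "dfn L K M (BL d (F \<union> B)) Q" using Q unfolding B_def n_def .
    show "finite {..<n}" by simp
    show "dfn L K M (BL d (F \<union> B)) (\<lambda>k w.
        (\<forall>i\<in>insert (b + l) (fv_trm (ts ! l)). block d w i \<in> E k) \<and>
      val k w (b + l) = eval (N k) (val k w) (ts ! l))" if "l \<in> {..<n}" for l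
    proof (rule dfn_mono[OF tm])
      show *: "ts ! l \<in> set ts" using that n_def by simp
      show "BL d (insert (b + l) (fv_trm (ts ! l))) \<subseteq> BL d (F \<union> B)"
        by (rule BL_mono) (use F(2)[OF *] that B_def in auto)
    qed
  qed
  then have "dfn L K M (BL d (F \<union> B) - BL d B)
     (\<lambda>k w. \<exists>u. u ` BL d B \<subseteq> sdom (M k) \<and> P k (override_on w u (BL d B)))"
    by (rule dfn_exs) (simp add: finite_BL d_pos B_def)
  moreover have "BL d (F \<union> B) - BL d B = BL d F" using FB unfolding BL_def by blast
  ultimately have "dfn L K M (BL d F)
     (\<lambda>k w. (\<forall>i\<in>F. block d w i \<in> E k) \<and>
       (\<exists>u. u ` BL d B \<subseteq> sdom (M k) \<and> P k (override_on w u (BL d B))))"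
    using dfn_Conj[OF dfn_idoms[OF F(1) order_refl]] by simp
  then show ?thesis
  proof (rule dfn_cong, intro conj_cong refl iffI)
    fix k w assume k: "k \<in> K" and dom: "\<forall>i\<in>F. block d w i \<in> E k"
    have ov: "block d (override_on w u (BL d B)) i = (if i \<in> B then block d u i else block d w i)" for u i
      using block_override_in[OF d_pos] block_override_out[OF d_pos] by auto
    have ev: "eval (N k) (val k (override_on w u (BL d B))) t = eval (N k) (val k w) t"
      if "t \<in> set ts" for t u
      by (rule eval_cong) (use F(2)[OF that] FB ov in auto)
    have RR: "R k (val k (override_on w u (BL d B))) as \<longleftrightarrow> R k (val k w) as" for u as
      by (rule R) (use FB ov in auto)
    {
      assume r: "R k (val k w) (map (eval (N k) (val k w)) ts)"
      have "\<exists>xs\<in>E k. \<pi> k xs = eval (N k) (val k w) t" if "t \<in> set ts" for t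
      proof -
        have "eval (N k) (val k w) t \<in> sdom (N k)"
          by (rule eval_in_sdom[OF strucN[OF k] wf[OF that]])
            (use F(2)[OF that] dom val_in[OF k] in auto)
        then show ?thesis using sdom_N[OF k] by (metis imageE)
      qed
      then obtain xs where xs: "\<And>t. t \<in> set ts \<Longrightarrow> xs t \<in> E k \<and> \<pi> k (xs t) = eval (N k) (val k w) t"
        by metis
      \<comment> \<open>The dummy lists in the blocks outside \<open>B\<close> are discarded by
        \<open>override_on\<close>.\<close>
      have "\<exists>u. \<forall>i. block d u i = (if i \<in> B then xs (ts ! (i - b)) else replicate d 0)"
        by (rule block_surj)
          (use xs in \<open>auto simp: B_def n_def idomset_def\<close>)
      then obtain u where "\<forall>i. block d u i = (if i \<in> B then xs (ts ! (i - b)) else replicate d 0)"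
        by blast
      then have u: "block d u i = xs (ts ! (i - b))" if "i \<in> B" for i using that by simp
      let ?w = "override_on w u (BL d B)"
      have uE: "block d ?w i \<in> E k" if "i \<in> F \<union> B" for i
        using that dom xs u ov by (auto simp: B_def n_def)
      have "u ` BL d B \<subseteq> sdom (M k)"
      proof -
        have "u ` BL d {i} \<subseteq> sdom (M k)" if "i \<in> B" for i
        proof -
          have "block d u i \<in> E k" using uE[of i] that ov by simp
          then show ?thesis using set_block[OF d_pos, of u i] unfolding idomset_def by simp
        qed
        then show ?thesis using BL_UN[of d B] by auto
      qed
      moreover have v: "val k ?w (b + l) = eval (N k) (val k w) (ts ! l)" if "l < n" for l
        using that xs[of "ts ! l"] u[of "b + l"] ov unfolding B_def n_def by simp
      moreover have "block d ?w i \<in> E k" if "l < n" "i \<in> insert (b + l) (fv_trm (ts ! l))" for l i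
        using that F(2)[of "ts ! l"] uE[of i] unfolding B_def n_def by auto
      moreover have "Q k ?w"
      proof -
        have "map (val k ?w) [b..<b + n] = map (eval (N k) (val k w)) ts"
          by (rule nth_equalityI) (use v in \<open>auto simp: n_def\<close>)
        then show ?thesis using QR[OF k, of ?w] uE r RR unfolding B_def n_def by simp
      qed
      ultimately have "P k ?w" unfolding P_def using ev by (auto simp: n_def)
      then show "\<exists>u. u ` BL d B \<subseteq> sdom (M k) \<and> P k (override_on w u (BL d B))"
        using \<open>u ` BL d B \<subseteq> sdom (M k)\<close> by blast
    next
      assume "\<exists>u. u ` BL d B \<subseteq> sdom (M k) \<and> P k (override_on w u (BL d B))"
      then obtain u where p: "P k (override_on w u (BL d B))" by blast
      let ?w = "override_on w u (BL d B)"
      have v: "block d ?w (b + l) \<in> E k" "val k ?w (b + l) = eval (N k) (val k w) (ts ! l)" if "l < n" for l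
        using that p ev[of "ts ! l"] unfolding P_def n_def by auto
      have "block d ?w i \<in> E k" if "i \<in> F \<union> B" for i
        using that dom ov[of u i] v(1)[of "i - b"] FB by (cases "i \<in> B") (auto simp: B_def)
      then have "R k (val k ?w) (map (val k ?w) [b..<b + n])"
        using QR[OF k, of ?w] p unfolding P_def B_def n_def by simp
      moreover have "map (val k ?w) [b..<b + n] = map (eval (N k) (val k w)) ts"
        by (rule nth_equalityI) (use v in \<open>auto simp: n_def\<close>)
      ultimately show "R k (val k w) (map (eval (N k) (val k w)) ts)" using RR by simp
    }
  qed
qed

end

context coded begin

text \<open>The value gets a variable \<open>j\<close> of its own, arbitrary in the induction,
  because the arguments of a function symbol are sent to different fresh blocks.\<close>

lemma term_pull: "wf_trm L' t \<Longrightarrow> dfn L K M (BL d (insert j (fv_trm t)))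
   (\<lambda>k w. (\<forall>i\<in>insert j (fv_trm t). block d w i \<in> E k) \<and> val k w j = eval (N k) (val k w) t)"
proof (induction t arbitrary: j)
  case (Var i)
  have "dfn L K M (BL d {j, i}) (\<lambda>k w. (\<forall>i\<in>{j,i}. block d w i \<in> E k) \<and>
      sat (M k) (lasg (map w (bix d j @ bix d i))) (ieq I))"
    by (intro dfn_Conj dfn_idoms dfn_lasg)
      (use wfI in \<open>auto simp: wf_interp_def bix_def mult_2 set_bix[OF d_pos, unfolded bix_def set_upt] BL_def\<close>)
  then show ?case unfolding fv_trm.simps
    by (rule dfn_cong) (use cod in \<open>auto simp: codes_def block_def\<close>)
next
  case (Fn f ts)
  define F where "F = insert j (fv_trm (Fn f ts))"
  have fin: "finite F" unfolding F_def by (simp add: finite_fv_trm)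
  define b where "b = Suc (Max F)"
  have b: "i < b" if "i \<in> F" for i using fin that unfolding b_def by (simp add: le_imp_less_Suc)
  have ar: "fun_ar L' f = Some (length ts)" using Fn.prems by simp
  \<comment> \<open>The order expected by \<open>ifun\<close>: the blocks of the arguments, then the
    block of the value.\<close>
  define js where "js = concat (map (bix d) [b..<b + length ts]) @ bix d j"
  have js: "length js = d * (length ts + 1)" "set js \<subseteq> BL d (F \<union> {b..<b + length ts})"
    using length_concat_bix[of d "[b..<b + length ts]"] d_pos
    by (auto simp: js_def set_bix BL_def F_def) (simp add: bix_def)
  have mj: "map w js = concat (map (block d w) [b..<b + length ts]) @ block d w j" for w :: "nat \<Rightarrow> nat"
    by (simp add: js_def concat_block block_def)
  have "dfn L K M (BL d F) (\<lambda>k w. (\<forall>i\<in>F. block d w i \<in> E k) \<and>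
      val k w j = sfun (N k) f (map (eval (N k) (val k w)) ts))"
  proof (rule args_pull[where R = "\<lambda>k v as. v j = sfun (N k) f as" and b = b
        and Q = "\<lambda>k w. sat (M k) (lasg (map w js)) (ifun I f)"])
    show "dfn L K M (BL d (F \<union> {b..<b + length ts})) (\<lambda>k w. sat (M k) (lasg (map w js)) (ifun I f))"
      by (rule dfn_lasg) (use wfI ar js in \<open>auto simp: wf_interp_def\<close>)
    fix k and w :: "nat \<Rightarrow> nat"
    assume k: "k \<in> K" and E: "\<And>i. i \<in> F \<union> {b..<b + length ts} \<Longrightarrow> block d w i \<in> E k"
    let ?xss = "map (block d w) [b..<b + length ts]"
    have "fun_ar L' f = Some (length ?xss)" "set ?xss \<subseteq> E k" "block d w j \<in> E k"
      using ar E F_def by auto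
    then have "\<pi> k (block d w j) = sfun (N k) f (map (\<pi> k) ?xss) \<longleftrightarrow>
        sat (M k) (lasg (concat ?xss @ block d w j)) (ifun I f)"
      using cod[OF k] unfolding codes_def by blast
    then show "sat (M k) (lasg (map w js)) (ifun I f) \<longleftrightarrow>
        val k w j = sfun (N k) f (map (val k w) [b..<b + length ts])"
      by (simp add: mj comp_def)
  next
    show "wf_trm L' t" if "t \<in> set ts" for t using Fn.prems that by simp
    show "fv_trm t \<subseteq> F" if "t \<in> set ts" for t using that F_def by auto
    show "v j = sfun (N k) f as \<longleftrightarrow> v' j = sfun (N k) f as"
      if "\<And>i. i \<in> F \<Longrightarrow> v i = v' i" for k and v v' :: "nat \<Rightarrow> nat" and as
      using that F_def by simp
  qed (use Fn fin b in auto)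
  then show ?case unfolding F_def by simp
qed

text \<open>Covers relation symbols and equations alike: an equation is an atom with two argument
  terms and the formula \<open>ieq I\<close>.\<close>

lemma atom_pull:
  assumes wf: "\<And>t. t \<in> set ts \<Longrightarrow> wf_trm L' t" and F: "F = (\<Union>t\<in>set ts. fv_trm t)"
    and \<rho>: "wf_fm L \<rho>" "fv \<rho> \<subseteq> {..<d * length ts}"
    and R: "\<And>k xss. k \<in> K \<Longrightarrow> length xss = length ts \<Longrightarrow> set xss \<subseteq> E k \<Longrightarrow>
       sat (M k) (lasg (concat xss)) \<rho> \<longleftrightarrow> R k (map (\<pi> k) xss)"
  shows "dfn L K M (BL d F) (\<lambda>k w. (\<forall>i\<in>F. block d w i \<in> E k) \<and>
      R k (map (eval (N k) (val k w)) ts))"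
proof -
  have fin: "finite F" unfolding F by (simp add: finite_fv_trm)
  \<comment> \<open>For empty \<open>F\<close> the value of \<open>Max F\<close> is unspecified, but
    then there is no block to avoid.\<close>
  define b where "b = Suc (Max F)"
  have b: "i < b" if "i \<in> F" for i using fin that unfolding b_def by (simp add: le_imp_less_Suc)
  define js where "js = concat (map (bix d) [b..<b + length ts])"
  have js: "length js = d * length ts" "set js \<subseteq> BL d (F \<union> {b..<b + length ts})"
    using length_concat_bix[of d "[b..<b + length ts]"] d_pos
    by (auto simp: js_def set_bix BL_def)
  have mj: "map w js = concat (map (block d w) [b..<b + length ts])" for w :: "nat \<Rightarrow> nat"
    by (simp add: js_def concat_block)
  show ?thesis
  proof (rule args_pull[where R = "\<lambda>k v. R k" and b = b
        and Q = "\<lambda>k w. sat (M k) (lasg (map w js)) \<rho>"])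
    show "dfn L K M (BL d (F \<union> {b..<b + length ts})) (\<lambda>k w. sat (M k) (lasg (map w js)) \<rho>)"
      by (rule dfn_lasg) (use \<rho> js in auto)
    fix k and w :: "nat \<Rightarrow> nat"
    assume k: "k \<in> K" and E: "\<And>i. i \<in> F \<union> {b..<b + length ts} \<Longrightarrow> block d w i \<in> E k"
    show "sat (M k) (lasg (map w js)) \<rho> \<longleftrightarrow> R k (map (val k w) [b..<b + length ts])"
    proof -
      have *: "set (map (block d w) [b..<b + length ts]) \<subseteq> E k" using E by auto
      show ?thesis using R[OF k _ *] by (simp add: mj comp_def)
    qed
  qed (use wf term_pull fin b F in auto)
qed

text \<open>The usual translation along an interpretation, relativised to the domain formula. The
  domain condition has to be restored after a negation, and a quantifier becomes one over a block of
  \<open>d\<close> variables.\<close>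

lemma fm_pull: "wf_fm L' \<phi> \<Longrightarrow> dfn L K M (BL d (fv \<phi>))
   (\<lambda>k w. (\<forall>i\<in>fv \<phi>. block d w i \<in> E k) \<and> sat (N k) (val k w) \<phi>)"
proof (induction \<phi>)
  case (Eq s t)
  have "dfn L K M (BL d (fv (Eq s t))) (\<lambda>k w. (\<forall>i\<in>fv (Eq s t). block d w i \<in> E k) \<and>
      (\<lambda>as. as ! 0 = as ! 1) (map (eval (N k) (val k w)) [s, t]))"
  proof (rule atom_pull[where \<rho> = "ieq I"])
    fix k xss assume k: "k \<in> K" and xss: "length xss = length [s, t]" "set xss \<subseteq> E k"
    obtain xs ys where "xss = [xs, ys]" using xss(1) by (auto simp: length_Suc_conv)
    then show "sat (M k) (lasg (concat xss)) (ieq I) \<longleftrightarrow> (map (\<pi> k) xss ! 0 = map (\<pi> k) xss ! 1)"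
      using cod[OF k] xss(2) by (auto simp: codes_def)
  qed (use Eq wfI in \<open>auto simp: wf_interp_def mult.commute\<close>)
  then show ?case by simp
next
  case (Rel r ts)
  have "dfn L K M (BL d (fv (Rel r ts))) (\<lambda>k w. (\<forall>i\<in>fv (Rel r ts). block d w i \<in> E k) \<and>
      (srel (N k) r) (map (eval (N k) (val k w)) ts))"
  proof (rule atom_pull[where \<rho> = "irel I r"])
    fix k xss assume k: "k \<in> K" and xss: "length xss = length ts" "set xss \<subseteq> E k"
    show "sat (M k) (lasg (concat xss)) (irel I r) \<longleftrightarrow> srel (N k) r (map (\<pi> k) xss)"
      using cod[OF k] xss Rel by (auto simp: codes_def)
  qed (use Rel wfI in \<open>auto simp: wf_interp_def\<close>)
  then show ?case by simp
next
  case (Neg \<phi>)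
  have "dfn L K M (BL d (fv \<phi>)) (\<lambda>k w. (\<forall>i\<in>fv \<phi>. block d w i \<in> E k) \<and>
     \<not> ((\<forall>i\<in>fv \<phi>. block d w i \<in> E k) \<and> sat (N k) (val k w) \<phi>))"
    by (intro dfn_Conj dfn_idoms dfn_Neg Neg) (use Neg.prems in \<open>auto simp: finite_fv\<close>)
  then show ?case unfolding fv.simps by (rule dfn_cong) auto
next
  case (Conj \<phi> \<psi>)
  have "dfn L K M (BL d (fv \<phi> \<union> fv \<psi>)) (\<lambda>k w. ((\<forall>i\<in>fv \<phi>. block d w i \<in> E k) \<and> sat (N k) (val k w) \<phi>) \<and>
     ((\<forall>i\<in>fv \<psi>. block d w i \<in> E k) \<and> sat (N k) (val k w) \<psi>))"
    by (rule dfn_Conj[OF dfn_mono[OF Conj.IH(1)] dfn_mono[OF Conj.IH(2)]])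
      (use Conj.prems in \<open>auto simp: BL_def\<close>)
  then show ?case unfolding fv.simps by (rule dfn_cong) auto
next
  case (Ex i \<phi>)
  \<comment> \<open>The domain condition for block \<open>i\<close> is added separately, since
    \<open>i\<close> need not be free in \<open>\<phi>\<close>.\<close>
  let ?P = "\<lambda>k w. block d w i \<in> E k \<and> (\<forall>i\<in>fv \<phi>. block d w i \<in> E k) \<and> sat (N k) (val k w) \<phi>"
  have "dfn L K M (BL d (insert i (fv \<phi>))) ?P"
    by (intro dfn_Conj[OF dfn_idom] dfn_mono[OF Ex.IH] BL_mono) (use Ex.prems in auto)
  then have "dfn L K M (BL d (insert i (fv \<phi>)) - BL d {i})
     (\<lambda>k w. \<exists>u. u ` BL d {i} \<subseteq> sdom (M k) \<and> ?P k (override_on w u (BL d {i})))"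
    by (rule dfn_exs) (simp add: finite_BL d_pos)
  moreover have "BL d (insert i (fv \<phi>)) - BL d {i} = BL d (fv (Ex i \<phi>))" unfolding BL_def by auto
  ultimately show ?case
  proof (simp only:, elim dfn_cong)
    fix k and w :: "nat \<Rightarrow> nat" assume k: "k \<in> K"
    have ov: "block d (override_on w u (BL d {i})) l = (if l = i then block d u i else block d w l)" for u :: "nat \<Rightarrow> nat" and l
      using block_override_in[OF d_pos, of l "{i}" w u] block_override_out[OF d_pos, of l "{i}" w u] by auto
    have ev: "sat (N k) (val k (override_on w u (BL d {i}))) \<phi> \<longleftrightarrow>
        sat (N k) ((val k w)(i := \<pi> k (block d u i))) \<phi>" for u
      by (rule sat_cong) (auto simp: ov)
    have "?P k (override_on w u (BL d {i})) \<longleftrightarrow> block d u i \<in> E k \<and>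
         (\<forall>i\<in>fv (Ex i \<phi>). block d w i \<in> E k) \<and> sat (N k) ((val k w)(i := \<pi> k (block d u i))) \<phi>" for u
      unfolding ev by (auto simp: ov)
    then have "(\<exists>u. u ` BL d {i} \<subseteq> sdom (M k) \<and> ?P k (override_on w u (BL d {i}))) \<longleftrightarrow>
       (\<exists>u. u ` BL d {i} \<subseteq> sdom (M k) \<and> block d u i \<in> E k \<and>
         (\<forall>i\<in>fv (Ex i \<phi>). block d w i \<in> E k) \<and> sat (N k) ((val k w)(i := \<pi> k (block d u i))) \<phi>)"
      by simp
    also have "\<dots> \<longleftrightarrow> (\<exists>xs\<in>E k. (\<forall>i\<in>fv (Ex i \<phi>). block d w i \<in> E k) \<and>
         sat (N k) ((val k w)(i := \<pi> k xs)) \<phi>)"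
    proof -
      have "\<exists>u. u ` BL d {i} \<subseteq> sdom (M k) \<and> block d u i = xs" if "xs \<in> E k" for xs
      proof -
        have "\<exists>u. \<forall>i. block d u i = xs" by (rule block_surj) (use that in \<open>simp add: idomset_def\<close>)
        then obtain u where u: "block d u i = xs" by blast
        then have "u ` BL d {i} \<subseteq> sdom (M k)"
          using set_block[OF d_pos, of u i] that unfolding idomset_def by simp
        then show ?thesis using u by blast
      qed
      then show ?thesis by metis
    qed
    also have "\<dots> \<longleftrightarrow> (\<forall>i\<in>fv (Ex i \<phi>). block d w i \<in> E k) \<and> sat (N k) (val k w) (Ex i \<phi>)"
      using sdom_N[OF k] by auto
    finally show "(\<forall>i\<in>fv (Ex i \<phi>). block d w i \<in> E k) \<and> sat (N k) (val k w) (Ex i \<phi>) \<longleftrightarrow>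
      (\<exists>u. u ` BL d {i} \<subseteq> sdom (M k) \<and> ?P k (override_on w u (BL d {i})))" by blast
  qed
qed

end

section \<open>Transport of codings along isomorphisms\<close>

lemma sat_map:
  assumes "struc_iso L A B g" "is_struc L A" "wf_fm L \<phi>" "fv \<phi> \<subseteq> {..<length xs}" "set xs \<subseteq> sdom A"
  shows "sat B (lasg (map g xs)) \<phi> \<longleftrightarrow> sat A (lasg xs) \<phi>"
proof -
  have "sat B (lasg (map g xs)) \<phi> \<longleftrightarrow> sat B (\<lambda>i. g (lasg xs i)) \<phi>"
    by (rule sat_cong) (use assms(4) in \<open>auto simp: lasg_def\<close>)
  also have "\<dots> \<longleftrightarrow> sat A (lasg xs) \<phi>"
    by (rule iso_sat[OF assms(1,2,3)]) (use assms(4,5) in \<open>auto simp: lasg_def subset_iff\<close>)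
  finally show ?thesis .
qed

lemma map_iso_surj:
  assumes "g ` X = Y" "set ys \<subseteq> Y"
  shows "\<exists>xs. set xs \<subseteq> X \<and> map g xs = ys"
proof (intro exI conjI)
  show "set (map (inv_into X g) ys) \<subseteq> X" using assms by (auto intro!: inv_into_into)
  show "map g (map (inv_into X g) ys) = ys"
    using assms by (auto simp: f_inv_into_f subset_iff intro!: map_idI)
qed

lemma idomset_iso:
  assumes iso: "struc_iso L A B g" and st: "is_struc L A" and wf: "wf_interp L L' I"
    and xs: "set xs \<subseteq> sdom A"
  shows "map g xs \<in> idomset I B \<longleftrightarrow> xs \<in> idomset I A"
proof -
  have im: "g ` sdom A = sdom B" using iso unfolding struc_iso_def bij_betw_def by blast
  have "length xs = idim I \<Longrightarrow> sat B (lasg (map g xs)) (idom I) \<longleftrightarrow> sat A (lasg xs) (idom I)"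
    by (rule sat_map[OF iso st]) (use wf xs in \<open>auto simp: wf_interp_def\<close>)
  then show ?thesis using xs im unfolding idomset_def by auto
qed

lemma concat_idomset:
  assumes "set xss \<subseteq> idomset I A"
  shows "length (concat xss) = idim I * length xss" "set (concat xss) \<subseteq> sdom A"
  using assms by (induction xss) (auto simp: idomset_def)

text \<open>The formulas of the interpretation are invariant under isomorphism. The intended
  \<open>A\<close> is a quotient structure and \<open>B\<close> its copy on
  \<open>nat\<close>.\<close>

lemma codes_iso_source:
  assumes iso: "struc_iso L A B g" and st: "is_struc L A" and wf: "wf_interp L L' I"
    and c: "codes L' I B N \<pi>"
  shows "codes L' I A N (\<lambda>xs. \<pi> (map g xs))"
proof -
  have im: "g ` sdom A = sdom B" using iso unfolding struc_iso_def bij_betw_def by blast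
  have E: "map g xs \<in> idomset I B" if "xs \<in> idomset I A" for xs
    using idomset_iso[OF iso st wf, of xs] that unfolding idomset_def by blast
  have im2: "map g ` idomset I A = idomset I B"
  proof (intro equalityI subsetI)
    fix ys assume ys: "ys \<in> idomset I B"
    then obtain xs where xs: "set xs \<subseteq> sdom A" "map g xs = ys"
      using map_iso_surj[OF im, of ys] unfolding idomset_def by blast
    then show "ys \<in> map g ` idomset I A" using idomset_iso[OF iso st wf xs(1)] ys by blast
  qed (use E in blast)
  have mm: "map (\<lambda>xs. \<pi> (map g xs)) xss = map \<pi> (map (map g) xss)" for xss by simp
  have s: "set (map (map g) xss) \<subseteq> idomset I B" if "set xss \<subseteq> idomset I A" for xss
    using that E by auto
  have "(\<lambda>xs. \<pi> (map g xs)) ` idomset I A = \<pi> ` idomset I B" unfolding im2[symmetric] by (simp add: image_image)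
  moreover have "\<pi> (map g xs) = \<pi> (map g ys) \<longleftrightarrow> sat B (lasg (map g xs @ map g ys)) (ieq I)"
    if "xs \<in> idomset I A" "ys \<in> idomset I A" for xs ys
    using c E that unfolding codes_def by blast
  moreover have "srel N r (map \<pi> (map (map g) xss)) \<longleftrightarrow> sat B (lasg (concat (map (map g) xss))) (irel I r)"
    if "rel_ar L' r = Some (length xss)" "set xss \<subseteq> idomset I A" for r xss
    using c s[OF that(2)] that(1) unfolding codes_def by (metis length_map)
  moreover have "\<pi> (map g ys) = sfun N f (map \<pi> (map (map g) xss)) \<longleftrightarrow>
      sat B (lasg (concat (map (map g) xss) @ map g ys)) (ifun I f)"
    if "fun_ar L' f = Some (length xss)" "set xss \<subseteq> idomset I A" "ys \<in> idomset I A" for f xss ys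
    using c s[OF that(2)] E[OF that(3)] that(1) unfolding codes_def by (metis length_map)
  moreover have "sat B (lasg (map g xs @ map g ys)) (ieq I) \<longleftrightarrow> sat A (lasg (xs @ ys)) (ieq I)"
    if "xs \<in> idomset I A" "ys \<in> idomset I A" for xs ys
    unfolding map_append[symmetric]
    by (rule sat_map[OF iso st]) (use wf that in \<open>auto simp: wf_interp_def idomset_def\<close>)
  moreover have "sat B (lasg (concat (map (map g) xss))) (irel I r) \<longleftrightarrow> sat A (lasg (concat xss)) (irel I r)"
    if "rel_ar L' r = Some (length xss)" "set xss \<subseteq> idomset I A" for r xss
    unfolding map_concat[symmetric]
    by (rule sat_map[OF iso st]) (use wf that concat_idomset[OF that(2)] in \<open>auto simp: wf_interp_def\<close>)
  moreover have "sat B (lasg (concat (map (map g) xss) @ map g ys)) (ifun I f) \<longleftrightarrow>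
      sat A (lasg (concat xss @ ys)) (ifun I f)"
    if "fun_ar L' f = Some (length xss)" "set xss \<subseteq> idomset I A" "ys \<in> idomset I A" for f xss ys
    unfolding map_concat[symmetric] map_append[symmetric]
    by (rule sat_map[OF iso st])
      (use wf that concat_idomset[OF that(2)] in \<open>auto simp: wf_interp_def idomset_def add.commute\<close>)
  moreover have "\<pi> ` idomset I B = sdom N" using c unfolding codes_def by blast
  ultimately show ?thesis unfolding codes_def mm by simp
qed

text \<open>This both moves a quotient to \<open>nat\<close> and puts a model in place of an
  isomorphic structure decoded from it.\<close>

lemma codes_iso_target:
  assumes iso: "struc_iso L' N N2 h" and st: "is_struc L' N" and c: "codes L' I A N \<pi>"
  shows "codes L' I A N2 (\<lambda>xs. h (\<pi> xs))"
proof -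
  have bij: "inj_on h (sdom N)" "h ` sdom N = sdom N2"
    using iso unfolding struc_iso_def bij_betw_def by auto
  have im: "\<pi> ` idomset I A = sdom N" using c unfolding codes_def by blast
  then have E: "\<pi> xs \<in> sdom N" if "xs \<in> idomset I A" for xs using that by blast
  have s: "set (map \<pi> xss) \<subseteq> sdom N" if "set xss \<subseteq> idomset I A" for xss
    using that E by auto
  have mm: "map (\<lambda>xs. h (\<pi> xs)) xss = map h (map \<pi> xss)" for xss by simp
  have hin: "h x = h y \<longleftrightarrow> x = y" if "x \<in> sdom N" "y \<in> sdom N" for x y
    using bij that by (meson inj_onD)
  have "(\<lambda>xs. h (\<pi> xs)) ` idomset I A = h ` (\<pi> ` idomset I A)" by (simp only: image_image)
  then have "(\<lambda>xs. h (\<pi> xs)) ` idomset I A = sdom N2" unfolding im bij(2) .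
  moreover have "\<forall>xs\<in>idomset I A. \<forall>ys\<in>idomset I A. h (\<pi> xs) = h (\<pi> ys) \<longleftrightarrow> sat A (lasg (xs @ ys)) (ieq I)"
    using c hin E unfolding codes_def by simp
  moreover have "srel N2 r (map h (map \<pi> xss)) \<longleftrightarrow> sat A (lasg (concat xss)) (irel I r)"
    if "rel_ar L' r = Some (length xss)" "set xss \<subseteq> idomset I A" for r xss
  proof -
    have "srel N r (map \<pi> xss) \<longleftrightarrow> srel N2 r (map h (map \<pi> xss))"
      using iso s[OF that(2)] that(1) unfolding struc_iso_def by (metis length_map)
    then show ?thesis using c that unfolding codes_def by blast
  qed
  moreover have "h (\<pi> ys) = sfun N2 f (map h (map \<pi> xss)) \<longleftrightarrow> sat A (lasg (concat xss @ ys)) (ifun I f)"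
    if "fun_ar L' f = Some (length xss)" "set xss \<subseteq> idomset I A" "ys \<in> idomset I A" for f xss ys
  proof -
    have "h (sfun N f (map \<pi> xss)) = sfun N2 f (map h (map \<pi> xss))"
      using iso s[OF that(2)] that(1) unfolding struc_iso_def by (metis length_map)
    moreover have "sfun N f (map \<pi> xss) \<in> sdom N"
      using st s[OF that(2)] that(1) unfolding is_struc_def by (metis length_map)
    ultimately have "h (\<pi> ys) = sfun N2 f (map h (map \<pi> xss)) \<longleftrightarrow> \<pi> ys = sfun N f (map \<pi> xss)"
      using hin E that by metis
    then show ?thesis using c that unfolding codes_def by blast
  qed
  ultimately show ?thesis unfolding codes_def mm by blast
qed

section \<open>Quotient structures versus codings\<close>

definition cls :: "interp \<Rightarrow> 'a struc \<Rightarrow> 'a list \<Rightarrow> 'a list set" where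
  "cls I M xs = ieqrel I M `` {xs}"

text \<open>The choice of representative is harmless for the classes of a coding, on each of which
  \<open>\<pi>\<close> is constant.\<close>

definition uncls :: "('a list \<Rightarrow> 'b) \<Rightarrow> 'a list set \<Rightarrow> 'b" where
  "uncls \<pi> C = \<pi> (SOME xs. xs \<in> C)"

lemma quot_eq: "idomset I M // ieqrel I M = cls I M ` idomset I M"
  unfolding quotient_def cls_def by blast

lemma cls_codes:
  assumes "codes L' I M N \<pi>" "xs \<in> idomset I M"
  shows "cls I M xs = {ys \<in> idomset I M. \<pi> ys = \<pi> xs}" "uncls \<pi> (cls I M xs) = \<pi> xs"
proof -
  show 1: "cls I M xs = {ys \<in> idomset I M. \<pi> ys = \<pi> xs}"
  proof -
    have "(xs, ys) \<in> ieqrel I M \<longleftrightarrow> ys \<in> idomset I M \<and> \<pi> ys = \<pi> xs" for ys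
      using assms unfolding codes_def ieqrel_def by (simp, metis)
    then show ?thesis unfolding cls_def by blast
  qed
  have "(SOME ys. ys \<in> cls I M xs) \<in> cls I M xs"
    by (rule someI[of _ xs]) (use 1 assms(2) in simp)
  then show "uncls \<pi> (cls I M xs) = \<pi> xs" unfolding uncls_def 1 by blast
qed

text \<open>The last claim describes all other choices of representatives: those with the same
  decoded values. This is what makes the operations of the quotient independent of the
  choice.\<close>

lemma reps:
  assumes c: "codes L' I M N \<pi>" and cs: "set cs \<subseteq> sdom (interp_struc I M)"
  obtains xss where "set xss \<subseteq> idomset I M" "cs = map (cls I M) xss"
    "map (uncls \<pi>) cs = map \<pi> xss"
    "\<And>yss. list_all2 (\<lambda>xs c. xs \<in> c) yss cs \<longleftrightarrow> set yss \<subseteq> idomset I M \<and> map \<pi> yss = map \<pi> xss"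
proof -
  obtain xss where xss: "set xss \<subseteq> idomset I M" "map (cls I M) xss = cs"
    using map_iso_surj[of "cls I M" "idomset I M" "sdom (interp_struc I M)" cs] cs quot_eq[of I M]
    unfolding interp_struc_def by auto
  have "map (uncls \<pi>) cs = map \<pi> xss"
    using xss cls_codes(2)[OF c] by (auto simp: subset_iff)
  moreover have "list_all2 (\<lambda>xs c. xs \<in> c) yss (map (cls I M) xss) \<longleftrightarrow>
      set yss \<subseteq> idomset I M \<and> map \<pi> yss = map \<pi> xss" for yss
    using xss(1)
  proof (induction xss arbitrary: yss)
    case Nil then show ?case by auto
  next
    case (Cons xs xss)
    then show ?case using cls_codes(1)[OF c, of xs] by (cases yss) auto
  qed
  ultimately show ?thesis using that xss by blast
qed

text \<open>Relations and functions of the quotient depend only on decoded values, by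
  \<open>reps\<close>. The argument rests on the coding instead of the clauses of
  \<open>is_interp\<close>, which speak only of models on \<open>nat\<close>, so it also covers an
  interpretation inside a quotient.\<close>

lemma interp_iso:
  assumes c: "codes L' I M N \<pi>" and st: "is_struc L' N"
  shows "struc_iso L' (interp_struc I M) N (uncls \<pi>)" "is_struc L' (interp_struc I M)"
proof -
  let ?A = "interp_struc I M"
  have dom: "sdom ?A = cls I M ` idomset I M" unfolding interp_struc_def by (simp add: quot_eq)
  have im: "\<pi> ` idomset I M = sdom N" using c unfolding codes_def by blast
  have bij: "bij_betw (uncls \<pi>) (sdom ?A) (sdom N)"
    unfolding bij_betw_def
  proof
    show "inj_on (uncls \<pi>) (sdom ?A)"
      unfolding dom inj_on_def using cls_codes[OF c] by auto
    show "uncls \<pi> ` sdom ?A = sdom N"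
      unfolding dom im[symmetric] image_image using cls_codes(2)[OF c] by simp
  qed
  have r: "srel ?A r cs \<longleftrightarrow> srel N r (map (uncls \<pi>) cs)"
    if ar: "rel_ar L' r = Some (length cs)" and cs: "set cs \<subseteq> sdom ?A" for r cs
  proof -
    obtain xss where xss: "set xss \<subseteq> idomset I M" "cs = map (cls I M) xss"
      "map (uncls \<pi>) cs = map \<pi> xss"
      "\<And>yss. list_all2 (\<lambda>xs c. xs \<in> c) yss cs \<longleftrightarrow> set yss \<subseteq> idomset I M \<and> map \<pi> yss = map \<pi> xss"
      using reps[OF c cs] by blast
    have "sat M (lasg (concat yss)) (irel I r) \<longleftrightarrow> srel N r (map \<pi> xss)"
      if "set yss \<subseteq> idomset I M" "map \<pi> yss = map \<pi> xss" for yss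
    proof -
      have "length yss = length cs" using xss(2) map_eq_imp_length_eq[OF that(2)] by simp
      then show ?thesis using c that ar unfolding codes_def by metis
    qed
    then have "(\<exists>yss. list_all2 (\<lambda>xs c. xs \<in> c) yss cs \<and> sat M (lasg (concat yss)) (irel I r)) \<longleftrightarrow>
        srel N r (map \<pi> xss)"
      unfolding xss(4) using xss(1) by blast
    then show ?thesis unfolding xss(3) by (simp add: interp_struc_def)
  qed
  have f: "sfun ?A f cs \<in> sdom ?A \<and> uncls \<pi> (sfun ?A f cs) = sfun N f (map (uncls \<pi>) cs)"
    if ar: "fun_ar L' f = Some (length cs)" and cs: "set cs \<subseteq> sdom ?A" for f cs
  proof -
    obtain xss where xss: "set xss \<subseteq> idomset I M" "cs = map (cls I M) xss"
      "map (uncls \<pi>) cs = map \<pi> xss"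
      "\<And>yss. list_all2 (\<lambda>xs c. xs \<in> c) yss cs \<longleftrightarrow> set yss \<subseteq> idomset I M \<and> map \<pi> yss = map \<pi> xss"
      using reps[OF c cs] by blast
    have *: "sat M (lasg (concat yss @ ys)) (ifun I f) \<longleftrightarrow> \<pi> ys = sfun N f (map \<pi> xss)"
      if "set yss \<subseteq> idomset I M" "map \<pi> yss = map \<pi> xss" "ys \<in> idomset I M" for yss ys
    proof -
      have "length yss = length cs" using xss(2) map_eq_imp_length_eq[OF that(2)] by simp
      then show ?thesis using c that ar unfolding codes_def by metis
    qed
    have "set (map \<pi> xss) \<subseteq> sdom N" using xss(1) im by auto
    then have "sfun N f (map \<pi> xss) \<in> sdom N"
      using st ar xss(2) unfolding is_struc_def by (metis length_map)
    then obtain zs where zs: "zs \<in> idomset I M" "\<pi> zs = sfun N f (map \<pi> xss)"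
      using im by (metis imageE)
    have "sfun ?A f cs = (THE c. c \<in> cls I M ` idomset I M \<and>
        (\<exists>yss ys. list_all2 (\<lambda>xs c. xs \<in> c) yss cs \<and> ys \<in> c \<and>
          sat M (lasg (concat yss @ ys)) (ifun I f)))"
      unfolding interp_struc_def by (simp add: quot_eq)
    also have "\<dots> = cls I M zs"
    proof (rule the_equality, intro conjI exI)
      show "cls I M zs \<in> cls I M ` idomset I M" using zs by simp
      show "list_all2 (\<lambda>xs c. xs \<in> c) xss cs" unfolding xss(4) using xss(1) by simp
      show "zs \<in> cls I M zs" using cls_codes(1)[OF c zs(1)] zs(1) by simp
      show "sat M (lasg (concat xss @ zs)) (ifun I f)" using *[OF xss(1) refl zs(1)] zs(2) by simp
    next
      \<comment> \<open>Any other candidate class decodes to the same value of the function in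
        \<open>N\<close>, hence is the same class.\<close>
      fix C assume C: "C \<in> cls I M ` idomset I M \<and>
        (\<exists>yss ys. list_all2 (\<lambda>xs c. xs \<in> c) yss cs \<and> ys \<in> C \<and>
          sat M (lasg (concat yss @ ys)) (ifun I f))"
      then obtain xs yss ys where 1: "xs \<in> idomset I M" "C = cls I M xs" "set yss \<subseteq> idomset I M"
        "map \<pi> yss = map \<pi> xss" "ys \<in> C" "sat M (lasg (concat yss @ ys)) (ifun I f)"
        using xss(4) by blast
      then have ys: "ys \<in> idomset I M" "\<pi> ys = \<pi> xs" using cls_codes(1)[OF c] by auto
      then have "\<pi> ys = \<pi> zs" using *[OF 1(3,4)] 1(6) zs(2) by simp
      then show "C = cls I M zs" using 1 ys zs cls_codes(1)[OF c] by simp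
    qed
    finally show ?thesis using dom zs cls_codes(2)[OF c zs(1)] xss(3) by simp
  qed
  show "struc_iso L' ?A N (uncls \<pi>)" unfolding struc_iso_def using bij r f by blast
  have "sdom ?A \<noteq> {}" using bij st unfolding is_struc_def bij_betw_def by auto
  then show "is_struc L' ?A" unfolding is_struc_def using f by blast
qed

text \<open>This is where the congruence, totality and uniqueness clauses of
  \<open>is_interp\<close> enter; later arguments see only the coding.\<close>

lemma codes_interp:
  assumes I: "is_interp L T L' T' I" and M: "model L T (M :: nat struc)"
  shows "codes L' I M (interp_struc I M) (cls I M)"
proof -
  let ?A = "interp_struc I M"
  let ?E = "idomset I M"
  have eq: "equiv ?E (ieqrel I M)" using I M unfolding is_interp_def by blast
  have rel: "\<And>r xss yss. rel_ar L' r = Some (length xss) \<Longrightarrow>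
      list_all2 (\<lambda>xs ys. (xs, ys) \<in> ieqrel I M) xss yss \<Longrightarrow>
      (sat M (lasg (concat xss)) (irel I r) \<longleftrightarrow> sat M (lasg (concat yss)) (irel I r))"
    using I M unfolding is_interp_def by metis
  have fn: "\<And>f xss. fun_ar L' f = Some (length xss) \<Longrightarrow> set xss \<subseteq> ?E \<Longrightarrow>
            (\<exists>ys\<in>?E. sat M (lasg (concat xss @ ys)) (ifun I f)) \<and>
            (\<forall>ys zs. ys \<in> ?E \<and> zs \<in> ?E \<and>
               sat M (lasg (concat xss @ ys)) (ifun I f) \<and>
               sat M (lasg (concat xss @ zs)) (ifun I f) \<longrightarrow> (ys, zs) \<in> ieqrel I M)"
    using I M unfolding is_interp_def by blast
  have fc: "\<And>f xss yss ys zs. fun_ar L' f = Some (length xss) \<Longrightarrow>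
      list_all2 (\<lambda>xs ys. (xs, ys) \<in> ieqrel I M) xss yss \<Longrightarrow> (ys, zs) \<in> ieqrel I M \<Longrightarrow>
      (sat M (lasg (concat xss @ ys)) (ifun I f) \<longleftrightarrow> sat M (lasg (concat yss @ zs)) (ifun I f))"
    using I M unfolding is_interp_def by metis
  have mem: "ys \<in> cls I M xs \<longleftrightarrow> (xs, ys) \<in> ieqrel I M" for xs ys unfolding cls_def by simp
  have refl: "xs \<in> cls I M xs" if "xs \<in> ?E" for xs
    using eq that unfolding mem by (meson equivE refl_onD)
  have ceq: "cls I M xs = cls I M ys \<longleftrightarrow> (xs, ys) \<in> ieqrel I M" if "xs \<in> ?E" "ys \<in> ?E" for xs ys
    using eq_equiv_class_iff[OF eq that] unfolding cls_def .
  have la: "list_all2 (\<lambda>xs c. xs \<in> c) yss (map (cls I M) xss) \<longleftrightarrow>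
      list_all2 (\<lambda>xs ys. (xs, ys) \<in> ieqrel I M) xss yss" for xss yss
    unfolding list_all2_map2 mem by (metis (mono_tags, lifting) list_all2_conv_all_nth)
  have lrefl: "list_all2 (\<lambda>xs ys. (xs, ys) \<in> ieqrel I M) xss xss" if "set xss \<subseteq> ?E" for xss
    using that refl unfolding mem by (auto simp: list_all2_conv_all_nth subset_iff)
  have "srel ?A r (map (cls I M) xss) \<longleftrightarrow> sat M (lasg (concat xss)) (irel I r)"
    if "rel_ar L' r = Some (length xss)" "set xss \<subseteq> ?E" for r xss
  proof -
    have "(\<exists>yss. list_all2 (\<lambda>xs c. xs \<in> c) yss (map (cls I M) xss) \<and>
        sat M (lasg (concat yss)) (irel I r)) \<longleftrightarrow> sat M (lasg (concat xss)) (irel I r)"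
      unfolding la using rel[OF that(1)] lrefl[OF that(2)] by blast
    then show ?thesis by (simp add: interp_struc_def)
  qed
  moreover have "cls I M ys = sfun ?A f (map (cls I M) xss) \<longleftrightarrow>
      sat M (lasg (concat xss @ ys)) (ifun I f)"
    if ar: "fun_ar L' f = Some (length xss)" and xss: "set xss \<subseteq> ?E" and ys: "ys \<in> ?E" for f xss ys
  proof -
    obtain zs where zs: "zs \<in> ?E" "sat M (lasg (concat xss @ zs)) (ifun I f)"
      using fn[OF ar xss] by blast
    have "sfun ?A f (map (cls I M) xss) = (THE c. c \<in> cls I M ` ?E \<and>
        (\<exists>yss ys. list_all2 (\<lambda>xs c. xs \<in> c) yss (map (cls I M) xss) \<and> ys \<in> c \<and>
          sat M (lasg (concat yss @ ys)) (ifun I f)))"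
      unfolding interp_struc_def by (simp add: quot_eq)
    also have "\<dots> = cls I M zs"
    proof (rule the_equality, intro conjI exI)
      show "cls I M zs \<in> cls I M ` ?E" using zs by simp
      show "list_all2 (\<lambda>xs c. xs \<in> c) xss (map (cls I M) xss)" unfolding la by (rule lrefl[OF xss])
      show "zs \<in> cls I M zs" by (rule refl[OF zs(1)])
      show "sat M (lasg (concat xss @ zs)) (ifun I f)" by (rule zs)
    next
      fix C assume "C \<in> cls I M ` ?E \<and>
        (\<exists>yss ys. list_all2 (\<lambda>xs c. xs \<in> c) yss (map (cls I M) xss) \<and> ys \<in> C \<and>
          sat M (lasg (concat yss @ ys)) (ifun I f))"
      then obtain xs yss ys where 1: "xs \<in> ?E" "C = cls I M xs"
        "list_all2 (\<lambda>xs ys. (xs, ys) \<in> ieqrel I M) xss yss"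
        "(xs, ys) \<in> ieqrel I M" "sat M (lasg (concat yss @ ys)) (ifun I f)"
        unfolding la mem by (auto simp: mem)
      have ys: "ys \<in> ?E" using 1(4) unfolding ieqrel_def by blast
      have "(ys, ys) \<in> ieqrel I M" using refl[OF ys] mem by blast
      then have "sat M (lasg (concat xss @ ys)) (ifun I f)"
        using fc[OF ar 1(3)] 1(5) by blast
      then have "(ys, zs) \<in> ieqrel I M" using fn[OF ar xss] ys zs by blast
      then show "C = cls I M zs" using 1 ceq ys zs by metis
    qed
    finally have "sfun ?A f (map (cls I M) xss) = cls I M zs" .
    moreover have "sat M (lasg (concat xss @ ys)) (ifun I f) \<longleftrightarrow> (ys, zs) \<in> ieqrel I M"
      using fn[OF ar xss] fc[OF ar lrefl[OF xss]] ys zs by blast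
    ultimately show ?thesis using ceq ys zs by simp
  qed
  moreover have "cls I M ` ?E = sdom ?A" unfolding interp_struc_def by (simp add: quot_eq)
  moreover have "cls I M xs = cls I M ys \<longleftrightarrow> sat M (lasg (xs @ ys)) (ieq I)"
    if "xs \<in> ?E" "ys \<in> ?E" for xs ys
    unfolding ceq[OF that] using that unfolding ieqrel_def by blast
  ultimately show ?thesis unfolding codes_def by (simp only: simp_thms ball_simps) simp
qed

lemma nat_copy:
  assumes A: "is_struc L A" and c: "countable (sdom A)"
  shows "\<exists>(N :: nat struc) g. struc_iso L A N g"
proof -
  let ?g = "to_nat_on (sdom A)"
  let ?h = "inv_into (sdom A) ?g"
  have inj: "inj_on ?g (sdom A)" by (rule inj_on_to_nat_on[OF c])
  let ?N = "\<lparr> sdom = ?g ` sdom A, srel = (\<lambda>r ys. srel A r (map ?h ys)),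
    sfun = (\<lambda>f ys. ?g (sfun A f (map ?h ys))) \<rparr>"
  have "map ?h (map ?g xs) = xs" if "set xs \<subseteq> sdom A" for xs
    using that inv_into_f_f[OF inj] by (auto simp: subset_iff intro!: map_idI)
  then have "struc_iso L A ?N ?g" unfolding struc_iso_def bij_betw_def using inj by simp
  then show ?thesis by blast
qed

lemma is_interp_wf: "is_interp L T L' T' I \<Longrightarrow> wf_interp L L' I"
  unfolding is_interp_def wf_interp_def by (intro conjI; elim conjE; assumption)

text \<open>Classes of lists over \<open>nat\<close> have list representatives, so the quotient is
  countable and can be copied to \<open>nat\<close>; the class map composed with the copying map is
  the coding.\<close>

lemma interp_copy:
  assumes I: "is_interp L T L' T' I" and M: "model L T (M :: nat struc)"
    and T': "\<And>\<phi>. \<phi> \<in> T' \<Longrightarrow> sentence L' \<phi>"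
  obtains N :: "nat struc" and \<pi> where "model L' T' N" "codes L' I M N \<pi>"
proof -
  let ?A = "interp_struc I M"
  have A: "model L' T' ?A" using I M unfolding is_interp_def by blast
  then have st: "is_struc L' ?A" unfolding model_def by blast
  have "countable (sdom ?A)" unfolding interp_struc_def by (simp add: quot_eq)
  then obtain N :: "nat struc" and g where g: "struc_iso L' ?A N g" using nat_copy[OF st] by blast
  then have "model L' T' N" using iso_model[OF g A T'] iso_is_struc[OF g st] by blast
  moreover have "codes L' I M N (\<lambda>xs. g (cls I M xs))"
    by (rule codes_iso_target[OF g st codes_interp[OF I M]])
  ultimately show ?thesis by (rule that)
qed

text \<open>\<open>defines_iso\<close> speaks of two nested quotients. The inner one is exchanged
  for \<open>N\<close> and the outer one for \<open>M2\<close>. The given isomorphism then becomes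
  \<open>\<beta>\<close>, and \<open>\<theta>\<close> says that decoding \<open>ys\<close> twice
  yields \<open>\<beta> a\<close>.\<close>

lemma defines_iso_codes:
  assumes di: "defines_iso L M \<Gamma> \<Delta> \<theta>" and M: "is_struc L M"
    and \<Delta>: "wf_interp L' L \<Delta>"
    and c: "codes L' \<Gamma> M N \<pi>" and N: "is_struc L' N"
    and c2: "codes L \<Delta> N M2 \<pi>2" and M2: "is_struc L M2"
  obtains \<beta> where "struc_iso L M M2 \<beta>"
    "\<And>a ys. a \<in> sdom M \<Longrightarrow> length ys = idim \<Gamma> * idim \<Delta> \<Longrightarrow> set ys \<subseteq> sdom M \<Longrightarrow>
       sat M (lasg (a # ys)) \<theta> \<longleftrightarrow> (\<forall>i<idim \<Delta>. chunk (idim \<Gamma>) i ys \<in> idomset \<Gamma> M) \<and>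
         map (\<lambda>i. \<pi> (chunk (idim \<Gamma>) i ys)) [0..<idim \<Delta>] \<in> idomset \<Delta> N \<and>
         \<pi>2 (map (\<lambda>i. \<pi> (chunk (idim \<Gamma>) i ys)) [0..<idim \<Delta>]) = \<beta> a"
proof -
  let ?A = "interp_struc \<Gamma> M"
  let ?p = "uncls \<pi>"
  note iA = interp_iso[OF c N]
  have cA: "codes L \<Delta> ?A M2 (\<lambda>cs. \<pi>2 (map ?p cs))"
    by (rule codes_iso_source[OF iA \<Delta> c2])
  let ?q = "uncls (\<lambda>cs. \<pi>2 (map ?p cs))"
  have iB: "struc_iso L (interp_struc \<Delta> ?A) M2 ?q" by (rule interp_iso[OF cA M2])
  obtain h where h: "struc_iso L M (interp_struc \<Delta> ?A) h"
    and \<theta>: "\<And>a ys. a \<in> sdom M \<Longrightarrow> length ys = idim \<Gamma> * idim \<Delta> \<Longrightarrow> set ys \<subseteq> sdom M \<Longrightarrow>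
           (sat M (lasg (a # ys)) \<theta> \<longleftrightarrow>
              (\<forall>i<idim \<Delta>. chunk (idim \<Gamma>) i ys \<in> idomset \<Gamma> M) \<and>
              (let cs = map (\<lambda>i. cls \<Gamma> M (chunk (idim \<Gamma>) i ys)) [0..<idim \<Delta>]
               in cs \<in> idomset \<Delta> ?A \<and> h a = cls \<Delta> ?A cs))"
    using di unfolding defines_iso_def cls_def by blast
  show ?thesis
  proof (rule that)
    show "struc_iso L M M2 (\<lambda>x. ?q (h x))" by (rule struc_iso_comp[OF h iB])
    fix a ys assume a: "a \<in> sdom M" and ys: "length ys = idim \<Gamma> * idim \<Delta>" "set ys \<subseteq> sdom M"
    let ?cs = "map (\<lambda>i. cls \<Gamma> M (chunk (idim \<Gamma>) i ys)) [0..<idim \<Delta>]"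
    let ?bs = "map (\<lambda>i. \<pi> (chunk (idim \<Gamma>) i ys)) [0..<idim \<Delta>]"
    show "sat M (lasg (a # ys)) \<theta> \<longleftrightarrow> (\<forall>i<idim \<Delta>. chunk (idim \<Gamma>) i ys \<in> idomset \<Gamma> M) \<and>
         ?bs \<in> idomset \<Delta> N \<and> \<pi>2 ?bs = ?q (h a)"
    proof (cases "\<forall>i<idim \<Delta>. chunk (idim \<Gamma>) i ys \<in> idomset \<Gamma> M")
      case True
      have m: "map ?p ?cs = ?bs" using True cls_codes(2)[OF c] by auto
      have s: "set ?cs \<subseteq> sdom ?A" using True unfolding interp_struc_def by (auto simp: quot_eq)
      have d: "?bs \<in> idomset \<Delta> N \<longleftrightarrow> ?cs \<in> idomset \<Delta> ?A"
        by (subst m[symmetric]) (rule idomset_iso[OF iA \<Delta> s])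
      have "h a = cls \<Delta> ?A ?cs \<longleftrightarrow> \<pi>2 ?bs = ?q (h a)" if cs: "?cs \<in> idomset \<Delta> ?A"
      proof -
        have "h a \<in> sdom (interp_struc \<Delta> ?A)" using h a unfolding struc_iso_def bij_betw_def by blast
        moreover have "cls \<Delta> ?A ?cs \<in> sdom (interp_struc \<Delta> ?A)"
          using cs unfolding interp_struc_def[of \<Delta>] by (simp add: quot_eq)
        ultimately have "h a = cls \<Delta> ?A ?cs \<longleftrightarrow> ?q (h a) = ?q (cls \<Delta> ?A ?cs)"
          using iB unfolding struc_iso_def bij_betw_def inj_on_def by metis
        moreover have "?q (cls \<Delta> ?A ?cs) = \<pi>2 ?bs" using cls_codes(2)[OF cA cs] unfolding m .
        ultimately show ?thesis by metis
      qed
      then show ?thesis using \<theta>[OF a ys] True d by (auto simp: Let_def)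
    next
      case False
      then show ?thesis using \<theta>[OF a ys] by blast
    qed
  qed
qed

section \<open>Bi-interpretations\<close>

lemma chunk_block:
  assumes "i < e" shows "chunk d i (block (d * e) w j) = block d w (j * e + i)"
proof -
  have "d * i + d \<le> d * e" using mult_le_mono2[of "Suc i" e d] assms by simp
  then have "take d (drop (i * d) [j * (d * e)..<j * (d * e) + d * e]) = [(j * e + i) * d..<(j * e + i) * d + d]"
    by (simp add: take_upt algebra_simps)
  then show ?thesis unfolding chunk_def block_def bix_def by (simp add: take_map drop_map)
qed

lemma BL_BL: "BL d (BL e A) = BL (d * e) A"
  unfolding BL_def by (simp add: div_mult2_eq)

lemma block_comp: "block e u j = map (\<lambda>i. u (j * e + i)) [0..<e]"
  unfolding block_def bix_def by (rule nth_equalityI) auto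

lemma BL_add: "0 < e \<Longrightarrow> BL e {j} = (\<lambda>i. j * e + i) ` {..<e}"
  unfolding set_bix[symmetric] bix_def lessThan_atLeast0 by (simp add: add.commute)

text \<open>The form used with assignments: a twofold code is one block of length
  \<open>idim \<Gamma> * idim \<Delta>\<close>, and its chunks are consecutive blocks of length
  \<open>idim \<Gamma>\<close>, so decoding them gives one block of elements of
  \<open>N\<close>.\<close>

lemma defines_iso_block:
  assumes di: "defines_iso L M \<Gamma> \<Delta> \<theta>" and M: "is_struc L M"
    and \<Gamma>: "wf_interp L L' \<Gamma>" and \<Delta>: "wf_interp L' L \<Delta>"
    and c: "codes L' \<Gamma> M N \<pi>" and N: "is_struc L' N"
    and c2: "codes L \<Delta> N M2 \<pi>2" and M2: "is_struc L M2"
  obtains \<beta> where "struc_iso L M M2 \<beta>"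
    "\<And>a w j. a \<in> sdom M \<Longrightarrow> w ` BL (idim \<Gamma> * idim \<Delta>) {j} \<subseteq> sdom M \<Longrightarrow>
       sat M (lasg (a # block (idim \<Gamma> * idim \<Delta>) w j)) \<theta> \<longleftrightarrow>
         (\<forall>i\<in>BL (idim \<Delta>) {j}. block (idim \<Gamma>) w i \<in> idomset \<Gamma> M) \<and>
         block (idim \<Delta>) (\<lambda>i. \<pi> (block (idim \<Gamma>) w i)) j \<in> idomset \<Delta> N \<and>
         \<pi>2 (block (idim \<Delta>) (\<lambda>i. \<pi> (block (idim \<Gamma>) w i)) j) = \<beta> a"
proof -
  have d: "0 < idim \<Gamma>" "0 < idim \<Delta>" using \<Gamma> \<Delta> unfolding wf_interp_def by auto
  obtain \<beta> where \<beta>: "struc_iso L M M2 \<beta>"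
    "\<And>a ys. a \<in> sdom M \<Longrightarrow> length ys = idim \<Gamma> * idim \<Delta> \<Longrightarrow> set ys \<subseteq> sdom M \<Longrightarrow>
       sat M (lasg (a # ys)) \<theta> \<longleftrightarrow> (\<forall>i<idim \<Delta>. chunk (idim \<Gamma>) i ys \<in> idomset \<Gamma> M) \<and>
         map (\<lambda>i. \<pi> (chunk (idim \<Gamma>) i ys)) [0..<idim \<Delta>] \<in> idomset \<Delta> N \<and>
         \<pi>2 (map (\<lambda>i. \<pi> (chunk (idim \<Gamma>) i ys)) [0..<idim \<Delta>]) = \<beta> a"
    using defines_iso_codes[OF di M \<Delta> c N c2 M2] by blast
  have m: "map (\<lambda>i. \<pi> (chunk (idim \<Gamma>) i (block (idim \<Gamma> * idim \<Delta>) w j))) [0..<idim \<Delta>] =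
      block (idim \<Delta>) (\<lambda>i. \<pi> (block (idim \<Gamma>) w i)) j" for w j
    unfolding block_comp[of "idim \<Delta>"] by (simp add: chunk_block)
  have q: "(\<forall>i<idim \<Delta>. chunk (idim \<Gamma>) i (block (idim \<Gamma> * idim \<Delta>) w j) \<in> X) \<longleftrightarrow>
     (\<forall>i\<in>BL (idim \<Delta>) {j}. block (idim \<Gamma>) w i \<in> X)" for w j X
    unfolding BL_add[OF d(2)] by (auto simp: chunk_block)
  show ?thesis
  proof (rule that[OF \<beta>(1)])
    fix a w j assume a: "a \<in> sdom M" and w: "w ` BL (idim \<Gamma> * idim \<Delta>) {j} \<subseteq> sdom M"
    have "set (block (idim \<Gamma> * idim \<Delta>) w j) \<subseteq> sdom M" using w d by (simp add: set_block)
    then show "sat M (lasg (a # block (idim \<Gamma> * idim \<Delta>) w j)) \<theta> \<longleftrightarrow>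
         (\<forall>i\<in>BL (idim \<Delta>) {j}. block (idim \<Gamma>) w i \<in> idomset \<Gamma> M) \<and>
         block (idim \<Delta>) (\<lambda>i. \<pi> (block (idim \<Gamma>) w i)) j \<in> idomset \<Delta> N \<and>
         \<pi>2 (block (idim \<Delta>) (\<lambda>i. \<pi> (block (idim \<Gamma>) w i)) j) = \<beta> a"
      using \<beta>(2)[OF a length_block] unfolding m q by blast
  qed
qed

text \<open>The defining formula may use fewer variables than \<open>F\<close>. The domain condition
  still covers all of \<open>F\<close>, because \<open>P\<close> agrees with its formula only where
  all of \<open>F\<close> takes values in the domain.\<close>

lemma (in coded) dfn_pull:
  assumes "dfn L' K N F P" "finite F"
  shows "dfn L K M (BL d F) (\<lambda>k w. (\<forall>i\<in>F. block d w i \<in> E k) \<and> P k (val k w))"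
proof -
  obtain \<phi> where \<phi>: "wf_fm L' \<phi>" "fv \<phi> \<subseteq> F"
    "\<And>k v. k \<in> K \<Longrightarrow> v ` F \<subseteq> sdom (N k) \<Longrightarrow> P k v \<longleftrightarrow> sat (N k) v \<phi>"
    using assms(1) unfolding dfn_def by blast
  have "dfn L K M (BL d F) (\<lambda>k w. (\<forall>i\<in>F. block d w i \<in> E k) \<and>
      ((\<forall>i\<in>fv \<phi>. block d w i \<in> E k) \<and> sat (N k) (val k w) \<phi>))"
    by (rule dfn_Conj[OF dfn_idoms dfn_mono[OF fm_pull]])
      (use assms(2) \<phi> BL_mono in auto)
  then show ?thesis
  proof (rule dfn_cong, intro conj_cong refl)
    fix k w assume k: "k \<in> K" and dom: "\<forall>i\<in>F. block d w i \<in> E k"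
    have "val k w ` F \<subseteq> sdom (N k)" using dom val_in[OF k] by blast
    then show "P k (val k w) \<longleftrightarrow> (\<forall>i\<in>fv \<phi>. block d w i \<in> E k) \<and> sat (N k) (val k w) \<phi>"
      using \<phi> k dom by blast
  qed
qed

section \<open>Mutual codings and the twofold decoding\<close>

locale pairs = A: coded L L' I K M N \<pi> + B: coded L' L J K N M \<pi>'
  for L L' I J K M N \<pi> \<pi>'
begin

text \<open>The graph of the partial decoding map from tuples of \<open>M\<close> by way of
  \<open>N\<close> back to \<open>M\<close>, with the positions of argument and value as
  parameters.\<close>

definition through :: "'a \<Rightarrow> (nat \<Rightarrow> nat) \<Rightarrow> nat \<Rightarrow> nat list \<Rightarrow> bool" where
  "through k w n g \<longleftrightarrow> (\<forall>i\<in>set g. block A.d w i \<in> A.E k) \<and> map (A.val k w) g \<in> B.E k \<and>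
     \<pi>' k (map (A.val k w) g) = w n"

text \<open>A formula for the standard placement of the variables serves every placement:
  \<open>f\<close> sends standard block \<open>l\<close> to block \<open>g ! l\<close> and the last
  variable to \<open>n\<close>.\<close>

lemma through_gen:
  assumes W: "dfn L K M {..A.d * B.d} (\<lambda>k w. through k w (A.d * B.d) [0..<B.d])"
    and g: "length g = B.d"
  shows "dfn L K M (insert n (BL A.d (set g))) (\<lambda>k w. through k w n g)"
proof -
  define f where "f i = (if i < A.d * B.d then (g ! (i div A.d)) * A.d + i mod A.d else n)" for i
  have b: "block A.d (\<lambda>i. w (f i)) l = block A.d w (g ! l)" if "l < B.d" for l and w :: "nat \<Rightarrow> nat"
  proof -
    have "l * A.d + i < A.d * B.d" if "i < A.d" for i
      using mult_le_mono1[of "Suc l" B.d A.d] \<open>l < B.d\<close> that by (simp add: mult.commute)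
    then show ?thesis unfolding block_comp f_def using A.d_pos by auto
  qed
  have m: "map (\<lambda>l. h (block A.d (\<lambda>i. w (f i)) l)) [0..<B.d] = map (\<lambda>i. h (block A.d w i)) g"
    for w :: "nat \<Rightarrow> nat" and h :: "nat list \<Rightarrow> nat"
    by (rule nth_equalityI) (use g b in auto)
  have "dfn L K M (insert n (BL A.d (set g))) (\<lambda>k w. through k (\<lambda>i. w (f i)) (A.d * B.d) [0..<B.d])"
  proof (rule dfn_ren[OF W])
    show "f ` {..A.d * B.d} \<subseteq> insert n (BL A.d (set g))"
      using g A.d_pos by (auto simp: f_def BL_def less_mult_imp_div_less mult.commute)
  qed
  moreover have "through k (\<lambda>i. w (f i)) (A.d * B.d) [0..<B.d] \<longleftrightarrow> through k w n g" for k w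
  proof -
    have "(\<forall>i\<in>{0..<B.d}. block A.d (\<lambda>i. w (f i)) i \<in> A.E k) \<longleftrightarrow> (\<forall>i\<in>set g. block A.d w i \<in> A.E k)"
    proof -
      have "set g = (!) g ` {0..<B.d}" using g by (auto simp: set_conv_nth)
      then show ?thesis using b by auto
    qed
    then show ?thesis unfolding through_def m by (simp add: f_def)
  qed
  ultimately show ?thesis by simp
qed

end

text \<open>Definability of both composite decodings is all that is kept of the formulas of a
  bi-interpretation. In this form the two sides are interchangeable, see
  \<open>bicode_sym\<close>.\<close>

locale bicode = pairs L L' I J K M N \<pi> \<pi>' + S: pairs L' L J I K N M \<pi>' \<pi>
  for L L' I J K M N \<pi> \<pi>' +
  assumes W: "dfn L K M {..A.d * B.d} (\<lambda>k w. through k w (A.d * B.d) [0..<B.d])"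
    and W': "dfn L' K N {..B.d * A.d} (\<lambda>k w. S.through k w (B.d * A.d) [0..<A.d])"

lemma bicode_sym: "bicode L L' I J K M N \<pi> \<pi>' \<Longrightarrow> bicode L' L J I K N M \<pi>' \<pi>"
  unfolding bicode_def bicode_axioms_def by blast

context pairs begin

lemma through_cong:
  assumes "\<And>i. i \<in> insert n (BL A.d (set g)) \<Longrightarrow> w i = w' i"
  shows "through k w n g \<longleftrightarrow> through k w' n g"
proof -
  have "block A.d w i = block A.d w' i" if "i \<in> set g" for i
    by (rule block_cong[OF A.d_pos]) (use assms that in \<open>auto simp: BL_def\<close>)
  then show ?thesis unfolding through_def using assms by (simp cong: map_cong)
qed

end

text \<open>A bi-interpretation does not require the two defining isomorphisms to be compatible, so
  the composite coding of a model of the second theory in itself agrees with the one given by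
  the second formula only up to an automorphism. Being definable, it is nevertheless definable
  on the second side: pull it back to the first structure, translate, and use that definable
  sets are invariant under the automorphism.\<close>

lemma bicodeI:
  assumes p: "pairs L L' I J K M N \<pi> \<pi>'"
    and \<theta>: "wf_fm L \<theta>" "fv \<theta> \<subseteq> {..<1 + idim I * idim J}"
    and \<theta>': "wf_fm L' \<theta>'" "fv \<theta>' \<subseteq> {..<1 + idim J * idim I}"
    and k\<theta>: "\<And>k a w. k \<in> K \<Longrightarrow> a \<in> sdom (M k) \<Longrightarrow> w ` {..<idim I * idim J} \<subseteq> sdom (M k) \<Longrightarrow>
       sat (M k) (lasg (a # block (idim I * idim J) w 0)) \<theta> \<longleftrightarrow>
       (\<forall>i<idim J. block (idim I) w i \<in> idomset I (M k)) \<and>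
       block (idim J) (\<lambda>i. \<pi> k (block (idim I) w i)) 0 \<in> idomset J (N k) \<and>
       \<pi>' k (block (idim J) (\<lambda>i. \<pi> k (block (idim I) w i)) 0) = a"
    and k\<theta>': "\<And>k. k \<in> K \<Longrightarrow> defines_iso L' (N k) J I \<theta>'"
  shows "bicode L L' I J K M N \<pi> \<pi>'"
proof -
  interpret pairs L L' I J K M N \<pi> \<pi>' by fact
  interpret S: pairs L' L J I K N M \<pi>' \<pi> by unfold_locales
  \<comment> \<open>The length of a twofold code, the same on both sides.\<close>
  define D where "D = A.d * B.d"
  have D': "B.d * A.d = D" by (simp add: D_def mult.commute)
  have bl0: "block q u 0 = map u [0..<q]" for q and u :: "nat \<Rightarrow> nat" by (simp add: block_def bix_def)
  have W: "dfn L K M {..A.d * B.d} (\<lambda>k w. through k w (A.d * B.d) [0..<B.d])"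
  proof -
    have "dfn L K M {..D} (\<lambda>k w. sat (M k) (lasg (map w (D # [0..<D]))) \<theta>)"
      by (rule dfn_lasg) (use \<theta> D_def in auto)
    then have "dfn L K M {..D} (\<lambda>k w. through k w D [0..<B.d])"
    proof (rule dfn_cong)
      fix k and w :: "nat \<Rightarrow> nat" assume k: "k \<in> K" and w: "w ` {..D} \<subseteq> sdom (M k)"
      have "sat (M k) (lasg (w D # block (idim I * idim J) w 0)) \<theta> \<longleftrightarrow> through k w D [0..<B.d]"
        by (subst k\<theta>[OF k]) (use w in \<open>auto simp: through_def bl0[of B.d] D_def\<close>)
      then show "through k w D [0..<B.d] \<longleftrightarrow> sat (M k) (lasg (map w (D # [0..<D]))) \<theta>"
        by (simp add: bl0 D_def)
    qed
    then show ?thesis by (simp add: D_def)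
  qed
  let ?W' = "\<lambda>k y. S.through k y D [0..<A.d]"
  \<comment> \<open>The relation to be defined, pulled back to \<open>M\<close>: its arguments are
    codes of \<open>D + 1\<close> elements of \<open>N\<close>.\<close>
  define \<sigma> where "\<sigma> k u \<longleftrightarrow> (\<forall>j\<in>{..D}. block A.d u j \<in> A.E k) \<and> ?W' k (A.val k u)" for k u
  have \<sigma>: "dfn L K M (BL A.d {..D}) \<sigma>"
  proof -
    \<comment> \<open>The fresh block \<open>b\<close> names the tuple of \<open>M\<close> to which
      the coded elements of \<open>N\<close> decode; each coordinate is pinned down by the formula
      for the composite on the first side. Then \<open>ieq I\<close> says that this tuple codes the
      same element of \<open>N\<close> as block \<open>D\<close>.\<close>
    define b where "b = Suc D"
    define R where "R k u \<longleftrightarrow> (\<forall>j\<in>insert b {..D}. block A.d u j \<in> A.E k) \<and>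
      (\<forall>i\<in>{..<A.d}. through k u (b * A.d + i) (bix B.d i)) \<and>
      sat (M k) (lasg (map u (bix A.d b @ bix A.d D))) (ieq I)" for k u
    have sub: "insert (b * A.d + i) (BL A.d (set (bix B.d i))) \<subseteq> BL A.d (insert b {..D})" if "i < A.d" for i
    proof -
      have "set (bix B.d i) \<subseteq> {..D}"
        using mult_le_mono1[of "Suc i" A.d B.d] that unfolding bix_def D_def by (auto simp: mult.commute)
      then show ?thesis using that by (auto simp: BL_def)
    qed
    have "dfn L K M (BL A.d (insert b {..D})) R"
      unfolding R_def
    proof (rule dfn_Conj[OF A.dfn_idoms dfn_Conj[OF dfn_ball]])
      show "dfn L K M (BL A.d (insert b {..D})) (\<lambda>k u. through k u (b * A.d + i) (bix B.d i))"
        if "i \<in> {..<A.d}" for i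
        by (rule dfn_mono[OF through_gen[OF W]]) (use that sub in \<open>auto simp: bix_def\<close>)
      show "dfn L K M (BL A.d (insert b {..D}))
         (\<lambda>k u. sat (M k) (lasg (map u (bix A.d b @ bix A.d D))) (ieq I))"
      proof (rule dfn_lasg)
        show "set (bix A.d b @ bix A.d D) \<subseteq> BL A.d (insert b {..D})"
          by (simp add: set_bix A.d_pos BL_mono)
        show "fv (ieq I) \<subseteq> {..<length (bix A.d b @ bix A.d D)}"
          using A.wfI by (simp add: wf_interp_def bix_def mult_2)
      qed (use A.wfI in \<open>simp add: wf_interp_def\<close>)
    qed auto
    then have "dfn L K M (BL A.d (insert b {..D}) - BL A.d {b})
      (\<lambda>k w. \<exists>u. u ` BL A.d {b} \<subseteq> sdom (M k) \<and> R k (override_on w u (BL A.d {b})))"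
      by (rule dfn_exs) (simp add: finite_BL A.d_pos)
    moreover have "BL A.d (insert b {..D}) - BL A.d {b} = BL A.d {..D}"
      unfolding BL_def b_def by auto
    ultimately have "dfn L K M (BL A.d {..D})
      (\<lambda>k w. \<exists>u. u ` BL A.d {b} \<subseteq> sdom (M k) \<and> R k (override_on w u (BL A.d {b})))" by simp
    then show ?thesis
    proof (rule dfn_cong)
      fix k and w :: "nat \<Rightarrow> nat" assume k: "k \<in> K"
      let ?w = "\<lambda>u. override_on w u (BL A.d {b})"
      have ov: "block A.d (?w u) j = (if j = b then block A.d u b else block A.d w j)" for u :: "nat \<Rightarrow> nat" and j
        using block_override_in[OF A.d_pos, of j "{b}" w u] block_override_out[OF A.d_pos, of j "{b}" w u]
        by auto
      have nb: "j \<noteq> b" if "j \<le> D" for j using that unfolding b_def by simp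
      have bi: "set (bix B.d i) \<subseteq> {..D}" if "i < A.d" for i
        using mult_le_mono1[of "Suc i" A.d B.d] that unfolding bix_def D_def by (auto simp: mult.commute)
      have th: "through k (?w u) (b * A.d + i) (bix B.d i) \<longleftrightarrow>
          B.val k (A.val k w) i = u (b * A.d + i) \<and> block B.d (A.val k w) i \<in> B.E k"
        if i: "i < A.d" and dom: "\<forall>j\<in>{..D}. block A.d w j \<in> A.E k" for i u
      proof -
        have "j \<noteq> b \<and> block A.d w j \<in> A.E k" if "j \<in> set (bix B.d i)" for j
          using bi[OF i] that dom unfolding b_def by auto
        then have "map (A.val k (?w u)) (bix B.d i) = block B.d (A.val k w) i"
          "\<forall>j\<in>set (bix B.d i). block A.d (?w u) j \<in> A.E k"
          unfolding block_def[of B.d] by (auto simp: ov)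
        moreover have "?w u (b * A.d + i) = u (b * A.d + i)"
          using i by (simp add: override_on_def BL_def)
        ultimately show ?thesis unfolding through_def by auto
      qed
      have R: "R k (?w u) \<longleftrightarrow> (\<forall>j\<in>{..D}. block A.d w j \<in> A.E k) \<and> block A.d u b \<in> A.E k \<and>
         (\<forall>i<A.d. B.val k (A.val k w) i = u (b * A.d + i) \<and> block B.d (A.val k w) i \<in> B.E k) \<and>
         \<pi> k (block A.d u b) = A.val k w D" for u
      proof (cases "(\<forall>j\<in>{..D}. block A.d w j \<in> A.E k) \<and> block A.d u b \<in> A.E k")
        case True
        have "map (?w u) (bix A.d b @ bix A.d D) = block A.d (?w u) b @ block A.d (?w u) D"
          unfolding block_def by simp
        also have "\<dots> = block A.d u b @ block A.d w D" using nb by (simp add: ov)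
        finally have "sat (M k) (lasg (map (?w u) (bix A.d b @ bix A.d D))) (ieq I) \<longleftrightarrow>
          \<pi> k (block A.d u b) = A.val k w D"
          using A.cod[OF k] True unfolding codes_def by (metis atMost_iff order_refl)
        then show ?thesis unfolding R_def using True th ov nb by auto
      next
        case False
        then show ?thesis unfolding R_def using ov nb by auto
      qed
      have E: "block A.d (B.val k (A.val k w)) 0 = block A.d u b"
        if "\<forall>i<A.d. B.val k (A.val k w) i = u (b * A.d + i)" for u
        unfolding block_comp[of A.d "\<lambda>i. B.val k (A.val k w) i"] block_comp[of A.d u] using that by simp
      show "\<sigma> k w \<longleftrightarrow> (\<exists>u. u ` BL A.d {b} \<subseteq> sdom (M k) \<and> R k (?w u))"
      proof
        assume s: "\<sigma> k w"
        then have s1: "\<forall>j\<in>{..D}. block A.d w j \<in> A.E k"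
          "\<forall>i<A.d. block B.d (A.val k w) i \<in> B.E k"
          "block A.d (B.val k (A.val k w)) 0 \<in> A.E k"
          "A.val k (B.val k (A.val k w)) 0 = A.val k w D"
          unfolding \<sigma>_def S.through_def bl0 by auto
        \<comment> \<open>The decoded tuple, shifted so that it occupies block
          \<open>b\<close>.\<close>
        define u where "u i = B.val k (A.val k w) (i - b * A.d)" for i
        have e: "\<forall>i<A.d. B.val k (A.val k w) i = u (b * A.d + i)" unfolding u_def by simp
        then have "block A.d u b \<in> A.E k" "\<pi> k (block A.d u b) = A.val k w D"
          using s1 E[OF e] by auto
        moreover from this have "u ` BL A.d {b} \<subseteq> sdom (M k)"
          using set_block[OF A.d_pos, of u b] unfolding idomset_def by simp
        ultimately show "\<exists>u. u ` BL A.d {b} \<subseteq> sdom (M k) \<and> R k (?w u)"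
          unfolding R using s1 e by blast
      next
        assume "\<exists>u. u ` BL A.d {b} \<subseteq> sdom (M k) \<and> R k (?w u)"
        then obtain u where u: "\<forall>j\<in>{..D}. block A.d w j \<in> A.E k" "block A.d u b \<in> A.E k"
         "\<forall>i<A.d. B.val k (A.val k w) i = u (b * A.d + i)" "\<forall>i<A.d. block B.d (A.val k w) i \<in> B.E k"
         "\<pi> k (block A.d u b) = A.val k w D" unfolding R by blast
        then show "\<sigma> k w" unfolding \<sigma>_def S.through_def bl0[symmetric] E[OF u(3)] by auto
      qed
    qed
  qed
  have bsub: "BL B.d (BL A.d {..D}) = BL D {..D}" by (simp add: BL_BL D')
  have dD: "0 < D" using A.d_pos B.d_pos by (simp add: D_def)
  \<comment> \<open>Variables below \<open>q\<close> hold \<open>D + 1\<close> twofold codes of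
    length \<open>D\<close>; the actual argument \<open>j\<close> sits at
    \<open>q + j\<close>.\<close>
  define q where "q = D * Suc D"
  define Z where "Z = BL D {..D}"
  have Zq: "n < q" if "n \<in> Z" for n
    using that div_less_iff_less_mult[OF dD, of n "Suc D"] unfolding Z_def BL_def q_def
    by (auto simp: mult.commute)
  \<comment> \<open>By \<open>\<theta>'\<close>, block \<open>j\<close> is a twofold code of the
    image of argument \<open>j\<close> under an automorphism; decoded once, these blocks are
    arguments for \<open>\<sigma>\<close>.\<close>
  define Q where "Q k z \<longleftrightarrow> (\<forall>j\<in>{..D}. sat (N k) (lasg (map z ((q + j) # bix D j))) \<theta>') \<and>
    (\<forall>i\<in>BL A.d {..D}. block B.d z i \<in> B.E k) \<and> \<sigma> k (B.val k z)" for k z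
  have "dfn L' K N (Z \<union> {q..q + D}) Q"
    unfolding Q_def
  proof (rule dfn_Conj[OF dfn_ball])
    show "dfn L' K N (Z \<union> {q..q + D}) (\<lambda>k z. sat (N k) (lasg (map z ((q + j) # bix D j))) \<theta>')"
      if "j \<in> {..D}" for j
    proof (rule dfn_lasg)
      show "set ((q + j) # bix D j) \<subseteq> Z \<union> {q..q + D}"
        using that BL_mono[of "{j}" "{..D}" D] unfolding Z_def by (simp add: set_bix[OF dD] le_supI1)
    qed (use \<theta>' D' in \<open>auto simp: bix_def\<close>)
    show "dfn L' K N (Z \<union> {q..q + D})
        (\<lambda>k z. (\<forall>i\<in>BL A.d {..D}. block B.d z i \<in> B.E k) \<and> \<sigma> k (B.val k z))"
      by (rule dfn_mono[OF B.dfn_pull[OF \<sigma>]]) (auto simp: bsub Z_def finite_BL A.d_pos)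
  qed simp
  then have "dfn L' K N ((Z \<union> {q..q + D}) - Z)
      (\<lambda>k w. \<exists>u. u ` Z \<subseteq> sdom (N k) \<and> Q k (override_on w u Z))"
    by (rule dfn_exs) (simp add: Z_def finite_BL dD)
  moreover have "(Z \<union> {q..q + D}) - Z = {q..q + D}" using Zq by fastforce
  ultimately have ex: "dfn L' K N {q..q + D} (\<lambda>k w. \<exists>u. u ` Z \<subseteq> sdom (N k) \<and> Q k (override_on w u Z))"
    by simp
  have "(\<lambda>i. i - q) ` {q..q + D} \<subseteq> {..D}" by auto
  define S' where "S' k x \<longleftrightarrow> (\<exists>u. u ` Z \<subseteq> sdom (N k) \<and> Q k (override_on (\<lambda>i. x (i - q)) u Z))" for k x
  from dfn_ren[OF ex \<open>(\<lambda>i. i - q) ` {q..q + D} \<subseteq> {..D}\<close>] have "dfn L' K N {..D} (\<lambda>k x. \<exists>u. u ` Z \<subseteq> sdom (N k) \<and> Q k (override_on (\<lambda>i. x (i - q)) u Z))" .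
  then have "dfn L' K N {..D} S'" unfolding S'_def .
  then obtain \<tau> where \<tau>: "wf_fm L' \<tau>" "fv \<tau> \<subseteq> {..D}"
    "\<And>k x. k \<in> K \<Longrightarrow> x ` {..D} \<subseteq> sdom (N k) \<Longrightarrow>
      S' k x \<longleftrightarrow> sat (N k) x \<tau>"
    unfolding dfn_def by blast
  have "?W' k x \<longleftrightarrow> sat (N k) x \<tau>" if k: "k \<in> K" and x: "x ` {..D} \<subseteq> sdom (N k)" for k x
  proof -
    \<comment> \<open>With the two given codings, the structure decoded from \<open>N k\<close> by
      way of \<open>M k\<close> is \<open>N k\<close> again, so \<open>\<beta>\<close> is an
      automorphism.\<close>
    obtain \<beta> where \<beta>: "struc_iso L' (N k) (N k) \<beta>"
      "\<And>a w j. a \<in> sdom (N k) \<Longrightarrow> w ` BL D {j} \<subseteq> sdom (N k) \<Longrightarrow>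
       sat (N k) (lasg (a # block D w j)) \<theta>' \<longleftrightarrow>
         (\<forall>i\<in>BL A.d {j}. block B.d w i \<in> B.E k) \<and>
         block A.d (B.val k w) j \<in> A.E k \<and> A.val k (B.val k w) j = \<beta> a"
      using defines_iso_block[OF k\<theta>'[OF k] A.strucN[OF k] B.wfI A.wfI B.cod[OF k] B.strucN[OF k]
          A.cod[OF k] A.strucN[OF k], unfolded D'] by blast
    have bij: "bij_betw \<beta> (sdom (N k)) (sdom (N k))" using \<beta>(1) unfolding struc_iso_def by blast
    have Wcong: "?W' k y \<longleftrightarrow> ?W' k y'" if "\<And>j. j \<le> D \<Longrightarrow> y j = y' j" for y y'
    proof (rule S.through_cong)
      fix i assume "i \<in> insert D (BL B.d (set [0..<A.d]))"
      then have "i \<le> D" by (auto simp: BL_def div_less_iff_less_mult[OF B.d_pos] D_def)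
      then show "y i = y' i" by (rule that)
    qed
    \<comment> \<open>At first \<open>\<tau>\<close> describes the wanted relation only with
      \<open>\<beta>\<close> applied to all arguments.\<close>
    have main: "sat (N k) y \<tau> \<longleftrightarrow> ?W' k (\<lambda>i. \<beta> (y i))" if y: "y ` {..D} \<subseteq> sdom (N k)" for y
    proof -
      have key: "Q k z \<longleftrightarrow> (\<forall>i\<in>BL A.d {..D}. block B.d z i \<in> B.E k) \<and>
          (\<forall>j\<in>{..D}. block A.d (B.val k z) j \<in> A.E k \<and> A.val k (B.val k z) j = \<beta> (y j)) \<and>
          ?W' k (\<lambda>i. \<beta> (y i))"
        if z: "z ` Z \<subseteq> sdom (N k)" "\<And>j. j \<le> D \<Longrightarrow> z (q + j) = y j" for z
      proof -
        have t: "sat (N k) (lasg (map z ((q + j) # bix D j))) \<theta>' \<longleftrightarrow>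
         (\<forall>i\<in>BL A.d {j}. block B.d z i \<in> B.E k) \<and>
         block A.d (B.val k z) j \<in> A.E k \<and> A.val k (B.val k z) j = \<beta> (y j)" if j: "j \<in> {..D}" for j
        proof -
          have "z ` BL D {j} \<subseteq> sdom (N k)" using z(1) j unfolding Z_def BL_def by auto
          moreover have "y j \<in> sdom (N k)" using y j by auto
          ultimately show ?thesis using \<beta>(2)[of "y j" z j] z(2)[of j] j by (simp add: block_def[of D])
        qed
        have u: "(\<forall>i\<in>BL A.d {..D}. P i) \<longleftrightarrow> (\<forall>j\<in>{..D}. \<forall>i\<in>BL A.d {j}. P i)" for P
          unfolding BL_def by auto
        have w: "?W' k (A.val k (B.val k z)) \<longleftrightarrow> ?W' k (\<lambda>i. \<beta> (y i))"
          if "\<forall>j\<in>{..D}. A.val k (B.val k z) j = \<beta> (y j)"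
          by (rule Wcong) (use that in simp)
        show ?thesis unfolding Q_def \<sigma>_def u using t w by auto
      qed
      have zz: "override_on (\<lambda>i. y (i - q)) u Z ` Z \<subseteq> sdom (N k)"
        "override_on (\<lambda>i. y (i - q)) u Z (q + j) = y j" if "u ` Z \<subseteq> sdom (N k)" for u j
        using that Zq[of "q + j"] by (auto simp: override_on_def)
      \<comment> \<open>Twofold codes are built in two layers: codes \<open>c\<close> in
        \<open>M\<close> of the images under \<open>\<beta>\<close>, then codes \<open>r\<close> in
        \<open>N\<close> of the entries of these codes. Irrelevant blocks are padded with
        zeros.\<close>
      have ex: "\<exists>u. u ` Z \<subseteq> sdom (N k) \<and> (\<forall>i\<in>BL A.d {..D}. block B.d u i \<in> B.E k) \<and>
          (\<forall>j\<in>{..D}. block A.d (B.val k u) j \<in> A.E k \<and> A.val k (B.val k u) j = \<beta> (y j))"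
      proof -
        have "\<exists>c\<in>A.E k. \<pi> k c = \<beta> (y j)" if "j \<in> {..D}" for j
        proof -
          have "\<beta> (y j) \<in> sdom (N k)" using bij y that unfolding bij_betw_def by auto
          then show ?thesis unfolding A.sdom_N[OF k] by force
        qed
        then obtain c where c: "\<And>j. j \<in> {..D} \<Longrightarrow> c j \<in> A.E k \<and> \<pi> k (c j) = \<beta> (y j)" by metis
        have "\<exists>v. \<forall>j. block A.d v j = (if j \<in> {..D} then c j else replicate A.d 0)"
          by (rule block_surj) (use c in \<open>auto simp: idomset_def\<close>)
        then obtain v where v0: "\<forall>j. block A.d v j = (if j \<in> {..D} then c j else replicate A.d 0)" by blast
        have v: "block A.d v j = c j" if "j \<in> {..D}" for j using v0 that by simp
        have "\<exists>r\<in>B.E k. \<pi>' k r = v n" if "n \<in> BL A.d {..D}" for n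
        proof -
          have j: "n div A.d \<in> {..D}" "n \<in> BL A.d {n div A.d}" using that unfolding BL_def by auto
          have "v n \<in> set (block A.d v (n div A.d))" using j(2) by (simp add: set_block A.d_pos)
          then have "v n \<in> sdom (M k)" using v[OF j(1)] c[OF j(1)] unfolding idomset_def by auto
          then show ?thesis unfolding B.sdom_N[OF k] by force
        qed
        then obtain r where r: "\<And>n. n \<in> BL A.d {..D} \<Longrightarrow> r n \<in> B.E k \<and> \<pi>' k (r n) = v n" by metis
        have "\<exists>u. \<forall>n. block B.d u n = (if n \<in> BL A.d {..D} then r n else replicate B.d 0)"
          by (rule block_surj) (use r in \<open>auto simp: idomset_def\<close>)
        then obtain u where u0: "\<forall>n. block B.d u n = (if n \<in> BL A.d {..D} then r n else replicate B.d 0)"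
          by blast
        have u: "block B.d u n = r n" if "n \<in> BL A.d {..D}" for n using u0 that by simp
        have "block A.d (B.val k u) j = c j" if j: "j \<in> {..D}" for j
        proof -
          have "block A.d (B.val k u) j = block A.d v j"
            by (rule block_cong[OF A.d_pos]) (use u r j in \<open>auto simp: BL_def\<close>)
          then show ?thesis using v[OF j] by simp
        qed
        moreover have "u ` Z \<subseteq> sdom (N k)"
        proof -
          have "u ` BL B.d {n} \<subseteq> sdom (N k)" if "n \<in> BL A.d {..D}" for n
            using u[OF that] r[OF that] set_block[OF B.d_pos, of u n] unfolding idomset_def by auto
          then show ?thesis unfolding Z_def bsub[symmetric] by (subst BL_UN) blast
        qed
        ultimately show ?thesis using u r c by (intro exI[of _ u]) simp
      qed
      have "sat (N k) y \<tau> \<longleftrightarrow> (\<exists>u. u ` Z \<subseteq> sdom (N k) \<and> Q k (override_on (\<lambda>i. y (i - q)) u Z))"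
        using \<tau>(3)[OF k y] unfolding S'_def by (rule sym)
      also have "\<dots> \<longleftrightarrow> ?W' k (\<lambda>i. \<beta> (y i))"
      proof
        assume "\<exists>u. u ` Z \<subseteq> sdom (N k) \<and> Q k (override_on (\<lambda>i. y (i - q)) u Z)"
        then show "?W' k (\<lambda>i. \<beta> (y i))" using key zz by blast
      next
        assume w: "?W' k (\<lambda>i. \<beta> (y i))"
        obtain u where u: "u ` Z \<subseteq> sdom (N k)" "\<forall>i\<in>BL A.d {..D}. block B.d u i \<in> B.E k"
          "\<forall>j\<in>{..D}. block A.d (B.val k u) j \<in> A.E k \<and> A.val k (B.val k u) j = \<beta> (y j)"
          using ex by blast
        let ?z = "override_on (\<lambda>i. y (i - q)) u Z"
        have b1: "block B.d ?z i = block B.d u i" if "i \<in> BL A.d {..D}" for i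
          unfolding Z_def bsub[symmetric] by (rule block_override_in[OF B.d_pos that])
        have b2: "block A.d (B.val k ?z) j = block A.d (B.val k u) j" if "j \<in> {..D}" for j
          by (rule block_cong[OF A.d_pos]) (use that b1 in \<open>auto simp: BL_def\<close>)
        have "Q k ?z" unfolding key[OF zz[OF u(1)]] using u b1 b2 w by simp
        then show "\<exists>u. u ` Z \<subseteq> sdom (N k) \<and> Q k (override_on (\<lambda>i. y (i - q)) u Z)" using u(1) by blast
      qed
      finally show ?thesis .
    qed
    \<comment> \<open>Writing \<open>x\<close> as the image of \<open>y\<close> lets the invariance
      of \<open>\<tau>\<close> under \<open>\<beta>\<close> cancel the twist.\<close>
    define y where "y i = inv_into (sdom (N k)) \<beta> (x i)" for i
    have y: "y ` {..D} \<subseteq> sdom (N k)" "\<And>i. i \<le> D \<Longrightarrow> \<beta> (y i) = x i"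
      using x bij unfolding y_def bij_betw_def by (auto simp: image_subset_iff f_inv_into_f inv_into_into)
    have "?W' k x \<longleftrightarrow> ?W' k (\<lambda>i. \<beta> (y i))" by (rule Wcong) (use y in simp)
    also have "\<dots> \<longleftrightarrow> sat (N k) y \<tau>" using main[OF y(1)] by simp
    also have "\<dots> \<longleftrightarrow> sat (N k) (\<lambda>i. \<beta> (y i)) \<tau>"
      using iso_sat[OF \<beta>(1) A.strucN[OF k] \<tau>(1), of y] y(1) \<tau>(2) by blast
    also have "\<dots> \<longleftrightarrow> sat (N k) x \<tau>" by (rule sat_cong) (use y(2) \<tau>(2) in auto)
    finally show ?thesis .
  qed
  then have "dfn L' K N {..D} ?W'" unfolding dfn_def using \<tau>(1,2) by blast
  then have "dfn L' K N {..B.d * A.d} (\<lambda>k w. S.through k w (B.d * A.d) [0..<A.d])" by (simp add: D')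
  then show ?thesis using W by unfold_locales
qed

section \<open>Rich sequences and coordinate maps\<close>

lemma dfn_dep:
  assumes "dfn L K S A P" "k \<in> K" "v ` A \<subseteq> sdom (S k)" "\<And>i. i \<in> A \<Longrightarrow> v i = w i"
  shows "P k v \<longleftrightarrow> P k w"
proof -
  obtain \<phi> where \<phi>: "fv \<phi> \<subseteq> A"
    "\<And>v. v ` A \<subseteq> sdom (S k) \<Longrightarrow> P k v \<longleftrightarrow> sat (S k) v \<phi>"
    using assms(1,2) unfolding dfn_def by blast
  have "w ` A \<subseteq> sdom (S k)" using assms(3,4) by (auto simp: image_subset_iff)
  moreover have "sat (S k) v \<phi> \<longleftrightarrow> sat (S k) w \<phi>"
    by (rule sat_cong) (use assms(4) \<phi>(1) in auto)
  ultimately show ?thesis using \<phi>(2) assms(3) by simp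
qed

text \<open>Satisfaction of the finite part \<open>D_{\<Phi>,n}\<close>, with membership of the
  first \<open>n\<close> entries in the domain built in. For rich \<open>\<Phi>\<close> the later
  entries have no influence.\<close>

definition Dn :: "'a struc \<Rightarrow> (nat \<Rightarrow> fm) \<Rightarrow> nat \<Rightarrow> (nat \<Rightarrow> 'a) \<Rightarrow> bool" where
  "Dn M \<Phi> n a \<longleftrightarrow> a ` {..<n} \<subseteq> sdom M \<and>
     (\<forall>k<n. \<forall>d\<in>sdom M. sat M (yx_asg d a) (\<Phi> k) \<longrightarrow> sat M (yx_asg (a k) a) (\<Phi> k))"

lemma Dn_0: "Dn M \<Phi> 0 a"
  unfolding Dn_def by simp

lemma Dn_mono: "Dn M \<Phi> n a \<Longrightarrow> m \<le> n \<Longrightarrow> Dn M \<Phi> m a"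
  unfolding Dn_def by auto

lemma realises_D_Dn: "range a \<subseteq> sdom M \<and> realises_D M \<Phi> a \<longleftrightarrow> (\<forall>n. Dn M \<Phi> n a)"
  unfolding realises_D_def Dn_def by auto

context
  fixes L \<Phi> assumes rich: "rich L \<Phi>"
begin

lemma rich_sat_cong:
  assumes "\<And>i. i < k \<Longrightarrow> a i = b i" "c = d"
  shows "sat M (yx_asg c a) (\<Phi> k) \<longleftrightarrow> sat M (yx_asg d b) (\<Phi> k)"
proof (rule sat_cong)
  fix i assume "i \<in> fv (\<Phi> k)"
  then have "i \<le> k" using rich unfolding rich_def by auto
  then show "yx_asg c a i = yx_asg d b i" using assms unfolding yx_asg_def by auto
qed

lemma Dn_cong:
  assumes "\<And>i. i < n \<Longrightarrow> a i = b i"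
  shows "Dn M \<Phi> n a \<longleftrightarrow> Dn M \<Phi> n b"
proof -
  have "sat M (yx_asg d a) (\<Phi> k) \<longleftrightarrow> sat M (yx_asg d b) (\<Phi> k)"
    "sat M (yx_asg (a k) a) (\<Phi> k) \<longleftrightarrow> sat M (yx_asg (b k) b) (\<Phi> k)" if "k < n" for k d
    by (rule rich_sat_cong; use assms that in simp)+
  moreover have "a ` {..<n} = b ` {..<n}" using assms by simp
  ultimately show ?thesis unfolding Dn_def by auto
qed

text \<open>Entry \<open>n\<close> may be any witness of \<open>\<Phi> n\<close>, and any element at
  all if there is none. So finite tuples always extend, with freedom to prescribe a witness.\<close>

lemma Dn_Suc_witness:
  assumes "Dn M \<Phi> n a" "c \<in> sdom M" "(\<exists>d\<in>sdom M. sat M (yx_asg d a) (\<Phi> n)) \<Longrightarrow> sat M (yx_asg c a) (\<Phi> n)"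
  shows "Dn M \<Phi> (Suc n) (a(n := c))"
proof -
  have "Dn M \<Phi> n (a(n := c))" using Dn_cong[of n a "a(n := c)"] assms(1) by simp
  moreover have "sat M (yx_asg d (a(n := c))) (\<Phi> n) \<longleftrightarrow> sat M (yx_asg d a) (\<Phi> n)" for d
    by (rule rich_sat_cong) auto
  ultimately show ?thesis unfolding Dn_def using assms(2,3) by (auto simp: less_Suc_eq)
qed

lemma Dn_extend:
  assumes "sdom M \<noteq> {}" "Dn M \<Phi> n a" "n \<le> m"
  shows "\<exists>b. Dn M \<Phi> m b \<and> (\<forall>i<n. b i = a i)"
  using assms(3)
proof (induction m rule: dec_induct)
  case base then show ?case using assms(2) by blast
next
  case (step m)
  then obtain b where b: "Dn M \<Phi> m b" "\<forall>i<n. b i = a i" by blast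
  obtain c where c: "c \<in> sdom M" "(\<exists>d\<in>sdom M. sat M (yx_asg d b) (\<Phi> m)) \<longrightarrow> sat M (yx_asg c b) (\<Phi> m)"
    using assms(1) by blast
  have "Dn M \<Phi> (Suc m) (b(m := c))" by (rule Dn_Suc_witness) (use b c in auto)
  moreover have "\<forall>i<n. (b(m := c)) i = a i" using b(2) step(1) by simp
  ultimately show ?case by blast
qed

lemma dfn_Dn: "dfn L K M {..<n} (\<lambda>k. Dn (M k) \<Phi> n)"
proof -
  let ?P = "\<lambda>l k w. \<forall>d\<in>sdom (M k). sat (M k) (yx_asg d w) (\<Phi> l) \<longrightarrow> sat (M k) (yx_asg (w l) w) (\<Phi> l)"
  have "dfn L K M {..<n} (?P l)" if l: "l < n" for l
  proof -
    have wf: "wf_fm L (\<Phi> l)" "fv (\<Phi> l) \<subseteq> {..l}" using rich unfolding rich_def by auto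
    \<comment> \<open>Variable 0 of \<open>\<Phi> l\<close> is its distinguished one: it is sent to
      \<open>n\<close> for the quantified element and to \<open>l\<close> for the entry under test.
      The other variables lose the shift by one.\<close>
    let ?f = "\<lambda>j i. if i = 0 then j else i - 1"
    have y: "yx_asg (w j) w = (\<lambda>i. w (?f j i))" for w :: "nat \<Rightarrow> nat" and j
      unfolding yx_asg_def by auto
    have "dfn L K M {..n} (\<lambda>k w. \<not> (sat (M k) (\<lambda>i. w (?f n i)) (\<Phi> l) \<longrightarrow> sat (M k) (\<lambda>i. w (?f l i)) (\<Phi> l)))"
      by (intro dfn_Neg dfn_imp dfn_sat) (use wf l in \<open>auto simp: subset_iff\<close>)
    then have "dfn L K M ({..n} - {n}) (\<lambda>k w. \<exists>d\<in>sdom (M k).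
       \<not> (sat (M k) (\<lambda>i. (w(n := d)) (?f n i)) (\<Phi> l) \<longrightarrow> sat (M k) (\<lambda>i. (w(n := d)) (?f l i)) (\<Phi> l)))"
      by (rule dfn_ex1)
    moreover have "{..n} - {n} = {..<n}" by auto
    moreover have "sat (M k) (\<lambda>i. (w(n := d)) (?f n i)) (\<Phi> l) \<longleftrightarrow> sat (M k) (yx_asg d w) (\<Phi> l)"
      "sat (M k) (\<lambda>i. (w(n := d)) (?f l i)) (\<Phi> l) \<longleftrightarrow> sat (M k) (yx_asg (w l) w) (\<Phi> l)" for k w d
      unfolding y[symmetric] by (rule rich_sat_cong; use l in simp)+
    ultimately have "dfn L K M {..<n} (\<lambda>k w. \<exists>d\<in>sdom (M k).
       \<not> (sat (M k) (yx_asg d w) (\<Phi> l) \<longrightarrow> sat (M k) (yx_asg (w l) w) (\<Phi> l)))" by simp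
    then have "dfn L K M {..<n} (\<lambda>k w. \<not> (\<exists>d\<in>sdom (M k).
       \<not> (sat (M k) (yx_asg d w) (\<Phi> l) \<longrightarrow> sat (M k) (yx_asg (w l) w) (\<Phi> l))))" by (rule dfn_Neg)
    then show ?thesis by (rule dfn_cong) blast
  qed
  then have "dfn L K M {..<n} (\<lambda>k w. \<forall>l\<in>{..<n}. ?P l k w)" by (intro dfn_ball) auto
  then show ?thesis by (rule dfn_cong) (auto simp: Dn_def)
qed

text \<open>The Tarski-Vaught property of the set of entries: \<open>\<psi>\<close> occurs in the
  sequence, and the entry at that position has to satisfy it.\<close>

lemma rich_witness:
  assumes "wf_fm L \<psi>" "realises_D M \<Phi> a" "d \<in> sdom M" "sat M (yx_asg d a) \<psi>"
  shows "\<exists>n. sat M (yx_asg (a n) a) \<psi>"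
proof -
  obtain k where "fv \<psi> \<subseteq> {..k}" using finite_fv[of \<psi>] finite_nat_iff_bounded_le by auto
  then obtain n where "\<Phi> n = \<psi>" using rich assms(1) unfolding rich_def by blast
  then show ?thesis using assms(2-4) unfolding realises_D_def by blast
qed

text \<open>Induction on the number \<open>r\<close> of extra coordinates. The last one is projected
  away, the induction hypothesis places the others, and richness supplies a later position whose
  formula asks for the missing one. The first conclusion says that the chosen positions carry a
  solution of \<open>U\<close> as soon as one exists; the second, that each solution can be made to
  appear there.\<close>

lemma rich_coordinates:
  assumes ne: "\<forall>k\<in>K. sdom (M k) \<noteq> {}"
  shows "dfn L K M {..<m + r} U \<Longrightarrow>
   \<exists>m' q. m < m' \<and> (\<forall>t<r. q t < m') \<and>
    (\<forall>k\<in>K. \<forall>y c. Dn (M k) \<Phi> m' y \<and> c ` {m..<m + r} \<subseteq> sdom (M k) \<and>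
        U k (override_on y c {m..<m + r}) \<longrightarrow> U k (\<lambda>i. if i < m then y i else y (q (i - m)))) \<and>
    (\<forall>k\<in>K. \<forall>w. w ` {..<m + r} \<subseteq> sdom (M k) \<and> Dn (M k) \<Phi> m w \<and> U k w \<longrightarrow>
        (\<exists>y. Dn (M k) \<Phi> m' y \<and> (\<forall>i<m. y i = w i) \<and> (\<forall>t<r. y (q t) = w (m + t))))"
proof (induction r arbitrary: U)
  case 0
  have 1: "U k (\<lambda>i. if i < m then y i else y (i - m))" if "k \<in> K" "Dn (M k) \<Phi> (Suc m) y" "U k y" for k y
    using dfn_dep[OF 0 that(1), of y "\<lambda>i. if i < m then y i else y (i - m)"] that(2,3)
    unfolding Dn_def by (auto simp: image_subset_iff)
  have 2: "\<exists>y. Dn (M k) \<Phi> (Suc m) y \<and> (\<forall>i<m. y i = w i)" if "k \<in> K" "Dn (M k) \<Phi> m w" for k w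
    using Dn_extend[OF ne[rule_format, OF that(1)] that(2), of "Suc m"] by simp
  \<comment> \<open>\<open>Suc m\<close> in place of \<open>m\<close> makes the length grow strictly
    even when no coordinate is placed.\<close>
  show ?case
    by (rule exI[of _ "Suc m"], rule exI[of _ "\<lambda>i. i"])
      (use 1 2 in \<open>simp add: override_on_def\<close>)
next
  case (Suc r)
  let ?V = "\<lambda>k w. \<exists>d\<in>sdom (M k). U k (w(m + r := d))"
  have "{..<m + Suc r} - {m + r} = {..<m + r}" by auto
  then have "dfn L K M {..<m + r} ?V" using dfn_ex1[OF Suc.prems, of "m + r"] by (simp only:)
  from Suc.IH[OF this] obtain m' q where q: "m < m'" "\<forall>t<r. q t < m'"
    and a0: "\<forall>k\<in>K. \<forall>y c. Dn (M k) \<Phi> m' y \<and> c ` {m..<m + r} \<subseteq> sdom (M k) \<and>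
        ?V k (override_on y c {m..<m + r}) \<longrightarrow> ?V k (\<lambda>i. if i < m then y i else y (q (i - m)))"
    and b0: "\<forall>k\<in>K. \<forall>w. w ` {..<m + r} \<subseteq> sdom (M k) \<and> Dn (M k) \<Phi> m w \<and> ?V k w \<longrightarrow>
        (\<exists>y. Dn (M k) \<Phi> m' y \<and> (\<forall>i<m. y i = w i) \<and> (\<forall>t<r. y (q t) = w (m + t)))"
    by (elim exE conjE) (rule that)
  have a: "?V k (\<lambda>i. if i < m then y i else y (q (i - m)))"
    if "k \<in> K" "Dn (M k) \<Phi> m' y" "c ` {m..<m + r} \<subseteq> sdom (M k)" "?V k (override_on y c {m..<m + r})"
    for k y c
    by (rule a0[rule_format, OF that(1) conjI[OF that(2) conjI[OF that(3,4)]]])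
  have b: "\<exists>y. Dn (M k) \<Phi> m' y \<and> (\<forall>i<m. y i = w i) \<and> (\<forall>t<r. y (q t) = w (m + t))"
    if "k \<in> K" "w ` {..<m + r} \<subseteq> sdom (M k)" "Dn (M k) \<Phi> m w" "?V k w" for k w
    by (rule b0[rule_format, OF that(1) conjI[OF that(2) conjI[OF that(3,4)]]])
  \<comment> \<open>Brings \<open>U\<close> into the convention of \<open>rich\<close>: the
    coordinate still to be placed becomes variable 0, and entry \<open>i\<close> becomes variable
    \<open>i + 1\<close>.\<close>
  define f where "f i = (if i < m then Suc i else if i = m + r then 0 else Suc (q (i - m)))" for i
  have qlt: "q (i - m) < m'" if "i < m + Suc r" "i \<noteq> m + r" "\<not> i < m" for i
    by (rule q(2)[rule_format]) (use that in linarith)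
  have "f ` {..<m + Suc r} \<subseteq> {..m'}" using q(1) qlt by (auto simp: f_def Suc_le_eq)
  from dfn_ren[OF Suc.prems this] obtain \<psi> where \<psi>: "wf_fm L \<psi>" "fv \<psi> \<subseteq> {..m'}"
    "\<And>k v. k \<in> K \<Longrightarrow> v ` {..m'} \<subseteq> sdom (M k) \<Longrightarrow> U k (\<lambda>i. v (f i)) \<longleftrightarrow> sat (M k) v \<psi>"
    unfolding dfn_def by blast
  \<comment> \<open>As \<open>n\<close> is at least \<open>m'\<close>, every entry mentioned by the
    formula precedes position \<open>n\<close>.\<close>
  obtain n where n: "m' \<le> n" "\<Phi> n = \<psi>" using rich \<psi>(1,2) unfolding rich_def by blast
  have \<psi>U: "sat (M k) (yx_asg d y) (\<Phi> n) \<longleftrightarrow>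
      U k ((\<lambda>i. if i < m then y i else y (q (i - m)))(m + r := d))"
    if k: "k \<in> K" and y: "y ` {..<m'} \<subseteq> sdom (M k)" and d: "d \<in> sdom (M k)" for k y d
  proof -
    have "(\<lambda>i. yx_asg d y (f i)) = (\<lambda>i. if i < m then y i else y (q (i - m)))(m + r := d)"
      by (auto simp: yx_asg_def f_def)
    moreover have "yx_asg d y ` {..m'} \<subseteq> sdom (M k)" using y d by (auto simp: yx_asg_def)
    ultimately show ?thesis using \<psi>(3)[OF k, of "yx_asg d y"] n(2) by simp
  qed
  define q' where "q' = q(r := n)"
  have A: "U k (\<lambda>i. if i < m then y i else y (q' (i - m)))"
    if k: "k \<in> K" and y: "Dn (M k) \<Phi> (Suc n) y" and c: "c ` {m..<m + Suc r} \<subseteq> sdom (M k)"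
      and U: "U k (override_on y c {m..<m + Suc r})" for k y c
  proof -
    have y': "Dn (M k) \<Phi> m' y" by (rule Dn_mono[OF y]) (use n in simp)
    have "(override_on y c {m..<m + r})(m + r := c (m + r)) = override_on y c {m..<m + Suc r}"
      by (auto simp: override_on_def)
    then have "U k ((override_on y c {m..<m + r})(m + r := c (m + r)))" using U by simp
    moreover have cr: "c (m + r) \<in> sdom (M k)" using c by auto
    ultimately have V: "?V k (override_on y c {m..<m + r})" by blast
    have "c ` {m..<m + r} \<subseteq> sdom (M k)" using c by (auto simp: image_subset_iff)
    from a[OF k y' this V] obtain d where d: "d \<in> sdom (M k)" "U k ((\<lambda>i. if i < m then y i else y (q (i - m)))(m + r := d))"
      by blast
    have yd: "y ` {..<m'} \<subseteq> sdom (M k)" "y n \<in> sdom (M k)" using y y' unfolding Dn_def by auto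
    have "sat (M k) (yx_asg d y) (\<Phi> n)" using \<psi>U[OF k yd(1) d(1)] d(2) by simp
    then have "sat (M k) (yx_asg (y n) y) (\<Phi> n)" using y d(1) unfolding Dn_def by blast
    then have U: "U k ((\<lambda>i. if i < m then y i else y (q (i - m)))(m + r := y n))" (is "U k ?g")
      using \<psi>U[OF k yd] by simp
    have "?g ` {..<m + Suc r} \<subseteq> sdom (M k)"
      using yd q(1) qlt by (auto simp: image_subset_iff)
    moreover have "?g i = (if i < m then y i else y (q' (i - m)))" if "i \<in> {..<m + Suc r}" for i
      using that by (auto simp: q'_def)
    ultimately have "U k ?g \<longleftrightarrow> U k (\<lambda>i. if i < m then y i else y (q' (i - m)))"
      by (rule dfn_dep[OF Suc.prems k])
    then show ?thesis using U by (rule iffD1)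
  qed
  have B: "\<exists>y. Dn (M k) \<Phi> (Suc n) y \<and> (\<forall>i<m. y i = w i) \<and> (\<forall>t<Suc r. y (q' t) = w (m + t))"
    if k: "k \<in> K" and w: "w ` {..<m + Suc r} \<subseteq> sdom (M k)" and D: "Dn (M k) \<Phi> m w" and U: "U k w" for k w
  proof -
    have wr: "w (m + r) \<in> sdom (M k)" using w by auto
    have "?V k w" using U wr by (intro bexI[of _ "w (m + r)"]) auto
    then obtain y where y: "Dn (M k) \<Phi> m' y" "\<forall>i<m. y i = w i" "\<forall>t<r. y (q t) = w (m + t)"
      using b[OF k _ D] w by (auto simp: image_subset_iff)
    \<comment> \<open>Arbitrary admissible entries fill the gap up to position \<open>n\<close>,
      where the prescribed value is a legitimate witness.\<close>
    obtain z where z: "Dn (M k) \<Phi> n z" "\<forall>i<m'. z i = y i"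
      using Dn_extend[OF ne[rule_format, OF k] y(1) n(1)] by blast
    have zw: "\<forall>i<m. z i = w i" "\<forall>t<r. z (q t) = w (m + t)" using y z q by auto
    have "U k ((\<lambda>i. if i < m then z i else z (q (i - m)))(m + r := w (m + r)))"
    proof -
      have "w i = ((\<lambda>i. if i < m then z i else z (q (i - m)))(m + r := w (m + r))) i"
        if "i \<in> {..<m + Suc r}" for i
        using zw(1) zw(2)[rule_format, of "i - m"] that by auto
      then show ?thesis using dfn_dep[OF Suc.prems k w] U by blast
    qed
    moreover have zd: "z ` {..<m'} \<subseteq> sdom (M k)" using z(1) n(1) unfolding Dn_def by auto
    ultimately have "sat (M k) (yx_asg (w (m + r)) z) (\<Phi> n)" using \<psi>U[OF k _ wr] by simp
    then have "Dn (M k) \<Phi> (Suc n) (z(n := w (m + r)))"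
      by (intro Dn_Suc_witness z(1) wr)
    then show ?thesis
      using zw q n by (intro exI[of _ "z(n := w (m + r))"]) (auto simp: q'_def less_Suc_eq)
  qed
  have "m < Suc n" "\<forall>t<Suc r. q' t < Suc n" using q n by (auto simp: q'_def less_Suc_eq)
  then show ?case using A B by blast
qed

end

section \<open>Finite stages of the back-and-forth\<close>

context pairs begin

text \<open>\<open>p j\<close> lists the positions whose entries form a code of entry
  \<open>j\<close> of the image; it does not depend on \<open>k\<close>. The last clause asks for
  some preimage, since entries that \<open>p\<close> does not select are left free.\<close>

definition csurj :: "(nat \<Rightarrow> fm) \<Rightarrow> (nat \<Rightarrow> fm) \<Rightarrow> nat \<Rightarrow> nat \<Rightarrow> (nat \<Rightarrow> nat list) \<Rightarrow> bool" where
  "csurj \<Phi> \<Psi> n m p \<longleftrightarrow> (\<forall>j<m. length (p j) = A.d \<and> set (p j) \<subseteq> {..<n}) \<and>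
    (\<forall>k\<in>K. \<forall>x. Dn (M k) \<Phi> n x \<longrightarrow>
       (\<forall>j<m. map x (p j) \<in> A.E k) \<and> Dn (N k) \<Psi> m (\<lambda>j. \<pi> k (map x (p j)))) \<and>
    (\<forall>k\<in>K. \<forall>y. Dn (N k) \<Psi> m y \<longrightarrow>
       (\<exists>x. Dn (M k) \<Phi> n x \<and> (\<forall>j<m. \<pi> k (map x (p j)) = y j)))"

end

context bicode begin

text \<open>\<open>rich_coordinates\<close> is applied to the relation that new entries code a tuple
  which \<open>p\<close> maps to the old ones. Surjectivity of \<open>p\<close> yields a solution,
  so the chosen positions carry one. Conversely, a code of a given \<open>x\<close> is a solution
  over the image of \<open>x\<close>, which makes \<open>q\<close> surjective.\<close>

lemma csurj_step:
  assumes \<Phi>: "rich L \<Phi>" and \<Psi>: "rich L' \<Psi>" and p: "csurj \<Phi> \<Psi> n m p"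
  shows "\<exists>m' q. m < m' \<and> S.csurj \<Psi> \<Phi> m' n q \<and>
    (\<forall>k\<in>K. \<forall>y. Dn (N k) \<Psi> m' y \<longrightarrow> (\<forall>j<m. \<pi> k (map (\<lambda>i. \<pi>' k (map y (q i))) (p j)) = y j))"
proof -
  have pl: "length (p j) = A.d" "set (p j) \<subseteq> {..<n}" if "j < m" for j
    using p that unfolding csurj_def by auto
  have pf: "map x (p j) \<in> A.E k" "Dn (N k) \<Psi> m (\<lambda>j. \<pi> k (map x (p j)))"
    if "k \<in> K" "Dn (M k) \<Phi> n x" "j < m" for k x j
    using p that unfolding csurj_def by auto
  have pf2: "Dn (N k) \<Psi> m (\<lambda>j. \<pi> k (map x (p j)))" if "k \<in> K" "Dn (M k) \<Phi> n x" for k x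
    using p that unfolding csurj_def by auto
  have ps: "\<exists>x. Dn (M k) \<Phi> n x \<and> (\<forall>j<m. \<pi> k (map x (p j)) = y j)" if "k \<in> K" "Dn (N k) \<Psi> m y" for k y
    using p that unfolding csurj_def by auto
  define r where "r = n * B.d"
  \<comment> \<open>Variables below \<open>r\<close> hold codes of the tuple for
    \<open>\<Phi>\<close>, in the position that pulling back produces; variable \<open>r + j\<close>
    holds entry \<open>j\<close> of the tuple for \<open>\<Psi>\<close>.\<close>
  define U0 where "U0 k v \<longleftrightarrow> ((\<forall>i\<in>{..<n}. block B.d v i \<in> B.E k) \<and> Dn (M k) \<Phi> n (B.val k v)) \<and>
    (\<forall>j\<in>{..<m}. S.through k v (r + j) (p j))" for k v
  have BLn: "BL B.d {..<n} = {..<r}"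
    unfolding BL_def r_def by (auto simp: div_less_iff_less_mult[OF B.d_pos])
  have "dfn L' K N {..<r + m} U0"
    unfolding U0_def
  proof (rule dfn_Conj[OF _ dfn_ball])
    show "dfn L' K N {..<r + m} (\<lambda>k v. (\<forall>i\<in>{..<n}. block B.d v i \<in> B.E k) \<and> Dn (M k) \<Phi> n (B.val k v))"
      by (rule dfn_mono[OF B.dfn_pull[OF dfn_Dn[OF \<Phi>]]]) (auto simp: BLn)
    show "dfn L' K N {..<r + m} (\<lambda>k v. S.through k v (r + j) (p j))" if "j \<in> {..<m}" for j
    proof (rule dfn_mono[OF S.through_gen[OF W']])
      show "length (p j) = A.d" using pl that by simp
      have "BL B.d (set (p j)) \<subseteq> BL B.d {..<n}" by (rule BL_mono) (use pl that in simp)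
      then show "insert (r + j) (BL B.d (set (p j))) \<subseteq> {..<r + m}" using BLn that by auto
    qed
  qed simp
  \<comment> \<open>Exchanges the two groups of variables, as \<open>rich_coordinates\<close>
    expects the given entries first.\<close>
  define f where "f i = (if i < r then m + i else i - r)" for i
  have "f ` {..<r + m} \<subseteq> {..<m + r}" by (auto simp: f_def)
  from dfn_ren[OF \<open>dfn L' K N {..<r + m} U0\<close> this]
  have U: "dfn L' K N {..<m + r} (\<lambda>k w. U0 k (\<lambda>i. w (f i)))" .
  have neN: "\<forall>k\<in>K. sdom (N k) \<noteq> {}" using A.strucN unfolding is_struc_def by blast
  have bl: "block B.d (\<lambda>i. w (f i)) i = block B.d (\<lambda>t. w (m + t)) i" if "i < n" for i and w :: "nat \<Rightarrow> nat"
  proof (rule block_cong[OF B.d_pos])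
    fix t assume "t \<in> BL B.d {i}"
    then have "t \<in> BL B.d {..<n}" using that unfolding BL_def by auto
    then show "w (f t) = w (m + t)" unfolding BLn by (simp add: f_def)
  qed
  have fj: "f (r + j) = j" for j by (simp add: f_def)
  have U0_iff: "U0 k (\<lambda>i. w (f i)) \<longleftrightarrow>
      (\<forall>i<n. block B.d (\<lambda>t. w (m + t)) i \<in> B.E k) \<and> Dn (M k) \<Phi> n (B.val k (\<lambda>t. w (m + t))) \<and>
      (\<forall>j<m. map (B.val k (\<lambda>t. w (m + t))) (p j) \<in> A.E k \<and>
         \<pi> k (map (B.val k (\<lambda>t. w (m + t))) (p j)) = w j)" for k and w :: "nat \<Rightarrow> nat"
  proof -
    have mp: "map (B.val k (\<lambda>i. w (f i))) (p j) = map (B.val k (\<lambda>t. w (m + t))) (p j)" if "j < m" for j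
      using pl(2)[OF that] bl by (auto simp: subset_iff)
    have "Dn (M k) \<Phi> n (B.val k (\<lambda>i. w (f i))) \<longleftrightarrow> Dn (M k) \<Phi> n (B.val k (\<lambda>t. w (m + t)))"
      by (rule Dn_cong[OF \<Phi>]) (use bl in simp)
    moreover have "S.through k (\<lambda>i. w (f i)) (r + j) (p j) \<longleftrightarrow>
        map (B.val k (\<lambda>t. w (m + t))) (p j) \<in> A.E k \<and> \<pi> k (map (B.val k (\<lambda>t. w (m + t))) (p j)) = w j"
      if "j < m" "\<forall>i<n. block B.d (\<lambda>t. w (m + t)) i \<in> B.E k" for j
    proof -
      have "\<forall>i\<in>set (p j). block B.d (\<lambda>i. w (f i)) i \<in> B.E k"
        using pl(2)[OF that(1)] that(2) bl by (auto simp: subset_iff)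
      then show ?thesis unfolding S.through_def mp[OF that(1)] fj by blast
    qed
    ultimately show ?thesis unfolding U0_def using bl by (auto 0 3)
  qed
  have codes: "\<exists>u. u ` {..<r} \<subseteq> sdom (N k) \<and> (\<forall>i<n. block B.d u i \<in> B.E k \<and> B.val k u i = x i)"
    if k: "k \<in> K" and x: "Dn (M k) \<Phi> n x" for k x
  proof -
    have "\<exists>c\<in>B.E k. \<pi>' k c = x i" if "i < n" for i
    proof -
      have "x i \<in> \<pi>' k ` B.E k" using x that unfolding Dn_def B.sdom_N[OF k] by blast
      then show ?thesis by (metis imageE)
    qed
    then obtain c where c: "\<And>i. i < n \<Longrightarrow> c i \<in> B.E k \<and> \<pi>' k (c i) = x i" by metis
    have "\<exists>u. \<forall>i. block B.d u i = (if i < n then c i else replicate B.d 0)"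
      by (rule block_surj) (use c in \<open>auto simp: idomset_def\<close>)
    then obtain u where "\<forall>i. block B.d u i = (if i < n then c i else replicate B.d 0)" by blast
    then have u: "block B.d u i = c i" if "i < n" for i using that by simp
    have "u ` BL B.d {i} \<subseteq> sdom (N k)" if "i < n" for i
      using u[OF that] c[OF that] set_block[OF B.d_pos, of u i] unfolding idomset_def by auto
    then have "u ` {..<r} \<subseteq> sdom (N k)" unfolding BLn[symmetric] by (subst BL_UN) blast
    moreover have "\<forall>i<n. block B.d u i \<in> B.E k \<and> B.val k u i = x i" using u c by simp
    ultimately show ?thesis by blast
  qed
  have U_intro: "U0 k (\<lambda>i. w (f i))"
    if k: "k \<in> K" and x: "Dn (M k) \<Phi> n x" and w1: "\<And>j. j < m \<Longrightarrow> w j = \<pi> k (map x (p j))"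
      and u: "\<forall>i<n. block B.d u i \<in> B.E k \<and> B.val k u i = x i" and w2: "\<And>t. t < r \<Longrightarrow> w (m + t) = u t"
    for k x u and w :: "nat \<Rightarrow> nat"
  proof -
    have b: "block B.d (\<lambda>t. w (m + t)) i = block B.d u i" if "i < n" for i
    proof (rule block_cong[OF B.d_pos])
      fix t assume "t \<in> BL B.d {i}"
      then have "t \<in> BL B.d {..<n}" using that unfolding BL_def by auto
      then show "w (m + t) = u t" unfolding BLn by (simp add: w2)
    qed
    have v: "B.val k (\<lambda>t. w (m + t)) i = x i" if "i < n" for i using b u that by simp
    have mp: "map (B.val k (\<lambda>t. w (m + t))) (p j) = map x (p j)" if "j < m" for j
      using pl(2)[OF that] v by (auto simp: subset_iff)
    have "Dn (M k) \<Phi> n (B.val k (\<lambda>t. w (m + t)))"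
      using x Dn_cong[OF \<Phi>, of n "B.val k (\<lambda>t. w (m + t))" x] v by simp
    moreover have "\<forall>j<m. map (B.val k (\<lambda>t. w (m + t))) (p j) \<in> A.E k \<and>
         \<pi> k (map (B.val k (\<lambda>t. w (m + t))) (p j)) = w j"
    proof (intro allI impI)
      fix j assume j: "j < m"
      show "map (B.val k (\<lambda>t. w (m + t))) (p j) \<in> A.E k \<and>
         \<pi> k (map (B.val k (\<lambda>t. w (m + t))) (p j)) = w j"
        unfolding mp[OF j] w1[OF j] using pf(1)[OF k x j] by blast
    qed
    moreover have "\<forall>i<n. block B.d (\<lambda>t. w (m + t)) i \<in> B.E k" using b u by simp
    ultimately show ?thesis unfolding U0_iff by blast
  qed
  from rich_coordinates[OF \<Psi> neN U]
  obtain m' q0 where m': "m < m'" "\<forall>t<r. q0 t < m'"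
    and a0: "\<forall>k\<in>K. \<forall>y c. Dn (N k) \<Psi> m' y \<and> c ` {m..<m + r} \<subseteq> sdom (N k) \<and>
        U0 k (\<lambda>i. (override_on y c {m..<m + r}) (f i)) \<longrightarrow>
        U0 k (\<lambda>i. (\<lambda>i. if i < m then y i else y (q0 (i - m))) (f i))"
    and b0: "\<forall>k\<in>K. \<forall>w. w ` {..<m + r} \<subseteq> sdom (N k) \<and> Dn (N k) \<Psi> m w \<and> U0 k (\<lambda>i. w (f i)) \<longrightarrow>
        (\<exists>y. Dn (N k) \<Psi> m' y \<and> (\<forall>i<m. y i = w i) \<and> (\<forall>t<r. y (q0 t) = w (m + t)))"
    by (elim exE conjE) (rule that)
  have a: "U0 k (\<lambda>i. (\<lambda>i. if i < m then y i else y (q0 (i - m))) (f i))"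
    if "k \<in> K" "Dn (N k) \<Psi> m' y" "c ` {m..<m + r} \<subseteq> sdom (N k)"
      "U0 k (\<lambda>i. (override_on y c {m..<m + r}) (f i))" for k y c
    by (rule a0[rule_format, OF that(1) conjI[OF that(2) conjI[OF that(3,4)]]])
  have b: "\<exists>y. Dn (N k) \<Psi> m' y \<and> (\<forall>i<m. y i = w i) \<and> (\<forall>t<r. y (q0 t) = w (m + t))"
    if "k \<in> K" "w ` {..<m + r} \<subseteq> sdom (N k)" "Dn (N k) \<Psi> m w" "U0 k (\<lambda>i. w (f i))" for k w
    by (rule b0[rule_format, OF that(1) conjI[OF that(2) conjI[OF that(3,4)]]])
  define q where "q i = block B.d q0 i" for i
  have mq: "map y (q i) = block B.d (\<lambda>t. y (q0 t)) i" for y :: "nat \<Rightarrow> nat" and i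
    unfolding q_def block_def by simp
  \<comment> \<open>A code of some preimage of the restriction of \<open>y\<close> completes it to a
    solution. Hence the selected entries of \<open>y\<close> are a solution too, possibly for
    another preimage.\<close>
  have F: "(\<forall>i<n. map y (q i) \<in> B.E k) \<and> Dn (M k) \<Phi> n (\<lambda>i. \<pi>' k (map y (q i))) \<and>
      (\<forall>j<m. \<pi> k (map (\<lambda>i. \<pi>' k (map y (q i))) (p j)) = y j)"
    if k: "k \<in> K" and y: "Dn (N k) \<Psi> m' y" for k y
  proof -
    have "Dn (N k) \<Psi> m y" by (rule Dn_mono[OF y]) (use m' in simp)
    then obtain x where x: "Dn (M k) \<Phi> n x" "\<forall>j<m. \<pi> k (map x (p j)) = y j" using ps[OF k] by blast
    obtain u where u: "u ` {..<r} \<subseteq> sdom (N k)" "\<forall>i<n. block B.d u i \<in> B.E k \<and> B.val k u i = x i"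
      using codes[OF k x(1)] by blast
    let ?c = "\<lambda>i. u (i - m)"
    have U: "U0 k (\<lambda>i. (override_on y ?c {m..<m + r}) (f i))"
      by (rule U_intro[OF k x(1) _ u(2)]) (use x(2) in \<open>auto simp: override_on_def\<close>)
    have "?c ` {m..<m + r} \<subseteq> sdom (N k)" using u(1) by (auto simp: image_subset_iff)
    from a[OF k y this U] have "U0 k (\<lambda>i. (\<lambda>i. if i < m then y i else y (q0 (i - m))) (f i))" .
    then show ?thesis
      using U0_iff[of k "\<lambda>i. if i < m then y i else y (q0 (i - m))"] by (simp add: mq)
  qed
  have G: "\<exists>y. Dn (N k) \<Psi> m' y \<and> (\<forall>i<n. \<pi>' k (map y (q i)) = x i)"
    if k: "k \<in> K" and x: "Dn (M k) \<Phi> n x" for k x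
  proof -
    obtain u where u: "u ` {..<r} \<subseteq> sdom (N k)" "\<forall>i<n. block B.d u i \<in> B.E k \<and> B.val k u i = x i"
      using codes[OF k x] by blast
    \<comment> \<open>Putting the image of \<open>x\<close> in front makes \<open>x\<close> a
      preimage of the old entries, so that the code of \<open>x\<close> is a solution to be
      realised.\<close>
    define w where "w i = (if i < m then \<pi> k (map x (p i)) else u (i - m))" for i
    have Uw: "U0 k (\<lambda>i. w (f i))" by (rule U_intro[OF k x _ u(2)]) (auto simp: w_def)
    have Dw: "Dn (N k) \<Psi> m w"
      using pf2[OF k x] Dn_cong[OF \<Psi>, of m w "\<lambda>j. \<pi> k (map x (p j))"] by (simp add: w_def)
    then have "w ` {..<m + r} \<subseteq> sdom (N k)"
      using u(1) unfolding Dn_def by (auto simp: w_def image_subset_iff)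
    then obtain y where y: "Dn (N k) \<Psi> m' y" "\<forall>i<m. y i = w i" "\<forall>t<r. y (q0 t) = w (m + t)"
      using b[OF k _ Dw Uw] by blast
    have "map y (q i) = block B.d u i" if "i < n" for i
      unfolding mq
    proof (rule block_cong[OF B.d_pos])
      fix t assume "t \<in> BL B.d {i}"
      then have "t \<in> BL B.d {..<n}" using that unfolding BL_def by auto
      then show "y (q0 t) = u t" unfolding BLn using y(3) by (simp add: w_def)
    qed
    then show ?thesis using y(1) u(2) by auto
  qed
  have "set (q i) \<subseteq> {..<m'}" if "i < n" for i
  proof -
    have "BL B.d {i} \<subseteq> {..<r}" unfolding BLn[symmetric] by (rule BL_mono) (use that in simp)
    then show ?thesis unfolding q_def set_block[OF B.d_pos] using m'(2) by auto
  qed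
  then have "S.csurj \<Psi> \<Phi> m' n q" unfolding S.csurj_def using F G by (simp add: q_def)
  then show ?thesis using m'(1) F by blast
qed

end

section \<open>The limit of the finite stages\<close>

context bicode begin

text \<open>Dependent choice from the empty tuples. Each step uses \<open>csurj_step\<close> twice:
  once for \<open>q s\<close>, once with the sides exchanged for \<open>p (Suc s)\<close>. The state
  holds only \<open>p s\<close>; the map \<open>q s\<close> is an existential witness of the
  transition and is extracted afterwards.\<close>

lemma csurj_sequence:
  assumes \<Phi>: "rich L \<Phi>" and \<Psi>: "rich L' \<Psi>"
  obtains n m :: "nat \<Rightarrow> nat" and p q where "strict_mono n" "strict_mono m"
    "\<And>s. csurj \<Phi> \<Psi> (n s) (m s) (p s)" "\<And>s. S.csurj \<Psi> \<Phi> (m (Suc s)) (n s) (q s)"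
    "\<And>s k y j. k \<in> K \<Longrightarrow> Dn (N k) \<Psi> (m (Suc s)) y \<Longrightarrow> j < m s \<Longrightarrow>
       \<pi> k (map (\<lambda>i. \<pi>' k (map y (q s i))) (p s j)) = y j"
    "\<And>s k x i. k \<in> K \<Longrightarrow> Dn (M k) \<Phi> (n (Suc s)) x \<Longrightarrow> i < n s \<Longrightarrow>
       \<pi>' k (map (\<lambda>j. \<pi> k (map x (p (Suc s) j))) (q s i)) = x i"
proof -
  interpret T: bicode L' L J I K N M \<pi>' \<pi> by (rule bicode_sym) (rule bicode_axioms)
  define P where "P st \<longleftrightarrow> (case st of (n, m, p) \<Rightarrow> csurj \<Phi> \<Psi> n m p)" for st
  define Q where "Q st st' q \<longleftrightarrow> (case st of (n, m, p) \<Rightarrow> case st' of (n', m', p') \<Rightarrow>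
     n < n' \<and> m < m' \<and> S.csurj \<Psi> \<Phi> m' n q \<and>
     (\<forall>k\<in>K. \<forall>y. Dn (N k) \<Psi> m' y \<longrightarrow> (\<forall>j<m. \<pi> k (map (\<lambda>i. \<pi>' k (map y (q i))) (p j)) = y j)) \<and>
     (\<forall>k\<in>K. \<forall>x. Dn (M k) \<Phi> n' x \<longrightarrow> (\<forall>i<n. \<pi>' k (map (\<lambda>j. \<pi> k (map x (p' j))) (q i)) = x i)))"
    for st st' q
  have "\<exists>f. \<forall>s. P (f s) \<and> (\<exists>q. Q (f s) (f (Suc s)) q)"
  proof (rule dependent_nat_choice)
    have "csurj \<Phi> \<Psi> 0 0 (\<lambda>j. [])" unfolding csurj_def by (simp add: Dn_0)
    then show "\<exists>st. P st" unfolding P_def by (intro exI[of _ "(0, 0, \<lambda>j. [])"]) simp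
    fix st s assume "P st"
    moreover obtain n m p where st: "st = (n, m, p)" by (cases st) auto
    ultimately have 1: "csurj \<Phi> \<Psi> n m p" unfolding P_def by simp
    obtain m' q where 2: "m < m'" "S.csurj \<Psi> \<Phi> m' n q"
      "\<forall>k\<in>K. \<forall>y. Dn (N k) \<Psi> m' y \<longrightarrow> (\<forall>j<m. \<pi> k (map (\<lambda>i. \<pi>' k (map y (q i))) (p j)) = y j)"
      using csurj_step[OF \<Phi> \<Psi> 1] by blast
    obtain n' p' where 3: "n < n'" "csurj \<Phi> \<Psi> n' m' p'"
      "\<forall>k\<in>K. \<forall>x. Dn (M k) \<Phi> n' x \<longrightarrow> (\<forall>i<n. \<pi>' k (map (\<lambda>j. \<pi> k (map x (p' j))) (q i)) = x i)"
      using T.csurj_step[OF \<Psi> \<Phi> 2(2)] by blast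
    have "P (n', m', p') \<and> Q st (n', m', p') q"
      unfolding P_def Q_def st using 2 3 by simp
    then show "\<exists>st'. P st' \<and> (\<exists>q. Q st st' q)" by blast
  qed
  then obtain f where f: "\<forall>s. P (f s) \<and> (\<exists>q. Q (f s) (f (Suc s)) q)" by blast
  then obtain q where q: "\<And>s. Q (f s) (f (Suc s)) (q s)" by metis
  define n where "n s = fst (f s)" for s
  define m where "m s = fst (snd (f s))" for s
  define p where "p s = snd (snd (f s))" for s
  have fs: "f s = (n s, m s, p s)" for s unfolding n_def m_def p_def by simp
  have P: "csurj \<Phi> \<Psi> (n s) (m s) (p s)" for s using f unfolding P_def fs by simp
  note qq = q[unfolded Q_def fs prod.case]
  show ?thesis
  proof (rule that[of n m p q])
    show "strict_mono n" "strict_mono m" using qq by (auto simp: strict_mono_Suc_iff)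
  qed (use P qq in blast)+
qed

text \<open>The stages cohere: \<open>x\<close> restricted to length \<open>n s\<close> is
  \<open>q s\<close> of \<open>p (Suc s)\<close> of \<open>x\<close>, and \<open>p s\<close> after
  \<open>q s\<close> is restriction, so \<open>p s\<close> and \<open>p (Suc s)\<close> agree below
  \<open>m s\<close>. Thus entry \<open>j\<close> may be computed at any stage that reaches it;
  stage \<open>Suc j\<close> does, because \<open>s \<le> m s\<close>.\<close>

lemma limit_forward:
  assumes \<Phi>: "rich L \<Phi>" and \<Psi>: "rich L' \<Psi>" and k: "k \<in> K"
    and mono: "strict_mono n" "strict_mono m"
    and p: "\<And>s. csurj \<Phi> \<Psi> (n s) (m s) (p s)"
    and ql: "\<And>s i. i < n s \<Longrightarrow> set (q s i) \<subseteq> {..<m (Suc s)}"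
    and FG: "\<And>s y j. Dn (N k) \<Psi> (m (Suc s)) y \<Longrightarrow> j < m s \<Longrightarrow>
       \<pi> k (map (\<lambda>i. \<pi>' k (map y (q s i))) (p s j)) = y j"
    and GF: "\<And>s x i. Dn (M k) \<Phi> (n (Suc s)) x \<Longrightarrow> i < n s \<Longrightarrow>
       \<pi>' k (map (\<lambda>j. \<pi> k (map x (p (Suc s) j))) (q s i)) = x i"
    and x: "\<And>s. Dn (M k) \<Phi> s x"
  shows "map x (p (Suc j) j) \<in> A.E k"
    "Dn (N k) \<Psi> s (\<lambda>j. \<pi> k (map x (p (Suc j) j)))"
    "\<pi>' k (map (\<lambda>j. \<pi> k (map x (p (Suc j) j))) (q (Suc i) i)) = x i"
proof -
  have lt: "s \<le> n s" "s \<le> m s" for s using mono by (simp_all add: strict_mono_imp_increasing)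
  have pl: "set (p s j) \<subseteq> {..<n s}" if "j < m s" for s j
    using p[of s] that unfolding csurj_def by blast
  let ?F = "\<lambda>s j. \<pi> k (map x (p s j))"
  have E: "map x (p s j) \<in> A.E k" if "j < m s" for s j
    using p[of s] x[of "n s"] k that unfolding csurj_def by blast
  have D: "Dn (N k) \<Psi> (m s) (?F s)" for s
    using p[of s] x[of "n s"] k unfolding csurj_def by blast
  have coh1: "?F (Suc s) j = ?F s j" if "j < m s" for s j
  proof -
    have "?F (Suc s) j = \<pi> k (map (\<lambda>i. \<pi>' k (map (?F (Suc s)) (q s i))) (p s j))"
      using FG[OF D that] by simp
    also have "map (\<lambda>i. \<pi>' k (map (?F (Suc s)) (q s i))) (p s j) = map x (p s j)"
      using pl[OF that] GF[OF x] by (auto simp: subset_iff)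
    finally show ?thesis .
  qed
  have coh: "?F t j = ?F s j" if "s \<le> t" "j < m s" for s t j
    using that(1)
  proof (induction t rule: dec_induct)
    case (step t)
    have "j < m t" using that(2) step(1) mono(2) by (meson less_le_trans strict_mono_less_eq)
    then show ?case using coh1 step by metis
  qed simp
  have jm: "j < m (Suc j)" for j using lt(2)[of "Suc j"] by simp
  have F: "?F (Suc j) j = ?F s j" if "j < m s" for s j
    using coh[of s "Suc j" j] coh[of "Suc j" s j] that jm by (metis nat_le_linear)
  show "map x (p (Suc j) j) \<in> A.E k" by (rule E) (rule jm)
  have "Dn (N k) \<Psi> (m s) (\<lambda>j. ?F (Suc j) j)"
    using D[of s] Dn_cong[OF \<Psi>, of "m s" "?F s" "\<lambda>j. ?F (Suc j) j"] F by simp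
  then show "Dn (N k) \<Psi> s (\<lambda>j. ?F (Suc j) j)" using Dn_mono lt(2) by blast
  have i: "i < n (Suc i)" using lt(1)[of "Suc i"] by simp
  have "map (\<lambda>j. ?F (Suc j) j) (q (Suc i) i) = map (?F (Suc (Suc i))) (q (Suc i) i)"
    using ql[OF i] F[of _ "Suc (Suc i)"] by (auto simp: subset_iff)
  then show "\<pi>' k (map (\<lambda>j. ?F (Suc j) j) (q (Suc i) i)) = x i"
    using GF[OF x i] by (simp only:)
qed

text \<open>The mirror image of \<open>limit_forward\<close> with the stages shifted, as
  \<open>q s\<close> starts from length \<open>m (Suc s)\<close>: coherence rewrites
  \<open>q s\<close> of \<open>y\<close> as \<open>q s\<close> of \<open>p (Suc s)\<close> of
  \<open>q (Suc s)\<close> of \<open>y\<close>.\<close>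

lemma limit_backward:
  assumes \<Phi>: "rich L \<Phi>" and \<Psi>: "rich L' \<Psi>" and k: "k \<in> K"
    and mono: "strict_mono n" "strict_mono m"
    and pl: "\<And>s j. j < m s \<Longrightarrow> set (p s j) \<subseteq> {..<n s}"
    and q: "\<And>s. S.csurj \<Psi> \<Phi> (m (Suc s)) (n s) (q s)"
    and FG: "\<And>s y j. Dn (N k) \<Psi> (m (Suc s)) y \<Longrightarrow> j < m s \<Longrightarrow>
       \<pi> k (map (\<lambda>i. \<pi>' k (map y (q s i))) (p s j)) = y j"
    and GF: "\<And>s x i. Dn (M k) \<Phi> (n (Suc s)) x \<Longrightarrow> i < n s \<Longrightarrow>
       \<pi>' k (map (\<lambda>j. \<pi> k (map x (p (Suc s) j))) (q s i)) = x i"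
    and y: "\<And>s. Dn (N k) \<Psi> s y"
  shows "map y (q (Suc i) i) \<in> B.E k"
    "Dn (M k) \<Phi> s (\<lambda>i. \<pi>' k (map y (q (Suc i) i)))"
    "\<pi> k (map (\<lambda>i. \<pi>' k (map y (q (Suc i) i))) (p (Suc j) j)) = y j"
proof -
  have lt: "s \<le> n s" "s \<le> m s" for s using mono by (simp_all add: strict_mono_imp_increasing)
  let ?G = "\<lambda>s i. \<pi>' k (map y (q s i))"
  have ql: "set (q s i) \<subseteq> {..<m (Suc s)}" if "i < n s" for s i
    using q[of s] that unfolding S.csurj_def by blast
  have E: "map y (q s i) \<in> B.E k" if "i < n s" for s i
    using q[of s] y[of "m (Suc s)"] k that unfolding S.csurj_def by blast
  have D: "Dn (M k) \<Phi> (n s) (?G s)" for s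
    using q[of s] y[of "m (Suc s)"] k unfolding S.csurj_def by blast
  have coh1: "?G (Suc s) i = ?G s i" if "i < n s" for s i
  proof -
    have "?G (Suc s) i = \<pi>' k (map (\<lambda>j. \<pi> k (map (?G (Suc s)) (p (Suc s) j))) (q s i))"
      using GF[OF D that] by simp
    also have "map (\<lambda>j. \<pi> k (map (?G (Suc s)) (p (Suc s) j))) (q s i) = map y (q s i)"
      using ql[OF that] FG[OF y] by (auto simp: subset_iff)
    finally show ?thesis .
  qed
  have coh: "?G t i = ?G s i" if "s \<le> t" "i < n s" for s t i
    using that(1)
  proof (induction t rule: dec_induct)
    case (step t)
    have "i < n t" using that(2) step(1) mono(1) by (meson less_le_trans strict_mono_less_eq)
    then show ?case using coh1 step by metis
  qed simp
  have inn: "i < n (Suc i)" for i using lt(1)[of "Suc i"] by simp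
  have G: "?G (Suc i) i = ?G s i" if "i < n s" for s i
    using coh[of s "Suc i" i] coh[of "Suc i" s i] that inn by (metis nat_le_linear)
  show "map y (q (Suc i) i) \<in> B.E k" by (rule E) (rule inn)
  have "Dn (M k) \<Phi> (n s) (\<lambda>i. ?G (Suc i) i)"
    using D[of s] Dn_cong[OF \<Phi>, of "n s" "?G s" "\<lambda>i. ?G (Suc i) i"] G by simp
  then show "Dn (M k) \<Phi> s (\<lambda>i. ?G (Suc i) i)" using Dn_mono lt(1) by blast
  have j: "j < m (Suc j)" using lt(2)[of "Suc j"] by simp
  have "map (\<lambda>i. ?G (Suc i) i) (p (Suc j) j) = map (?G (Suc j)) (p (Suc j) j)"
    using pl[OF j] G[of _ "Suc j"] by (auto simp: subset_iff)
  then show "\<pi> k (map (\<lambda>i. ?G (Suc i) i) (p (Suc j) j)) = y j"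
    using FG[OF y j] by (simp only:)
qed

text \<open>The lists are the diagonals of the stages. They are common to all \<open>k\<close>,
  which is what lets the bijections of tuples induce a map on types.\<close>

lemma bijection:
  assumes \<Phi>: "rich L \<Phi>" and \<Psi>: "rich L' \<Psi>"
  obtains p q :: "nat \<Rightarrow> nat list" where "\<And>j. length (p j) = A.d" "\<And>i. length (q i) = B.d"
    "\<And>k x j. k \<in> K \<Longrightarrow> range x \<subseteq> sdom (M k) \<Longrightarrow> realises_D (M k) \<Phi> x \<Longrightarrow> map x (p j) \<in> A.E k"
    "\<And>k x. k \<in> K \<Longrightarrow> range x \<subseteq> sdom (M k) \<Longrightarrow> realises_D (M k) \<Phi> x \<Longrightarrow>
       realises_D (N k) \<Psi> (\<lambda>j. \<pi> k (map x (p j)))"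
    "\<And>k x. k \<in> K \<Longrightarrow> range x \<subseteq> sdom (M k) \<Longrightarrow> realises_D (M k) \<Phi> x \<Longrightarrow>
       (\<lambda>i. \<pi>' k (map (\<lambda>j. \<pi> k (map x (p j))) (q i))) = x"
    "\<And>k y i. k \<in> K \<Longrightarrow> range y \<subseteq> sdom (N k) \<Longrightarrow> realises_D (N k) \<Psi> y \<Longrightarrow> map y (q i) \<in> B.E k"
    "\<And>k y. k \<in> K \<Longrightarrow> range y \<subseteq> sdom (N k) \<Longrightarrow> realises_D (N k) \<Psi> y \<Longrightarrow>
       realises_D (M k) \<Phi> (\<lambda>i. \<pi>' k (map y (q i)))"
    "\<And>k y. k \<in> K \<Longrightarrow> range y \<subseteq> sdom (N k) \<Longrightarrow> realises_D (N k) \<Psi> y \<Longrightarrow>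
       (\<lambda>j. \<pi> k (map (\<lambda>i. \<pi>' k (map y (q i))) (p j))) = y"
proof (rule csurj_sequence[OF \<Phi> \<Psi>])
  fix n m p q
  assume mono: "strict_mono n" "strict_mono m"
    and p: "\<And>s. csurj \<Phi> \<Psi> (n s) (m s) (p s)" and q: "\<And>s. S.csurj \<Psi> \<Phi> (m (Suc s)) (n s) (q s)"
    and FG: "\<And>s k y j. k \<in> K \<Longrightarrow> Dn (N k) \<Psi> (m (Suc s)) y \<Longrightarrow> j < m s \<Longrightarrow>
       \<pi> k (map (\<lambda>i. \<pi>' k (map y (q s i))) (p s j)) = y j"
    and GF: "\<And>s k x i. k \<in> K \<Longrightarrow> Dn (M k) \<Phi> (n (Suc s)) x \<Longrightarrow> i < n s \<Longrightarrow>
       \<pi>' k (map (\<lambda>j. \<pi> k (map x (p (Suc s) j))) (q s i)) = x i"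
  have pl: "length (p s j) = A.d" "set (p s j) \<subseteq> {..<n s}" if "j < m s" for s j
    using p[of s] that unfolding csurj_def by blast+
  have ql: "length (q s i) = B.d" "set (q s i) \<subseteq> {..<m (Suc s)}" if "i < n s" for s i
    using q[of s] that unfolding S.csurj_def by blast+
  have lt: "s < n (Suc s)" "s < m (Suc s)" for s
    using strict_mono_imp_increasing[OF mono(1), of "Suc s"] strict_mono_imp_increasing[OF mono(2), of "Suc s"] by auto
  note X = limit_forward[OF \<Phi> \<Psi> _ mono p ql(2) FG GF]
  note Y = limit_backward[OF \<Phi> \<Psi> _ mono pl(2) q FG GF]
  have DX: "Dn (M k) \<Phi> s x" if "range x \<subseteq> sdom (M k)" "realises_D (M k) \<Phi> x" for k x s
    using realises_D_Dn that by blast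
  have DY: "Dn (N k) \<Psi> s x" if "range x \<subseteq> sdom (N k)" "realises_D (N k) \<Psi> x" for k x s
    using realises_D_Dn that by blast
  show ?thesis
  proof (rule that[of "\<lambda>j. p (Suc j) j" "\<lambda>i. q (Suc i) i"])
    show "length (p (Suc j) j) = A.d" for j by (rule pl(1)[OF lt(2)])
    show "length (q (Suc i) i) = B.d" for i by (rule ql(1)[OF lt(1)])
    fix k assume k: "k \<in> K"
    {
      fix x assume "range x \<subseteq> sdom (M k)" "realises_D (M k) \<Phi> x"
      note x = DX[OF this]
      show "map x (p (Suc j) j) \<in> A.E k" for j by (rule X(1)) (use k x in simp_all)
      have "Dn (N k) \<Psi> s (\<lambda>j. \<pi> k (map x (p (Suc j) j)))" for s by (rule X(2)) (use k x in simp_all)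
      then show "realises_D (N k) \<Psi> (\<lambda>j. \<pi> k (map x (p (Suc j) j)))" using realises_D_Dn by blast
      show "(\<lambda>i. \<pi>' k (map (\<lambda>j. \<pi> k (map x (p (Suc j) j))) (q (Suc i) i))) = x"
        by (rule ext, rule X(3)) (use k x in simp_all)
    next
      fix y assume "range y \<subseteq> sdom (N k)" "realises_D (N k) \<Psi> y"
      note y = DY[OF this]
      show "map y (q (Suc i) i) \<in> B.E k" for i by (rule Y(1)) (use k y in simp_all)
      have "Dn (M k) \<Phi> s (\<lambda>i. \<pi>' k (map y (q (Suc i) i)))" for s by (rule Y(2)) (use k y in simp_all)
      then show "realises_D (M k) \<Phi> (\<lambda>i. \<pi>' k (map y (q (Suc i) i)))" using realises_D_Dn by blast
      show "(\<lambda>j. \<pi> k (map (\<lambda>i. \<pi>' k (map y (q (Suc i) i))) (p (Suc j) j))) = y"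
        by (rule ext, rule Y(3)) (use k y in simp_all)
    }
  qed
qed

end

section \<open>Transfer of types and of sets of entries\<close>

context bicode begin

text \<open>A property of the images of \<open>a\<close> and \<open>b\<close> is a property of codes
  whose members are entries of \<open>a\<close> and \<open>b\<close>, so translation followed by a
  renaming suffices.\<close>

lemma type_transfer:
  assumes pl: "\<And>j. length (p j) = A.d"
    and pE: "\<And>k x j. k \<in> K \<Longrightarrow> range x \<subseteq> sdom (M k) \<Longrightarrow> realises_D (M k) \<Phi> x \<Longrightarrow> map x (p j) \<in> A.E k"
    and \<psi>: "wf_fm L' \<psi>"
  shows "\<exists>\<phi>. wf_fm L \<phi> \<and> (\<forall>k\<in>K. \<forall>a b. range a \<subseteq> sdom (M k) \<and> range b \<subseteq> sdom (M k) \<and>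
      realises_D (M k) \<Phi> a \<and> realises_D (M k) \<Phi> b \<longrightarrow>
      (sat (N k) (pair_asg (\<lambda>j. \<pi> k (map a (p j))) (\<lambda>j. \<pi> k (map b (p j)))) \<psi> \<longleftrightarrow>
       sat (M k) (pair_asg a b) \<phi>))"
proof -
  \<comment> \<open>Variable \<open>i\<close> of a pair belongs to entry \<open>i div 2\<close> of
    the first or second tuple by parity. Its block is sent to the entries of the same tuple at the
    positions \<open>p (i div 2)\<close>.\<close>
  define f where "f n = 2 * (p (n div A.d div 2) ! (n mod A.d)) + n div A.d mod 2" for n
  obtain \<phi> where \<phi>: "wf_fm L \<phi>" "\<forall>k\<in>K. \<forall>v. range v \<subseteq> sdom (M k) \<longrightarrow>
      ((\<forall>i\<in>fv \<psi>. block A.d (\<lambda>i. v (f i)) i \<in> A.E k) \<and> sat (N k) (A.val k (\<lambda>i. v (f i))) \<psi> \<longleftrightarrow>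
        sat (M k) v \<phi>)"
    using dfn_ren[OF A.fm_pull[OF \<psi>] subset_UNIV, of f] unfolding dfn_def by (elim exE conjE) (rule that)
  have "sat (N k) (pair_asg (\<lambda>j. \<pi> k (map a (p j))) (\<lambda>j. \<pi> k (map b (p j)))) \<psi> \<longleftrightarrow>
       sat (M k) (pair_asg a b) \<phi>"
    if k: "k \<in> K" and a: "range a \<subseteq> sdom (M k)" "realises_D (M k) \<Phi> a"
      and b: "range b \<subseteq> sdom (M k)" "realises_D (M k) \<Phi> b" for k a b
  proof -
    have bl: "block A.d (\<lambda>i. pair_asg a b (f i)) i = (if even i then map a (p (i div 2)) else map b (p (i div 2)))" for i
      unfolding block_comp
      by (rule nth_equalityI) (auto simp: pl f_def pair_asg_def odd_iff_mod_2_eq_one)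
    have "A.val k (\<lambda>i. pair_asg a b (f i)) = pair_asg (\<lambda>j. \<pi> k (map a (p j))) (\<lambda>j. \<pi> k (map b (p j)))"
      unfolding bl by (auto simp: pair_asg_def)
    moreover have "\<forall>i\<in>fv \<psi>. block A.d (\<lambda>i. pair_asg a b (f i)) i \<in> A.E k"
      unfolding bl using pE[OF k a] pE[OF k b] by simp
    moreover have "range (pair_asg a b) \<subseteq> sdom (M k)" using a(1) b(1) by (auto simp: pair_asg_def)
    ultimately show ?thesis using \<phi>(2)[rule_format, OF k, of "pair_asg a b"] by simp
  qed
  then show ?thesis using \<phi>(1) by blast
qed

text \<open>Since \<open>x\<close> is decoded from entries of \<open>y\<close>, the element coded by
  \<open>zs\<close> is definable in \<open>N\<close> from finitely many entries of \<open>y\<close>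
  by the composite decoding. Richness puts a witness of that definition among the entries of
  \<open>y\<close>, and the definition has only one solution.\<close>

lemma range_transfer:
  assumes \<Psi>: "rich L' \<Psi>" and k: "k \<in> K" and ql: "\<And>i. length (q i) = B.d"
    and y: "range y \<subseteq> sdom (N k)" "realises_D (N k) \<Psi> y" "\<And>i. map y (q i) \<in> B.E k"
    and x: "\<And>i. x i = \<pi>' k (map y (q i))"
    and zs: "zs \<in> A.E k" "set zs \<subseteq> range x"
  shows "\<pi> k zs \<in> range y"
proof -
  have "\<exists>js. zs = map x js"
  proof -
    have "\<exists>js. set js \<subseteq> UNIV \<and> map x js = zs" by (rule map_iso_surj[of x UNIV "range x"]) (use zs in auto)
    then show ?thesis by auto
  qed
  then obtain js where js: "zs = map x js" by blast
  have lj: "length js = A.d" using zs(1) unfolding js idomset_def by simp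
  \<comment> \<open>Variable 0 of \<open>yx_asg\<close> stands for the element being defined;
    \<open>Suc\<close> addresses the entries of \<open>y\<close>.\<close>
  define f where "f i = (if i < B.d * A.d then Suc (q (js ! (i div B.d)) ! (i mod B.d)) else 0)" for i
  obtain \<psi> where \<psi>: "wf_fm L' \<psi>" "\<And>k v. k \<in> K \<Longrightarrow> range v \<subseteq> sdom (N k) \<Longrightarrow>
      S.through k (\<lambda>i. v (f i)) (B.d * A.d) [0..<A.d] \<longleftrightarrow> sat (N k) v \<psi>"
    using dfn_ren[OF W', of f UNIV] unfolding dfn_def by auto
  have t: "S.through k (\<lambda>i. yx_asg c y (f i)) (B.d * A.d) [0..<A.d] \<longleftrightarrow> \<pi> k zs = c" for c
  proof -
    have bl: "block B.d (\<lambda>i. yx_asg c y (f i)) l = map y (q (js ! l))" if "l < A.d" for l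
    proof -
      have "l * B.d + i < B.d * A.d" if "i < B.d" for i
        using mult_le_mono1[of "Suc l" A.d B.d] \<open>l < A.d\<close> that by (simp add: mult.commute)
      then show ?thesis unfolding block_comp f_def
        by (intro nth_equalityI) (use ql in \<open>auto simp: yx_asg_def\<close>)
    qed
    have "map (B.val k (\<lambda>i. yx_asg c y (f i))) [0..<A.d] = zs"
      unfolding js by (rule nth_equalityI) (use lj bl x in auto)
    then show ?thesis unfolding S.through_def using bl y(3) zs(1) by (simp add: f_def yx_asg_def)
  qed
  have ra: "range (yx_asg c y) \<subseteq> sdom (N k)" if "c \<in> sdom (N k)" for c
    using that y(1) by (auto simp: yx_asg_def)
  have z: "\<pi> k zs \<in> sdom (N k)" using zs(1) A.sdom_N[OF k] by blast
  then have "sat (N k) (yx_asg (\<pi> k zs) y) \<psi>" using t[of "\<pi> k zs"] \<psi>(2)[OF k ra[OF z]] by simp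
  then obtain n where "sat (N k) (yx_asg (y n) y) \<psi>"
    using rich_witness[OF \<Psi> \<psi>(1) y(2) z] by blast
  moreover have "y n \<in> sdom (N k)" using y(1) by auto
  ultimately have "\<pi> k zs = y n" using t[of "y n"] \<psi>(2)[OF k ra[of "y n"]] by blast
  then show ?thesis by simp
qed

end

section \<open>Types and groupoids\<close>

lemma pair_asg_comp: "(\<lambda>i. g (pair_asg a b i)) = pair_asg (\<lambda>i. g (a i)) (\<lambda>i. g (b i))"
  unfolding pair_asg_def by auto

lemma ptp_iso:
  assumes "struc_iso L A B g" "is_struc L A" "range a \<subseteq> sdom A" "range b \<subseteq> sdom A"
  shows "ptp L B (\<lambda>i. g (a i)) (\<lambda>i. g (b i)) = ptp L A a b"
proof -
  have "range (pair_asg a b) \<subseteq> sdom A" using assms(3,4) by (auto simp: pair_asg_def)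
  then have "sat B (\<lambda>i. g (pair_asg a b i)) \<phi> \<longleftrightarrow> sat A (pair_asg a b) \<phi>" if "wf_fm L \<phi>" for \<phi>
    by (intro iso_sat[OF assms(1,2) that]) auto
  then show ?thesis unfolding ptp_def pair_asg_comp by auto
qed

text \<open>Exchanging the two tuples is the renaming that swaps each even variable with the odd one
  after it.\<close>

lemma ptp_swap: "\<phi> \<in> ptp L M b a \<longleftrightarrow> wf_fm L \<phi> \<and> ren (\<lambda>i. if even i then Suc i else i - 1) \<phi> \<in> ptp L M a b"
proof -
  have "pair_asg b a = (\<lambda>i. pair_asg a b (if even i then Suc i else i - 1))"
    by (rule ext, rename_tac i, case_tac "even i") (auto simp: pair_asg_def elim!: evenE oddE)
  then show ?thesis unfolding ptp_def by (auto simp: sat_ren wf_ren)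
qed

lemma ptp_swap_eq:
  assumes "ptp L M a b = ptp L M' a' b'"
  shows "ptp L M b a = ptp L M' b' a'"
proof -
  have "\<phi> \<in> ptp L M b a \<longleftrightarrow> \<phi> \<in> ptp L M' b' a'" for \<phi>
    unfolding ptp_swap[of \<phi> L M b a] ptp_swap[of \<phi> L M' b' a'] assms ..
  then show ?thesis by blast
qed

text \<open>Each condition of \<open>D\<close> on the first tuple is expressed by a formula
  \<open>D k\<close> in the variables of the pair, hence can be read off the type.\<close>

lemma ptp_realises:
  assumes rich: "rich L \<Phi>" and eq: "ptp L M a b = ptp L M' a' b'" and r: "realises_D M \<Phi> a"
  shows "realises_D M' \<Phi> a'"
proof -
  define f where "f z i = (if i = 0 then z else 2 * (i - 1))" for z i :: nat
  \<comment> \<open>Variable 1 can serve as the bound one: the entries of \<open>a\<close> occupy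
    even variables, and no odd variable is otherwise free in the renamed formula.\<close>
  define D where "D k = Neg (Conj (Ex 1 (ren (f 1) (\<Phi> k))) (Neg (ren (f (2 * k)) (\<Phi> k))))" for k
  have 1: "(\<lambda>i. ((pair_asg a b)(1 := d)) (f 1 i)) = yx_asg d a" for a b :: "nat \<Rightarrow> 'x" and d
    by (auto simp: fun_eq_iff f_def yx_asg_def pair_asg_def)
  have 2: "(\<lambda>i. pair_asg a b (f (2 * k) i)) = yx_asg (a k) a" for a b :: "nat \<Rightarrow> 'x" and k
    by (auto simp: fun_eq_iff f_def yx_asg_def pair_asg_def)
  have D: "sat M (pair_asg a b) (D k) \<longleftrightarrow>
     (\<forall>d\<in>sdom M. sat M (yx_asg d a) (\<Phi> k) \<longrightarrow> sat M (yx_asg (a k) a) (\<Phi> k))" for M :: "'x struc" and a b k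
    unfolding D_def by (auto simp: sat_ren 1[simplified] 2)
  have wf: "wf_fm L (D k)" for k using rich unfolding D_def rich_def by (simp add: wf_ren)
  have "sat M' (pair_asg a' b') (D k)" for k
  proof -
    have "D k \<in> ptp L M a b" using r wf D unfolding ptp_def realises_D_def by blast
    then show ?thesis unfolding eq by (simp add: ptp_def)
  qed
  then show ?thesis unfolding D realises_D_def by blast
qed

lemma ptp_range:
  assumes eq: "ptp L M a b = ptp L M' a' b'" and r: "range b \<subseteq> range a"
  shows "range b' \<subseteq> range a'"
proof -
  have "\<exists>j. b' i = a' j" for i
  proof -
    obtain j where "b i = a j" using r by blast
    then have "Eq (Var (2 * i + 1)) (Var (2 * j)) \<in> ptp L M a b" by (simp add: ptp_def pair_asg_def)
    then have "b' i = a' j" unfolding eq by (simp add: ptp_def pair_asg_def)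
    then show ?thesis by blast
  qed
  then show ?thesis by blast
qed

definition Dpair :: "(nat \<Rightarrow> fm) \<Rightarrow> 'a struc \<Rightarrow> (nat \<Rightarrow> 'a) \<Rightarrow> (nat \<Rightarrow> 'a) \<Rightarrow> bool" where
  "Dpair \<Phi> M a b \<longleftrightarrow> range a \<subseteq> sdom M \<and> range b \<subseteq> sdom M \<and>
     realises_D M \<Phi> a \<and> realises_D M \<Phi> b \<and> range a = range b"

text \<open>Belonging to the groupoid is a property of the type, so any realisation of an element
  may be used to compute with it.\<close>

lemma Dpair_ptp:
  assumes "rich L \<Phi>" "ptp L M a b = ptp L M' a' b'" "Dpair \<Phi> M a b"
    "range a' \<subseteq> sdom M'" "range b' \<subseteq> sdom M'"
  shows "Dpair \<Phi> M' a' b'"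
  using assms ptp_realises[OF assms(1,2)] ptp_realises[OF assms(1) ptp_swap_eq[OF assms(2)]]
    ptp_range[OF assms(2)] ptp_range[OF ptp_swap_eq[OF assms(2)]]
  unfolding Dpair_def by auto

text \<open>One direction of the isomorphism. \<open>F\<close> acts on tuples, and \<open>tr\<close>
  translates formulas about image tuples back. By \<open>exM\<close>, the family contains every
  model on \<open>nat\<close> up to isomorphism, so every element of the groupoid is realised inside
  it.\<close>

locale type_map =
  fixes L L' :: lang and T T' :: "fm set" and \<Phi> \<Psi> :: "nat \<Rightarrow> fm" and K :: "'k set"
    and M N :: "'k \<Rightarrow> nat struc" and F :: "'k \<Rightarrow> (nat \<Rightarrow> nat) \<Rightarrow> nat \<Rightarrow> nat" and tr :: "fm \<Rightarrow> fm"
  assumes rich\<Phi>: "rich L \<Phi>"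
    and modM: "\<And>k. k \<in> K \<Longrightarrow> model L T (M k)" and modN: "\<And>k. k \<in> K \<Longrightarrow> model L' T' (N k)"
    and exM: "\<And>A :: nat struc. model L T A \<Longrightarrow> \<exists>k\<in>K. \<exists>g. struc_iso L A (M k) g"
    and FD: "\<And>k a b. k \<in> K \<Longrightarrow> Dpair \<Phi> (M k) a b \<Longrightarrow> Dpair \<Psi> (N k) (F k a) (F k b)"
    and tr_wf: "\<And>\<psi>. wf_fm L' \<psi> \<Longrightarrow> wf_fm L (tr \<psi>)"
    and tr: "\<And>\<psi> k a b. wf_fm L' \<psi> \<Longrightarrow> k \<in> K \<Longrightarrow> Dpair \<Phi> (M k) a b \<Longrightarrow>
       sat (N k) (pair_asg (F k a) (F k b)) \<psi> \<longleftrightarrow> sat (M k) (pair_asg a b) (tr \<psi>)"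
begin

text \<open>An inverse image under \<open>tr\<close>: no realisation has to be chosen, and
  continuity is immediate.\<close>

definition tmap :: "fm set \<Rightarrow> fm set" where
  "tmap p = {\<psi>. wf_fm L' \<psi> \<and> tr \<psi> \<in> p}"

lemma tmap_ptp: "k \<in> K \<Longrightarrow> Dpair \<Phi> (M k) a b \<Longrightarrow> tmap (ptp L (M k) a b) = ptp L' (N k) (F k a) (F k b)"
  unfolding tmap_def ptp_def using tr tr_wf by auto

text \<open>One \<open>k\<close> and one \<open>g\<close> serve all tuples of \<open>A\<close>; a
  composition involves three tuples, which have to be moved together.\<close>

lemma iso_into_K:
  assumes A: "model L T (A :: nat struc)"
  obtains k g where "k \<in> K" "g ` sdom A \<subseteq> sdom (M k)"
    "\<forall>a b. range a \<subseteq> sdom A \<and> range b \<subseteq> sdom A \<longrightarrow>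
       ptp L A a b = ptp L (M k) (\<lambda>i. g (a i)) (\<lambda>i. g (b i))"
proof -
  obtain k g where k: "k \<in> K" and g: "struc_iso L A (M k) g" using exM[OF A] by blast
  have st: "is_struc L A" using A unfolding model_def by blast
  have im: "g ` sdom A = sdom (M k)" using g unfolding struc_iso_def bij_betw_def by blast
  show ?thesis
    by (rule that[of k g]) (use k im ptp_iso[OF g st] in auto)
qed

lemma Gset_repr:
  assumes "p \<in> Gset L T \<Phi>"
  obtains k a b where "k \<in> K" "Dpair \<Phi> (M k) a b" "p = ptp L (M k) a b"
proof -
  obtain A :: "nat struc" and a b where A: "model L T A" "p = ptp L A a b" "Dpair \<Phi> A a b"
    using assms unfolding Gset_def Dpair_def by blast
  then have ab: "range a \<subseteq> sdom A" "range b \<subseteq> sdom A" unfolding Dpair_def by auto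
  obtain k g where k: "k \<in> K" "g ` sdom A \<subseteq> sdom (M k)"
    "\<forall>a b. range a \<subseteq> sdom A \<and> range b \<subseteq> sdom A \<longrightarrow>
       ptp L A a b = ptp L (M k) (\<lambda>i. g (a i)) (\<lambda>i. g (b i))"
    by (rule iso_into_K[OF A(1)])
  have "Dpair \<Phi> (M k) (\<lambda>i. g (a i)) (\<lambda>i. g (b i))"
    by (rule Dpair_ptp[OF rich\<Phi> k(3)[rule_format, OF conjI[OF ab]] A(3)]) (use k(2) ab in \<open>auto simp: image_subset_iff\<close>)
  moreover have "p = ptp L (M k) (\<lambda>i. g (a i)) (\<lambda>i. g (b i))"
    unfolding A(2) by (rule k(3)[rule_format, OF conjI[OF ab]])
  ultimately show ?thesis by (rule that[OF k(1)])
qed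

lemma tmap_Gset:
  assumes "p \<in> Gset L T \<Phi>" shows "tmap p \<in> Gset L' T' \<Psi>"
proof -
  obtain k a b where k: "k \<in> K" "Dpair \<Phi> (M k) a b" "p = ptp L (M k) a b" by (rule Gset_repr[OF assms])
  have "tmap p = ptp L' (N k) (F k a) (F k b)" unfolding k(3) by (rule tmap_ptp[OF k(1,2)])
  then show ?thesis using FD[OF k(1,2)] modN[OF k(1)] unfolding Gset_def Dpair_def by blast
qed

lemma Gset_Dpair:
  assumes "ptp L (M k) a b \<in> Gset L T \<Phi>" "range a \<subseteq> sdom (M k)" "range b \<subseteq> sdom (M k)"
  shows "Dpair \<Phi> (M k) a b"
proof -
  obtain l a' b' where "l \<in> K" "Dpair \<Phi> (M l) a' b'" "ptp L (M k) a b = ptp L (M l) a' b'"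
    by (rule Gset_repr[OF assms(1)])
  then show ?thesis using Dpair_ptp[OF rich\<Phi>] assms(2,3) by metis
qed

text \<open>The tuples witnessing the composition need not be those that witness membership in the
  groupoid; \<open>Gset_Dpair\<close> shows that they satisfy the same conditions.\<close>

lemma tmap_comp:
  assumes G: "p \<in> Gset L T \<Phi>" "q \<in> Gset L T \<Phi>" "r \<in> Gset L T \<Phi>" and c: "tp_comp L T p q r"
  shows "tp_comp L' T' (tmap p) (tmap q) (tmap r)"
proof -
  obtain A :: "nat struc" and a b c where A: "model L T A" "range a \<subseteq> sdom A" "range b \<subseteq> sdom A" "range c \<subseteq> sdom A"
    "p = ptp L A a b" "q = ptp L A b c" "r = ptp L A a c"
    using c unfolding tp_comp_def by blast
  obtain k g where k: "k \<in> K" "g ` sdom A \<subseteq> sdom (M k)"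
    "\<forall>a b. range a \<subseteq> sdom A \<and> range b \<subseteq> sdom A \<longrightarrow>
       ptp L A a b = ptp L (M k) (\<lambda>i. g (a i)) (\<lambda>i. g (b i))"
    by (rule iso_into_K[OF A(1)])
  let ?a = "\<lambda>i. g (a i)" and ?b = "\<lambda>i. g (b i)" and ?c = "\<lambda>i. g (c i)"
  have s: "range ?a \<subseteq> sdom (M k)" "range ?b \<subseteq> sdom (M k)" "range ?c \<subseteq> sdom (M k)"
    using k(2) A(2-4) by (auto simp: image_subset_iff)
  have e: "p = ptp L (M k) ?a ?b" "q = ptp L (M k) ?b ?c" "r = ptp L (M k) ?a ?c"
    using A k(3) by auto
  have D: "Dpair \<Phi> (M k) ?a ?b" "Dpair \<Phi> (M k) ?b ?c" "Dpair \<Phi> (M k) ?a ?c"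
    using Gset_Dpair G s unfolding e by blast+
  have "tmap p = ptp L' (N k) (F k ?a) (F k ?b)" "tmap q = ptp L' (N k) (F k ?b) (F k ?c)"
    "tmap r = ptp L' (N k) (F k ?a) (F k ?c)"
    unfolding e using tmap_ptp[OF k(1)] D by blast+
  moreover have "range (F k ?a) \<subseteq> sdom (N k)" "range (F k ?b) \<subseteq> sdom (N k)" "range (F k ?c) \<subseteq> sdom (N k)"
    using FD[OF k(1) D(1)] FD[OF k(1) D(2)] unfolding Dpair_def by blast+
  ultimately show ?thesis unfolding tp_comp_def using modN[OF k(1)] by blast
qed

lemma tmap_inv:
  assumes G: "p \<in> Gset L T \<Phi>" "q \<in> Gset L T \<Phi>" and c: "tp_inv L T p q"
  shows "tp_inv L' T' (tmap p) (tmap q)"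
proof -
  obtain A :: "nat struc" and a b where A: "model L T A" "range a \<subseteq> sdom A" "range b \<subseteq> sdom A"
    "p = ptp L A a b" "q = ptp L A b a"
    using c unfolding tp_inv_def by blast
  obtain k g where k: "k \<in> K" "g ` sdom A \<subseteq> sdom (M k)"
    "\<forall>a b. range a \<subseteq> sdom A \<and> range b \<subseteq> sdom A \<longrightarrow>
       ptp L A a b = ptp L (M k) (\<lambda>i. g (a i)) (\<lambda>i. g (b i))"
    by (rule iso_into_K[OF A(1)])
  let ?a = "\<lambda>i. g (a i)" and ?b = "\<lambda>i. g (b i)"
  have s: "range ?a \<subseteq> sdom (M k)" "range ?b \<subseteq> sdom (M k)" using k(2) A(2,3) by (auto simp: image_subset_iff)
  have e: "p = ptp L (M k) ?a ?b" "q = ptp L (M k) ?b ?a" using A k(3) by auto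
  have D: "Dpair \<Phi> (M k) ?a ?b" "Dpair \<Phi> (M k) ?b ?a"
    using Gset_Dpair G s unfolding e by blast+
  have "tmap p = ptp L' (N k) (F k ?a) (F k ?b)" "tmap q = ptp L' (N k) (F k ?b) (F k ?a)"
    unfolding e using tmap_ptp[OF k(1)] D by blast+
  moreover have "range (F k ?a) \<subseteq> sdom (N k)" "range (F k ?b) \<subseteq> sdom (N k)"
    using FD[OF k(1) D(1)] unfolding Dpair_def by blast+
  ultimately show ?thesis unfolding tp_inv_def using modN[OF k(1)] by blast
qed

end

section \<open>The topology and the groupoid isomorphism\<close>

lemma Gset_Stypes: "Gset L T \<Phi> \<subseteq> Stypes L T"
  unfolding Gset_def Stypes_def by blast

text \<open>A generated topology lives on the union of its generators. A tautology places every type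
  in one of them.\<close>

lemma ptp_Union: "ptp L M a b \<in> \<Union>{{p. \<phi> \<in> p} | \<phi>. wf_fm L \<phi>}"
proof -
  have "Eq (Var 0) (Var 0) \<in> ptp L M a b" "wf_fm L (Eq (Var 0) (Var 0))" by (auto simp: ptp_def)
  then show ?thesis by blast
qed

lemma gtop_G_Phi:
  "gtop (G_Phi L T \<Phi>) = subtopology (topology_generated_by {{p. \<phi> \<in> p} | \<phi>. wf_fm L \<phi>}) (Gset L T \<Phi>)"
  unfolding G_Phi_def logic_top_def using Gset_Stypes[of L T \<Phi>]
  by (simp add: subtopology_subtopology Int_absorb1)

lemma Gset_Union: "Gset L T \<Phi> \<subseteq> \<Union>{{p. \<phi> \<in> p} | \<phi>. wf_fm L \<phi>}"
proof
  fix p assume "p \<in> Gset L T \<Phi>"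
  then obtain M :: "nat struc" and a b where p: "p = ptp L M a b" unfolding Gset_def by blast
  show "p \<in> \<Union>{{p. \<phi> \<in> p} | \<phi>. wf_fm L \<phi>}" unfolding p by (rule ptp_Union)
qed

lemma topspace_G_Phi: "topspace (gtop (G_Phi L T \<Phi>)) = Gset L T \<Phi>"
  unfolding gtop_G_Phi topspace_subtopology topology_generated_by_topspace
  by (rule Int_absorb1[OF Gset_Union])

lemma (in type_map) tmap_continuous:
  "continuous_map (gtop (G_Phi L T \<Phi>)) (gtop (G_Phi L' T' \<Psi>)) tmap"
proof -
  let ?X = "gtop (G_Phi L T \<Phi>)"
  let ?B = "{{p. \<phi> \<in> p} | \<phi>. wf_fm L' \<phi>}"
  have G: "tmap ` Gset L T \<Phi> \<subseteq> Gset L' T' \<Psi>" using tmap_Gset by blast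
  have "continuous_map ?X (topology_generated_by ?B) tmap"
  proof (rule continuous_on_generated_topo)
    fix U assume "U \<in> ?B"
    then obtain \<psi> where \<psi>: "wf_fm L' \<psi>" "U = {p. \<psi> \<in> p}" by blast
    have "tmap -` U \<inter> topspace ?X = Gset L T \<Phi> \<inter> {p. tr \<psi> \<in> p}"
      unfolding topspace_G_Phi \<psi> tmap_def using \<psi>(1) by auto
    moreover have "openin (topology_generated_by {{p. \<phi> \<in> p} | \<phi>. wf_fm L \<phi>}) {p. tr \<psi> \<in> p}"
      by (rule topology_generated_by_Basis) (use tr_wf[OF \<psi>(1)] in blast)
    ultimately show "openin ?X (tmap -` U \<inter> topspace ?X)"
      unfolding gtop_G_Phi openin_subtopology by blast
  next
    show "tmap ` topspace ?X \<subseteq> \<Union>?B"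
      unfolding topspace_G_Phi by (rule subset_trans[OF G Gset_Union])
  qed
  then show ?thesis unfolding gtop_G_Phi[of L'] continuous_map_in_subtopology
    using G topspace_G_Phi by auto
qed

lemma type_maps_iso:
  assumes "type_map L L' T T' \<Phi> \<Psi> K M N F tr" "type_map L' L T' T \<Psi> \<Phi> K N M G tr'"
    and GF: "\<And>k a b. k \<in> K \<Longrightarrow> Dpair \<Phi> (M k) a b \<Longrightarrow> G k (F k a) = a"
    and FG: "\<And>k a b. k \<in> K \<Longrightarrow> Dpair \<Psi> (N k) a b \<Longrightarrow> F k (G k a) = a"
  shows "tgroupoid_isomorphic (G_Phi L T \<Phi>) (G_Phi L' T' \<Psi>)"
proof -
  interpret X: type_map L L' T T' \<Phi> \<Psi> K M N F tr by fact
  interpret Y: type_map L' L T' T \<Psi> \<Phi> K N M G tr' by fact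
  \<comment> \<open>For the swapped pair, the inverse laws \<open>GF\<close> and \<open>FG\<close>
    speak about the second tuple.\<close>
  have sw: "Dpair \<Phi> A b a" if "Dpair \<Phi> A a b" for \<Phi> A and a b :: "nat \<Rightarrow> nat"
    using that unfolding Dpair_def by auto
  have YX: "Y.tmap (X.tmap p) = p" if p: "p \<in> Gset L T \<Phi>" for p
  proof -
    obtain k a b where k: "k \<in> K" "Dpair \<Phi> (M k) a b" "p = ptp L (M k) a b" by (rule X.Gset_repr[OF p])
    show ?thesis unfolding k(3) X.tmap_ptp[OF k(1,2)] Y.tmap_ptp[OF k(1) X.FD[OF k(1,2)]]
      using GF[OF k(1,2)] GF[OF k(1) sw[OF k(2)]] by simp
  qed
  have XY: "X.tmap (Y.tmap p) = p" if p: "p \<in> Gset L' T' \<Psi>" for p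
  proof -
    obtain k a b where k: "k \<in> K" "Dpair \<Psi> (N k) a b" "p = ptp L' (N k) a b" by (rule Y.Gset_repr[OF p])
    show ?thesis unfolding k(3) Y.tmap_ptp[OF k(1,2)] X.tmap_ptp[OF k(1) Y.FD[OF k(1,2)]]
      using FG[OF k(1,2)] FG[OF k(1) sw[OF k(2)]] by simp
  qed
  have "homeomorphic_maps (gtop (G_Phi L T \<Phi>)) (gtop (G_Phi L' T' \<Psi>)) X.tmap Y.tmap"
    unfolding homeomorphic_maps_def topspace_G_Phi
    using X.tmap_continuous Y.tmap_continuous XY YX by simp
  then have h: "homeomorphic_map (gtop (G_Phi L T \<Phi>)) (gtop (G_Phi L' T' \<Psi>)) X.tmap"
    using homeomorphic_map_maps by blast
  \<comment> \<open>The converse implication is preservation by the inverse map.\<close>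
  have c: "tp_comp L T p q r \<longleftrightarrow> tp_comp L' T' (X.tmap p) (X.tmap q) (X.tmap r)"
    if "p \<in> Gset L T \<Phi>" "q \<in> Gset L T \<Phi>" "r \<in> Gset L T \<Phi>" for p q r
    using X.tmap_comp[OF that] Y.tmap_comp[of "X.tmap p" "X.tmap q" "X.tmap r"]
      X.tmap_Gset YX that by metis
  have i: "tp_inv L T p q \<longleftrightarrow> tp_inv L' T' (X.tmap p) (X.tmap q)"
    if "p \<in> Gset L T \<Phi>" "q \<in> Gset L T \<Phi>" for p q
    using X.tmap_inv[OF that] Y.tmap_inv[of "X.tmap p" "X.tmap q"] X.tmap_Gset YX that by metis
  have "tgroupoid_iso (G_Phi L T \<Phi>) (G_Phi L' T' \<Psi>) X.tmap"
    unfolding tgroupoid_iso_def topspace_G_Phi using h c i by (simp add: G_Phi_def)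
  then show ?thesis unfolding tgroupoid_isomorphic_def by blast
qed

text \<open>Interpreting twice gives a copy \<open>M2\<close> of \<open>M\<close>, with isomorphism
  \<open>\<beta>\<close>. Transporting the second coding along the inverse of \<open>\<beta>\<close>
  makes \<open>M\<close> itself the decoded structure and \<open>\<theta>\<close> the graph of the
  twofold decoding. This removes the discrepancy on the side of \<open>M\<close>; that on the side
  of \<open>N\<close> is dealt with in \<open>bicodeI\<close>.\<close>

lemma coherent_copy:
  assumes \<Gamma>: "is_interp L T L' T' \<Gamma>" and \<Delta>: "is_interp L' T' L T \<Delta>"
    and T: "\<And>\<phi>. \<phi> \<in> T \<Longrightarrow> sentence L \<phi>" and T': "\<And>\<phi>. \<phi> \<in> T' \<Longrightarrow> sentence L' \<phi>"
    and M: "model L T (M :: nat struc)" and di: "defines_iso L M \<Gamma> \<Delta> \<theta>"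
  obtains N :: "nat struc" and \<pi> \<pi>' where "model L' T' N" "codes L' \<Gamma> M N \<pi>" "codes L \<Delta> N M \<pi>'"
    "\<And>a w. a \<in> sdom M \<Longrightarrow> w ` {..<idim \<Gamma> * idim \<Delta>} \<subseteq> sdom M \<Longrightarrow>
       sat M (lasg (a # block (idim \<Gamma> * idim \<Delta>) w 0)) \<theta> \<longleftrightarrow>
       (\<forall>i<idim \<Delta>. block (idim \<Gamma>) w i \<in> idomset \<Gamma> M) \<and>
       block (idim \<Delta>) (\<lambda>i. \<pi> (block (idim \<Gamma>) w i)) 0 \<in> idomset \<Delta> N \<and>
       \<pi>' (block (idim \<Delta>) (\<lambda>i. \<pi> (block (idim \<Gamma>) w i)) 0) = a"
proof -
  note w\<Gamma> = is_interp_wf[OF \<Gamma>] and w\<Delta> = is_interp_wf[OF \<Delta>]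
  have d: "0 < idim \<Gamma>" "0 < idim \<Delta>" using w\<Gamma> w\<Delta> unfolding wf_interp_def by auto
  obtain N :: "nat struc" and \<pi> where N: "model L' T' N" "codes L' \<Gamma> M N \<pi>"
    by (rule interp_copy[OF \<Gamma> M T'])
  obtain M2 :: "nat struc" and \<pi>2 where M2: "model L T M2" "codes L \<Delta> N M2 \<pi>2"
    by (rule interp_copy[OF \<Delta> N(1) T])
  have st: "is_struc L M" "is_struc L' N" "is_struc L M2" using M N M2 unfolding model_def by auto
  obtain \<beta> where \<beta>: "struc_iso L M M2 \<beta>"
    "\<And>a w j. a \<in> sdom M \<Longrightarrow> w ` BL (idim \<Gamma> * idim \<Delta>) {j} \<subseteq> sdom M \<Longrightarrow>
       sat M (lasg (a # block (idim \<Gamma> * idim \<Delta>) w j)) \<theta> \<longleftrightarrow>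
         (\<forall>i\<in>BL (idim \<Delta>) {j}. block (idim \<Gamma>) w i \<in> idomset \<Gamma> M) \<and>
         block (idim \<Delta>) (\<lambda>i. \<pi> (block (idim \<Gamma>) w i)) j \<in> idomset \<Delta> N \<and>
         \<pi>2 (block (idim \<Delta>) (\<lambda>i. \<pi> (block (idim \<Gamma>) w i)) j) = \<beta> a"
    using defines_iso_block[OF di st(1) w\<Gamma> w\<Delta> N(2) st(2) M2(2) st(3)] by blast
  have bij: "inj_on \<beta> (sdom M)" "\<beta> ` sdom M = sdom M2" using \<beta>(1) unfolding struc_iso_def bij_betw_def by auto
  let ?h = "inv_into (sdom M) \<beta>"
  have h: "struc_iso L M2 M ?h" by (rule struc_iso_inv[OF \<beta>(1) st(1)])
  have c: "codes L \<Delta> N M (\<lambda>xs. ?h (\<pi>2 xs))" by (rule codes_iso_target[OF h st(3) M2(2)])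
  have B0: "BL e {0} = {..<e}" if "0 < e" for e
    using BL_add[OF that, of 0] by simp
  have eq: "?h (\<pi>2 xs) = a \<longleftrightarrow> \<pi>2 xs = \<beta> a" if "xs \<in> idomset \<Delta> N" "a \<in> sdom M" for xs a
  proof -
    have "\<pi>2 xs \<in> \<beta> ` sdom M" using M2(2) that(1) bij(2) unfolding codes_def by blast
    then show ?thesis using bij(1) that(2) by (metis f_inv_into_f inv_into_f_f)
  qed
  show ?thesis
  proof (rule that[OF N c])
    fix a w assume a: "a \<in> sdom M" and w: "w ` {..<idim \<Gamma> * idim \<Delta>} \<subseteq> sdom M"
    have "w ` BL (idim \<Gamma> * idim \<Delta>) {0} \<subseteq> sdom M" using w d by (simp add: B0)
    from \<beta>(2)[OF a this] eq[OF _ a] d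
    show "sat M (lasg (a # block (idim \<Gamma> * idim \<Delta>) w 0)) \<theta> \<longleftrightarrow>
       (\<forall>i<idim \<Delta>. block (idim \<Gamma>) w i \<in> idomset \<Gamma> M) \<and>
       block (idim \<Delta>) (\<lambda>i. \<pi> (block (idim \<Gamma>) w i)) 0 \<in> idomset \<Delta> N \<and>
       ?h (\<pi>2 (block (idim \<Delta>) (\<lambda>i. \<pi> (block (idim \<Gamma>) w i)) 0)) = a"
      by (auto simp: B0)
  qed
qed

text \<open>The translation is chosen formula by formula. Equality of the sets of entries is
  preserved by applying \<open>range_transfer\<close> in both directions.\<close>

lemma (in bicode) type_map_exists:
  assumes \<Phi>: "rich L \<Phi>" and \<Psi>: "rich L' \<Psi>"
    and modM: "\<And>k. k \<in> K \<Longrightarrow> model L T (M k)" and modN: "\<And>k. k \<in> K \<Longrightarrow> model L' T' (N k)"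
    and exM: "\<And>A :: nat struc. model L T A \<Longrightarrow> \<exists>k\<in>K. \<exists>g. struc_iso L A (M k) g"
    and p: "\<And>j. length (p j) = A.d" and q: "\<And>i. length (q i) = B.d"
    and p1: "\<And>k x j. k \<in> K \<Longrightarrow> range x \<subseteq> sdom (M k) \<Longrightarrow> realises_D (M k) \<Phi> x \<Longrightarrow> map x (p j) \<in> A.E k"
    and p2: "\<And>k x. k \<in> K \<Longrightarrow> range x \<subseteq> sdom (M k) \<Longrightarrow> realises_D (M k) \<Phi> x \<Longrightarrow>
       realises_D (N k) \<Psi> (\<lambda>j. \<pi> k (map x (p j)))"
    and p3: "\<And>k x. k \<in> K \<Longrightarrow> range x \<subseteq> sdom (M k) \<Longrightarrow> realises_D (M k) \<Phi> x \<Longrightarrow>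
       (\<lambda>i. \<pi>' k (map (\<lambda>j. \<pi> k (map x (p j))) (q i))) = x"
    and q1: "\<And>k y i. k \<in> K \<Longrightarrow> range y \<subseteq> sdom (N k) \<Longrightarrow> realises_D (N k) \<Psi> y \<Longrightarrow> map y (q i) \<in> B.E k"
  shows "\<exists>tr. type_map L L' T T' \<Phi> \<Psi> K M N (\<lambda>k x j. \<pi> k (map x (p j))) tr"
proof -
  define Q where "Q \<psi> \<phi> \<longleftrightarrow> wf_fm L \<phi> \<and>
     (\<forall>k\<in>K. \<forall>a b. range a \<subseteq> sdom (M k) \<and> range b \<subseteq> sdom (M k) \<and>
      realises_D (M k) \<Phi> a \<and> realises_D (M k) \<Phi> b \<longrightarrow>
      (sat (N k) (pair_asg (\<lambda>j. \<pi> k (map a (p j))) (\<lambda>j. \<pi> k (map b (p j)))) \<psi> \<longleftrightarrow>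
       sat (M k) (pair_asg a b) \<phi>))" for \<psi> \<phi>
  have "\<exists>\<phi>. Q \<psi> \<phi>" if "wf_fm L' \<psi>" for \<psi>
    unfolding Q_def by (rule type_transfer[OF p p1 that])
  then obtain tr where tr: "\<And>\<psi>. wf_fm L' \<psi> \<Longrightarrow> Q \<psi> (tr \<psi>)" by metis
  let ?F = "\<lambda>k x j. \<pi> k (map x (p j))"
  have "type_map L L' T T' \<Phi> \<Psi> K M N ?F tr"
  proof
    fix k a b assume k: "k \<in> K" and D: "Dpair \<Phi> (M k) a b"
    then have a: "range a \<subseteq> sdom (M k)" "realises_D (M k) \<Phi> a"
      and b: "range b \<subseteq> sdom (M k)" "realises_D (M k) \<Phi> b" and ab: "range a = range b"
      unfolding Dpair_def by auto
    have s: "range (?F k x) \<subseteq> sdom (N k)" if "range x \<subseteq> sdom (M k)" "realises_D (M k) \<Phi> x" for x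
      using p1[OF k that] A.sdom_N[OF k] by auto
    \<comment> \<open>By \<open>p3\<close>, \<open>x\<close> is decoded from its own image, which is
      the situation of \<open>range_transfer\<close>.\<close>
    have r: "range (?F k y) \<subseteq> range (?F k x)"
      if x: "range x \<subseteq> sdom (M k)" "realises_D (M k) \<Phi> x"
        and y: "range y \<subseteq> sdom (M k)" "realises_D (M k) \<Phi> y" and xy: "range y \<subseteq> range x" for x y
    proof
      fix z assume "z \<in> range (?F k y)"
      then obtain j where z: "z = \<pi> k (map y (p j))" by auto
      show "z \<in> range (?F k x)"
        unfolding z
      proof (rule range_transfer[OF \<Psi> k q s[OF x] p2[OF k x] q1[OF k s[OF x] p2[OF k x]]])
        show "x i = \<pi>' k (map (?F k x) (q i))" for i using fun_cong[OF p3[OF k x], of i] by simp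
        show "map y (p j) \<in> A.E k" by (rule p1[OF k y])
        show "set (map y (p j)) \<subseteq> range x" using xy by auto
      qed
    qed
    show "Dpair \<Psi> (N k) (?F k a) (?F k b)"
      unfolding Dpair_def using s[OF a] s[OF b] p2[OF k a] p2[OF k b] r[OF a b] r[OF b a] ab by auto
  next
    fix \<psi> k a b assume "wf_fm L' \<psi>" "k \<in> K" "Dpair \<Phi> (M k) a b"
    then show "sat (N k) (pair_asg (?F k a) (?F k b)) \<psi> \<longleftrightarrow> sat (M k) (pair_asg a b) (tr \<psi>)"
      using tr[of \<psi>] unfolding Dpair_def Q_def by blast
  next
    show "wf_fm L (tr \<psi>)" if "wf_fm L' \<psi>" for \<psi> using tr[OF that] unfolding Q_def by blast
  qed (fact \<Phi> modM modN exM)+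
  then show ?thesis by blast
qed

theorem theorem2p12:
  fixes L L' :: lang and T T' :: "fm set" and \<Phi> \<Psi> :: "nat \<Rightarrow> fm"
  assumes "complete_theory L T" and "no_singleton_models L T"
    and "complete_theory L' T'" and "no_singleton_models L' T'"
    and "bi_interpretable L T L' T'"
    and "rich L \<Phi>" and "rich L' \<Psi>"
  shows "tgroupoid_isomorphic (G_Phi L T \<Phi>) (G_Phi L' T' \<Psi>)"
proof -
  have T: "\<And>\<phi>. \<phi> \<in> T \<Longrightarrow> sentence L \<phi>" and T': "\<And>\<phi>. \<phi> \<in> T' \<Longrightarrow> sentence L' \<phi>"
    using assms(1,3) unfolding complete_theory_def by auto
  obtain \<Gamma> \<Delta> \<theta> \<theta>' where \<Gamma>: "is_interp L T L' T' \<Gamma>" and \<Delta>: "is_interp L' T' L T \<Delta>"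
    and \<theta>: "wf_fm L \<theta>" "fv \<theta> \<subseteq> {..<1 + idim \<Gamma> * idim \<Delta>}"
    and \<theta>': "wf_fm L' \<theta>'" "fv \<theta>' \<subseteq> {..<1 + idim \<Delta> * idim \<Gamma>}"
    and di: "\<And>M :: nat struc. model L T M \<Longrightarrow> defines_iso L M \<Gamma> \<Delta> \<theta>"
    and di': "\<And>N :: nat struc. model L' T' N \<Longrightarrow> defines_iso L' N \<Delta> \<Gamma> \<theta>'"
    using assms(5) unfolding bi_interpretable_def by blast
  \<comment> \<open>A coherent quadruple: both structures are models, each codes the other, and
    \<open>\<theta>\<close> defines the decoding on the first side without any twist.\<close>
  define P where "P M N \<pi> \<pi>' \<longleftrightarrow> model L T M \<and> model L' T' N \<and> codes L' \<Gamma> M N \<pi> \<and> codes L \<Delta> N M \<pi>' \<and>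
    (\<forall>a w. a \<in> sdom M \<and> w ` {..<idim \<Gamma> * idim \<Delta>} \<subseteq> sdom M \<longrightarrow>
       (sat M (lasg (a # block (idim \<Gamma> * idim \<Delta>) w 0)) \<theta> \<longleftrightarrow>
       (\<forall>i<idim \<Delta>. block (idim \<Gamma>) w i \<in> idomset \<Gamma> M) \<and>
       block (idim \<Delta>) (\<lambda>i. \<pi> (block (idim \<Gamma>) w i)) 0 \<in> idomset \<Delta> N \<and>
       \<pi>' (block (idim \<Delta>) (\<lambda>i. \<pi> (block (idim \<Gamma>) w i)) 0) = a))"
    for M N :: "nat struc" and \<pi> \<pi>' :: "nat list \<Rightarrow> nat"
  \<comment> \<open>All coherent quadruples form one index set, so the formulas found below are
    uniform over all of them.\<close>
  define K where "K = {k. case k of (M, N, \<pi>, \<pi>') \<Rightarrow> P M N \<pi> \<pi>'}"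
  define M where "M k = fst k" for k :: "nat struc \<times> nat struc \<times> (nat list \<Rightarrow> nat) \<times> (nat list \<Rightarrow> nat)"
  define N where "N k = fst (snd k)" for k :: "nat struc \<times> nat struc \<times> (nat list \<Rightarrow> nat) \<times> (nat list \<Rightarrow> nat)"
  define \<pi> where "\<pi> k = fst (snd (snd k))" for k :: "nat struc \<times> nat struc \<times> (nat list \<Rightarrow> nat) \<times> (nat list \<Rightarrow> nat)"
  define \<pi>' where "\<pi>' k = snd (snd (snd k))" for k :: "nat struc \<times> nat struc \<times> (nat list \<Rightarrow> nat) \<times> (nat list \<Rightarrow> nat)"
  have K: "P (M k) (N k) (\<pi> k) (\<pi>' k)" if "k \<in> K" for k
    using that unfolding K_def M_def N_def \<pi>_def \<pi>'_def by (simp add: case_prod_beta)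
  have modM: "model L T (M k)" and modN: "model L' T' (N k)" if "k \<in> K" for k
    using K[OF that] unfolding P_def by blast+
  have copy: "\<exists>k\<in>K. M k = A" if A: "model L T A" for A :: "nat struc"
  proof (rule coherent_copy[OF \<Gamma> \<Delta> T T' A di[OF A]])
    fix N' :: "nat struc" and \<rho> \<rho>' assume "model L' T' N'" "codes L' \<Gamma> A N' \<rho>" "codes L \<Delta> N' A \<rho>'"
      "\<And>a w. a \<in> sdom A \<Longrightarrow> w ` {..<idim \<Gamma> * idim \<Delta>} \<subseteq> sdom A \<Longrightarrow>
       sat A (lasg (a # block (idim \<Gamma> * idim \<Delta>) w 0)) \<theta> \<longleftrightarrow>
       (\<forall>i<idim \<Delta>. block (idim \<Gamma>) w i \<in> idomset \<Gamma> A) \<and>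
       block (idim \<Delta>) (\<lambda>i. \<rho> (block (idim \<Gamma>) w i)) 0 \<in> idomset \<Delta> N' \<and>
       \<rho>' (block (idim \<Delta>) (\<lambda>i. \<rho> (block (idim \<Gamma>) w i)) 0) = a"
    then have "P A N' \<rho> \<rho>'" unfolding P_def using A by simp
    then have "(A, N', \<rho>, \<rho>') \<in> K" unfolding K_def by simp
    then show ?thesis unfolding M_def by force
  qed
  have exM: "\<exists>k\<in>K. \<exists>g. struc_iso L A (M k) g" if "model L T A" for A :: "nat struc"
    using copy[OF that] struc_iso_id by metis
  \<comment> \<open>A model \<open>A\<close> of \<open>T'\<close> need not be the second component
    of a quadruple. But it interprets a model \<open>B\<close> of \<open>T\<close>, and the second
    component attached to \<open>B\<close> is isomorphic to \<open>A\<close> because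
    \<open>\<theta>'\<close> defines an isomorphism from \<open>A\<close> onto its double
    interpretation.\<close>
  have exN: "\<exists>k\<in>K. \<exists>g. struc_iso L' A (N k) g" if A: "model L' T' A" for A :: "nat struc"
  proof -
    obtain B :: "nat struc" and \<rho> where B: "model L T B" "codes L \<Delta> A B \<rho>"
      by (rule interp_copy[OF \<Delta> A T])
    obtain k where k: "k \<in> K" "M k = B" using copy[OF B(1)] by blast
    have c: "codes L' \<Gamma> B (N k) (\<pi> k)" using K[OF k(1)] unfolding P_def k(2) by blast
    have st: "is_struc L' A" "is_struc L B" "is_struc L' (N k)"
      using A B(1) modN[OF k(1)] unfolding model_def by auto
    obtain \<beta> where "struc_iso L' A (N k) \<beta>"
      by (rule defines_iso_codes[OF di'[OF A] st(1) is_interp_wf[OF \<Gamma>] B(2) st(2) c st(3)])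
    then show ?thesis using k(1) by blast
  qed
  have "pairs L L' \<Gamma> \<Delta> K M N \<pi> \<pi>'"
  proof
    show "wf_interp L L' \<Gamma>" "wf_interp L' L \<Delta>" using is_interp_wf \<Gamma> \<Delta> by blast+
    fix k assume k: "k \<in> K"
    show "codes L' \<Gamma> (M k) (N k) (\<pi> k)" "codes L \<Delta> (N k) (M k) (\<pi>' k)"
      using K[OF k] unfolding P_def by blast+
    show "is_struc L' (N k)" "is_struc L (M k)"
      using modM[OF k] modN[OF k] unfolding model_def by blast+
  qed
  then have "bicode L L' \<Gamma> \<Delta> K M N \<pi> \<pi>'"
  proof (rule bicodeI[OF _ \<theta> \<theta>'])
    show "defines_iso L' (N k) \<Delta> \<Gamma> \<theta>'" if "k \<in> K" for k by (rule di'[OF modN[OF that]])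
  next
    fix k a w assume k: "k \<in> K" and a: "a \<in> sdom (M k)" "w ` {..<idim \<Gamma> * idim \<Delta>} \<subseteq> sdom (M k)"
    then show "sat (M k) (lasg (a # block (idim \<Gamma> * idim \<Delta>) w 0)) \<theta> \<longleftrightarrow>
       (\<forall>i<idim \<Delta>. block (idim \<Gamma>) w i \<in> idomset \<Gamma> (M k)) \<and>
       block (idim \<Delta>) (\<lambda>i. \<pi> k (block (idim \<Gamma>) w i)) 0 \<in> idomset \<Delta> (N k) \<and>
       \<pi>' k (block (idim \<Delta>) (\<lambda>i. \<pi> k (block (idim \<Gamma>) w i)) 0) = a"
      using K[OF k] unfolding P_def by blast
  qed
  then interpret X: bicode L L' \<Gamma> \<Delta> K M N \<pi> \<pi>' .
  interpret Y: bicode L' L \<Delta> \<Gamma> K N M \<pi>' \<pi> by (rule bicode_sym) (rule X.bicode_axioms)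
  show ?thesis
  proof (rule X.bijection[OF assms(6,7)])
    fix p q
    assume p: "\<And>j. length (p j) = idim \<Gamma>" and q: "\<And>i. length (q i) = idim \<Delta>"
      and p1: "\<And>k x j. k \<in> K \<Longrightarrow> range x \<subseteq> sdom (M k) \<Longrightarrow> realises_D (M k) \<Phi> x \<Longrightarrow> map x (p j) \<in> idomset \<Gamma> (M k)"
      and p2: "\<And>k x. k \<in> K \<Longrightarrow> range x \<subseteq> sdom (M k) \<Longrightarrow> realises_D (M k) \<Phi> x \<Longrightarrow>
       realises_D (N k) \<Psi> (\<lambda>j. \<pi> k (map x (p j)))"
      and p3: "\<And>k x. k \<in> K \<Longrightarrow> range x \<subseteq> sdom (M k) \<Longrightarrow> realises_D (M k) \<Phi> x \<Longrightarrow>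
       (\<lambda>i. \<pi>' k (map (\<lambda>j. \<pi> k (map x (p j))) (q i))) = x"
      and q1: "\<And>k y i. k \<in> K \<Longrightarrow> range y \<subseteq> sdom (N k) \<Longrightarrow> realises_D (N k) \<Psi> y \<Longrightarrow> map y (q i) \<in> idomset \<Delta> (N k)"
      and q2: "\<And>k y. k \<in> K \<Longrightarrow> range y \<subseteq> sdom (N k) \<Longrightarrow> realises_D (N k) \<Psi> y \<Longrightarrow>
       realises_D (M k) \<Phi> (\<lambda>i. \<pi>' k (map y (q i)))"
      and q3: "\<And>k y. k \<in> K \<Longrightarrow> range y \<subseteq> sdom (N k) \<Longrightarrow> realises_D (N k) \<Psi> y \<Longrightarrow>
       (\<lambda>j. \<pi> k (map (\<lambda>i. \<pi>' k (map y (q i))) (p j))) = y"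
    obtain tr where tr: "type_map L L' T T' \<Phi> \<Psi> K M N (\<lambda>k x j. \<pi> k (map x (p j))) tr"
      using X.type_map_exists[OF assms(6,7) modM modN exM p q p1 p2 p3 q1] by blast
    \<comment> \<open>The inverse direction is the same construction with the two sides
      exchanged.\<close>
    obtain tr' where tr': "type_map L' L T' T \<Psi> \<Phi> K N M (\<lambda>k y i. \<pi>' k (map y (q i))) tr'"
      using Y.type_map_exists[OF assms(7,6) modN modM exN q p q1 q2 q3 p1] by blast
    show ?thesis
      by (rule type_maps_iso[OF tr tr']) (auto simp: Dpair_def p3 q3)
  qed
qed

end
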